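(* Let $P_0\in H^3(\mathbb R)\cap W^{2,1}(\mathbb R)$ be such that $XP_0\in H^3(\mathbb R)$ and $\widehat{P_0}(0)\ne0$, and let $0<\mu\le\mu_{\max}$. Let $$\zeta_R(t,X)=-\frac{it}2\int_{\mathbb R}\xi\,\omega(\sqrt\mu\,\xi)\,\widehat{P_0}(\xi)\,e^{-it\xi\omega(\sqrt\mu\,\xi)}e^{iX\xi}\,d\xi .$$ Then $$|\zeta_R(t,\cdot)|_\infty\le C(\mu_{\max})\sqrt{\frac t\mu}\left(|P_0|_{H^3}+|P_0|_{L^1}+|XP_0|_{H^3}\right),$$ and $$\liminf_{t\to+\infty}\left|\frac1{\sqrt t}\zeta_R(t,\cdot)\right|_\infty\ge C(P_0)>0,$$ where $C(\mu_{\max})$ depends only on $\mu_{\max}$ and $C(P_0)$ only on $P_0$.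
   Context: $\omega(\xi)=\sqrt{\frac{\tanh\xi}{\xi}}$ (with $\omega(0)=1$), $\widehat{P_0}$ is the Fourier transform of the real-valued function $P_0$ on $\mathbb R$, $XP_0$ denotes the function $X\mapsto XP_0(X)$, $|\cdot|_\infty$ is the $L^\infty(\mathbb R)$ norm, $t>0$.
   Formalization: The lower-bound constant C(P_0) may also depend on μ_max (it is uniform in 0<μ≤μ_max); a constant depending on P_0 alone for every μ_max is impossible, since for Gaussian P_0 the liminf is O(μ^{-1/8}) as μ→∞. *)

theory Defs
  imports "HOL-Analysis.Analysis" "HOL-Probability.Essential_Supremum"
begin

definition Lp :: "real \<Rightarrow> (real \<Rightarrow> real) \<Rightarrow> bool" where
  "Lp p f \<longleftrightarrow> f \<in> borel_measurable lebesgue \<and> integrable lebesgue (\<lambda>x. \<bar>f x\<bar> powr p)"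

definition Lp_norm :: "real \<Rightarrow> (real \<Rightarrow> real) \<Rightarrow> real" where
  "Lp_norm p f = (LINT x|lebesgue. \<bar>f x\<bar> powr p) powr (1 / p)"

text \<open>The value is an extended real: it is infinite if \<^term>\<open>f\<close> is not essentially bounded.\<close>

definition Linf_norm :: "(real \<Rightarrow> complex) \<Rightarrow> ereal" where
  "Linf_norm f = esssup lebesgue (\<lambda>x. ereal (norm (f x)))"

definition test_function :: "(real \<Rightarrow> real) \<Rightarrow> bool" where
  "test_function \<phi> \<longleftrightarrow>
     (\<forall>n x. (deriv ^^ n) \<phi> field_differentiable at x) \<and>
     (\<exists>R. \<forall>x. \<bar>x\<bar> > R \<longrightarrow> \<phi> x = 0)"

definition locally_integrable :: "(real \<Rightarrow> real) \<Rightarrow> bool" where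
  "locally_integrable f \<longleftrightarrow> (\<forall>R. set_integrable lebesgue {-R..R} f)"

definition weak_deriv :: "nat \<Rightarrow> (real \<Rightarrow> real) \<Rightarrow> (real \<Rightarrow> real) \<Rightarrow> bool" where
  "weak_deriv k f g \<longleftrightarrow>
     locally_integrable f \<and> locally_integrable g \<and>
     (\<forall>\<phi>. test_function \<phi> \<longrightarrow>
        (LINT x|lebesgue. f x * (deriv ^^ k) \<phi> x) = (- 1) ^ k * (LINT x|lebesgue. g x * \<phi> x))"

definition sobolev :: "nat \<Rightarrow> real \<Rightarrow> (real \<Rightarrow> real) \<Rightarrow> bool" where
  "sobolev k p f \<longleftrightarrow> Lp p f \<and> (\<forall>j\<le>k. \<exists>g. weak_deriv j f g \<and> Lp p g)"

text \<open>Weak derivatives are unique up to null sets, so the norm does not depend on the choice made by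
  \<open>SOME\<close>.\<close>

definition sobolev_norm :: "nat \<Rightarrow> real \<Rightarrow> (real \<Rightarrow> real) \<Rightarrow> real" where
  "sobolev_norm k p f = (\<Sum>j\<le>k. Lp_norm p (SOME g. weak_deriv j f g) powr p) powr (1 / p)"

abbreviation H3 :: "(real \<Rightarrow> real) \<Rightarrow> bool" where
  "H3 \<equiv> sobolev 3 2"

abbreviation H3_norm :: "(real \<Rightarrow> real) \<Rightarrow> real" where
  "H3_norm \<equiv> sobolev_norm 3 2"

text \<open>Any other normalisation of the Fourier transform by a constant factor only rescales the
  constants in the estimates.\<close>

definition fourier :: "(real \<Rightarrow> real) \<Rightarrow> real \<Rightarrow> complex" where
  "fourier f \<xi> = (LINT x|lebesgue. complex_of_real (f x) * exp (- (\<i> * complex_of_real (x * \<xi>))))"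

definition \<omega> :: "real \<Rightarrow> real" where
  "\<omega> \<xi> = (if \<xi> = 0 then 1 else sqrt (tanh \<xi> / \<xi>))"

definition zeta_R :: "real \<Rightarrow> (real \<Rightarrow> real) \<Rightarrow> real \<Rightarrow> real \<Rightarrow> complex" where
  "zeta_R \<mu> P\<^sub>0 t X =
     - (\<i> * complex_of_real t / 2) *
     (LINT \<xi>|lebesgue.
        complex_of_real (\<xi> * \<omega> (sqrt \<mu> * \<xi>)) * fourier P\<^sub>0 \<xi> *
        exp (- (\<i> * complex_of_real (t * \<xi> * \<omega> (sqrt \<mu> * \<xi>)))) *
        exp (\<i> * complex_of_real (X * \<xi>)))"

end

theory Submission
  imports Defs "HOL-Probability.Probability"
begin

text \<open>
  Put \<open>f = P\<^sub>0 - P\<^sub>0''\<close>, so that \<open>f \<in> L\<^sup>1\<close> and \<open>fourier P\<^sub>0 \<xi> = fourier f \<xi> / (1 + \<xi>\<^sup>2)\<close>, and write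
  \<open>\<phi> \<xi> = \<xi> \<omega> (sqrt \<mu> \<xi>)\<close>. Then \<open>\<zeta>\<^sub>R\<close> is \<open>- i t / 2\<close> times the convolution of \<open>f\<close> with
  \<open>K X = \<integral> \<phi> / (1 + \<xi>\<^sup>2) exp (i (X \<xi> - t \<phi>)) d\<xi>\<close>. On \<open>\<xi> > 0\<close> one has \<open>- \<phi>'' \<ge> c \<mu> \<phi> / (1 + \<xi>\<^sup>2)\<close>:
  the amplitude of \<open>K\<close> is dominated by the second derivative of its phase, although both degenerate
  at \<open>0\<close> and at infinity. A van der Corput argument with this weight gives \<open>|K| \<le> C / sqrt (t \<mu>)\<close>,
  hence the upper bound, since \<open>X P\<^sub>0'' = (X P\<^sub>0)'' - 2 P\<^sub>0'\<close> lies in \<open>L\<^sup>2\<close> and so controls \<open>P\<^sub>0''\<close>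
  in \<open>L\<^sup>1\<close>.

  For the lower bound \<open>\<zeta>\<^sub>R\<close> is tested against a Gaussian wave packet of unit mass, spatial width of
  order \<open>sqrt t\<close> and frequency \<open>x0 > 0\<close> with \<open>fourier P\<^sub>0 x0 \<noteq> 0\<close>, centred at \<open>t \<phi>' x0\<close>. After rescaling
  frequencies by \<open>sqrt t\<close> the phase is bounded by a quadratic, so the pairing is at least
  \<open>c sqrt t\<close> and no stationary phase expansion is needed.
\<close>

section \<open>A weighted van der Corput estimate\<close>

text \<open>The factor \<open>1 / (1 + \<xi>^2)\<close> does two things. The bare amplitude
  \<open>\<phi>\<close> grows like the square root of \<xi>, so without it the kernel integral would
  not converge absolutely. It also aligns the degeneracies: near 0 the amplitude behaves like \<xi>
  and \<open>- \<phi>''\<close> like \<open>\<mu> * \<xi>\<close>, while at infinity both decay like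
  the power -3/2 of \<xi>. A lower bound on \<open>\<phi>''\<close> alone, as in the classical
  estimate, is impossible, but the quotient of the two stays bounded below. The price is a factor
  \<open>1 + \<mu>max\<close>, from comparing \<open>1 + \<mu> * \<xi>^2\<close> with
  \<open>1 + \<xi>^2\<close>. In the lower bound the frequency 0 is useless although
  \<open>fourier P 0\<close> does not vanish, because \<open>\<phi>\<close> does; continuity
  provides a usable frequency \<open>x0 > 0\<close>. The constant has to serve all
  \<open>\<mu> \<le> \<mu>max\<close> at once, so \<open>x0\<close> is chosen from the data alone,
  and the amplitude at \<open>x0\<close> and the curvature of the phase are estimated through
  \<open>\<mu>max\<close> only. The packet width is the scale at which the quadratic part of the
  phase is of order one: enough cancellation is then excluded by an elementary bound on the
  cosine.\<close>

text \<open>Instead of cutting at \<open>|p| = \<delta>\<close>, the integrand is split smoothly: the part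
  \<open>p\<^sup>2 / (p\<^sup>2 + \<delta>\<^sup>2)\<close> is integrated by parts, the rest is at most \<open>p' \<delta>\<^sup>2 / (\<kappa> (p\<^sup>2 + \<delta>\<^sup>2))\<close>,
  the derivative of an arctangent.\<close>
lemma vdc_weighted:
  fixes m m' p p' \<psi> :: "real \<Rightarrow> real"
  assumes ab: "a \<le> b" and \<kappa>: "\<kappa> > 0" and \<delta>: "\<delta> > 0"
    and dm: "\<And>x. x \<in> {a..b} \<Longrightarrow> (m has_real_derivative m' x) (at x)"
    and d\<psi>: "\<And>x. x \<in> {a..b} \<Longrightarrow> (\<psi> has_real_derivative p x) (at x)"
    and dp: "\<And>x. x \<in> {a..b} \<Longrightarrow> (p has_real_derivative p' x) (at x)"
    and cm': "continuous_on {a..b} m'" and cp': "continuous_on {a..b} p'"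
    and m0: "\<And>x. x \<in> {a..b} \<Longrightarrow> 0 \<le> m x" and mM: "\<And>x. x \<in> {a..b} \<Longrightarrow> m x \<le> M"
    and mp: "\<And>x. x \<in> {a..b} \<Longrightarrow> \<kappa> * m x \<le> p' x"
    and V: "integral {a..b} (\<lambda>x. \<bar>m' x\<bar>) \<le> V"
  shows "norm (integral {a..b} (\<lambda>x. of_real (m x) * cis (\<psi> x)))
    \<le> pi * \<delta> / \<kappa> + (M + V / 2 + pi * M) / \<delta>"
proof -
  define D where "D x = (p x)\<^sup>2 + \<delta>\<^sup>2" for x
  have Dpos: "D x > 0" for x using \<delta> by (simp add: D_def add_nonneg_pos)
  have cm: "continuous_on {a..b} m" and c\<psi>: "continuous_on {a..b} \<psi>" and cp: "continuous_on {a..b} p"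
    using DERIV_isCont[OF dm] DERIV_isCont[OF d\<psi>] DERIV_isCont[OF dp]
    by (auto intro!: continuous_at_imp_continuous_on)
  \<comment> \<open>\<open>p / D\<close> takes the place of \<open>1 / p\<close> in the classical
    integration by parts. It stays below \<open>1 / (2 * \<delta>)\<close> even where
    \<open>p\<close> vanishes, so stationary points need no separate treatment.\<close>
  define G where "G x = of_real (m x * (p x / D x)) * cis (\<psi> x)" for x
  define G' where "G' x = of_real (m' x * (p x / D x) + m x * ((\<delta>\<^sup>2 - (p x)\<^sup>2) / (D x)\<^sup>2 * p' x)) * cis (\<psi> x)
      + of_real (m x * (p x / D x)) * (of_real (p x) * (\<i> * cis (\<psi> x)))" for x
  have dG: "(G has_vector_derivative G' x) (at x within {a..b})" if x: "x \<in> {a..b}" for x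
  proof -
    have "((\<lambda>x. m x * (p x / D x)) has_real_derivative
        (m' x * (p x / D x) + m x * ((\<delta>\<^sup>2 - (p x)\<^sup>2) / (D x)\<^sup>2 * p' x))) (at x)"
    proof (rule DERIV_mult'[OF dm[OF x] , THEN DERIV_cong])
      have "((\<lambda>x. p x / ((p x)\<^sup>2 + \<delta>\<^sup>2)) has_real_derivative
          (p' x * D x - p x * (2 * p x * p' x)) / (D x * D x)) (at x)"
        using Dpos[of x] by (auto intro!: derivative_eq_intros dp[OF x] simp: D_def)
      also have "(p' x * D x - p x * (2 * p x * p' x)) / (D x * D x) = (\<delta>\<^sup>2 - (p x)\<^sup>2) / (D x)\<^sup>2 * p' x"
        by (simp add: D_def algebra_simps power2_eq_square)
      finally show "((\<lambda>x. p x / D x) has_real_derivative (\<delta>\<^sup>2 - (p x)\<^sup>2) / (D x)\<^sup>2 * p' x) (at x)"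
        unfolding D_def .
    qed simp
    then have 1: "((\<lambda>x. complex_of_real (m x * (p x / D x))) has_vector_derivative
        of_real (m' x * (p x / D x) + m x * ((\<delta>\<^sup>2 - (p x)\<^sup>2) / (D x)\<^sup>2 * p' x))) (at x)"
      using has_real_derivative_iff_has_vector_derivative has_vector_derivative_of_real by blast
    have 2: "((\<lambda>x. cis (\<psi> x)) has_vector_derivative of_real (p x) * (\<i> * cis (\<psi> x))) (at x)"
    proof -
      have "(cis has_vector_derivative \<i> * cis (\<psi> x)) (at (\<psi> x))"
        unfolding cis_conv_exp
        by (rule has_vector_derivative_eq_rhs, rule has_vector_derivative_real_field)
           (auto intro!: derivative_eq_intros)
      from vector_diff_chain_at[OF d\<psi>[OF x, unfolded has_real_derivative_iff_has_vector_derivative] this]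
      show ?thesis by (simp add: o_def scaleR_conv_of_real)
    qed
    show ?thesis
      using has_vector_derivative_mult[OF 1 2] has_vector_derivative_at_within
      unfolding G_def G'_def by (fastforce simp: algebra_simps)
  qed
  have intG: "(G' has_integral (G b - G a)) {a..b}"
    by (rule fundamental_theorem_of_calculus[OF ab]) (rule dG)
  have qb: "\<bar>p x / D x\<bar> \<le> 1 / (2 * \<delta>)" for x
  proof -
    have "0 \<le> (\<bar>p x\<bar> - \<delta>)\<^sup>2" by simp
    then have "2 * \<delta> * \<bar>p x\<bar> \<le> D x" by (simp add: D_def power2_eq_square algebra_simps)
    then have "\<bar>p x\<bar> \<le> 1 / (2 * \<delta>) * D x" using \<delta> by (simp add: pos_le_divide_eq mult.commute)
    then show ?thesis using Dpos[of x] by (simp only: abs_divide abs_of_pos pos_divide_le_eq)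
  qed
  have Gb: "norm (G x) \<le> M / (2 * \<delta>)" if "x \<in> {a..b}" for x
    using mult_mono[OF mM[OF that] qb[of x]] m0[OF that] mM[OF that]
    by (simp add: G_def norm_mult norm_divide abs_mult)
  define A where "A = (\<lambda>x. arctan (p x / \<delta>) / \<delta>)"
  have dA: "(A has_real_derivative p' x / D x) (at x)" if "x \<in> {a..b}" for x
  proof -
    have "(A has_real_derivative inverse (1 + (p x / \<delta>)\<^sup>2) * (p' x / \<delta>) / \<delta>) (at x)"
      unfolding A_def
      by (rule DERIV_cdivide DERIV_chain2[OF DERIV_arctan] dp[OF that])+
    moreover have "1 + (p x / \<delta>)\<^sup>2 = D x / \<delta>\<^sup>2"
      using \<delta> by (simp add: D_def power_divide add_divide_distrib)
    ultimately show ?thesis using \<delta> by (simp add: power2_eq_square)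
  qed
  have intA: "((\<lambda>x. p' x / D x) has_integral (A b - A a)) {a..b}"
    by (rule fundamental_theorem_of_calculus[OF ab])
       (metis dA has_field_derivative_at_within has_real_derivative_iff_has_vector_derivative)
  \<comment> \<open>The bounded range of arctan makes this independent of the size of
    \<open>p\<close> and of the length of the interval.\<close>
  have Ab: "A b - A a \<le> pi / \<delta>"
  proof -
    have "arctan (p b / \<delta>) - arctan (p a / \<delta>) \<le> pi"
      using arctan_bounded[of "p b / \<delta>"] arctan_bounded[of "p a / \<delta>"] by linarith
    then show ?thesis using \<delta> by (simp add: A_def divide_right_mono flip: diff_divide_distrib)
  qed
  define F where "F = (\<lambda>x. of_real (m x) * cis (\<psi> x))"
  have cF: "continuous_on {a..b} F" unfolding F_def cis_conv_exp
    by (intro continuous_intros cm c\<psi>)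
  have intF: "F integrable_on {a..b}" using cF integrable_continuous_real by blast
  define R where "R = (\<lambda>x. \<bar>m' x\<bar> / (2 * \<delta>) + (M + \<delta>\<^sup>2 / \<kappa>) * (p' x / D x))"
  have iabs: "(\<lambda>x. \<bar>m' x\<bar>) integrable_on {a..b}"
    by (intro integrable_continuous_real continuous_intros cm')
  have intR: "(R has_integral (integral {a..b} (\<lambda>x. \<bar>m' x\<bar>) / (2 * \<delta>) + (M + \<delta>\<^sup>2 / \<kappa>) * (A b - A a))) {a..b}"
    unfolding R_def
    by (intro has_integral_add has_integral_mult_right has_integral_divide intA)
       (use iabs in \<open>simp add: integrable_integral\<close>)
  have M0: "0 \<le> M" using m0[of a] mM[of a] ab by force
  \<comment> \<open>Differentiating \<open>cis\<close> in \<open>G\<close> produces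
    \<open>\<i> * m * p^2 / D\<close>, so adding \<open>\<i> * G'\<close> cancels the part
    \<open>m * p^2 / D\<close> of \<open>m\<close>. What remains is
    \<open>m * \<delta>^2 / D\<close> and the derivative of the factor
    \<open>m * p / D\<close>.\<close>
  have bound: "norm (F x + \<i> * G' x) \<le> R x" if x: "x \<in> {a..b}" for x
  proof -
    have "F x + \<i> * G' x = cis (\<psi> x) * (of_real (m x * \<delta>\<^sup>2 / D x)
       + \<i> * of_real (m' x * (p x / D x)) + \<i> * of_real (m x * ((\<delta>\<^sup>2 - (p x)\<^sup>2) / (D x)\<^sup>2 * p' x)))"
    proof -
      have "complex_of_real (m x) = of_real (m x * \<delta>\<^sup>2 / D x) + of_real (m x * (p x / D x) * p x)"
      proof -
        have "m x * \<delta>\<^sup>2 / D x + m x * (p x / D x) * p x = m x * D x / D x"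
          unfolding D_def by (simp add: add_divide_distrib distrib_left power2_eq_square)
        then have "m x = m x * \<delta>\<^sup>2 / D x + m x * (p x / D x) * p x" using Dpos[of x] by simp
        then show ?thesis by (metis of_real_add)
      qed
      then have "F x = (of_real (m x * \<delta>\<^sup>2 / D x) + of_real (m x * (p x / D x) * p x)) * cis (\<psi> x)"
        unfolding F_def by (rule arg_cong)
      then show ?thesis unfolding G'_def by (simp add: algebra_simps)
    qed
    also have "norm \<dots> \<le> m x * \<delta>\<^sup>2 / D x + \<bar>m' x * (p x / D x)\<bar> + \<bar>m x * ((\<delta>\<^sup>2 - (p x)\<^sup>2) / (D x)\<^sup>2 * p' x)\<bar>"
      unfolding norm_mult norm_cis mult_1
      apply (rule order_trans[OF norm_triangle_ineq])
      apply (rule add_mono)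
       apply (rule order_trans[OF norm_triangle_ineq])
      using m0[OF x] Dpos[of x]
      by (auto simp: norm_mult norm_divide abs_mult simp flip: of_real_diff of_real_power of_real_mult of_real_divide)
    also have "\<dots> \<le> R x"
    proof -
      \<comment> \<open>Monotonicity of \<open>p\<close> is what allows \<open>p' / D\<close> to
        majorize both the unintegrated part and the term with the derivative of
        \<open>p / D\<close>.\<close>
      have p'0: "0 \<le> p' x" using mp[OF x] m0[OF x] \<kappa>
        by (metis order_trans less_imp_le mult_nonneg_nonneg)
      have 1: "m x * \<delta>\<^sup>2 / D x \<le> \<delta>\<^sup>2 / \<kappa> * (p' x / D x)"
      proof -
        have "m x \<le> p' x / \<kappa>" using mp[OF x] \<kappa> by (simp add: field_simps)
        then have "m x * (\<delta>\<^sup>2 / D x) \<le> p' x / \<kappa> * (\<delta>\<^sup>2 / D x)"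
          using Dpos[of x] by (intro mult_right_mono) auto
        then show ?thesis by (simp add: field_simps)
      qed
      have 2: "\<bar>m' x * (p x / D x)\<bar> \<le> \<bar>m' x\<bar> / (2 * \<delta>)"
        using mult_left_mono[OF qb[of x], of "\<bar>m' x\<bar>"] by (simp add: abs_mult)
      have "\<bar>\<delta>\<^sup>2 - (p x)\<^sup>2\<bar> \<le> D x"
        using zero_le_power2[of "p x"] zero_le_power2[of \<delta>] unfolding D_def abs_le_iff by linarith
      then have "\<bar>(\<delta>\<^sup>2 - (p x)\<^sup>2) / (D x)\<^sup>2\<bar> \<le> 1 / D x"
        using Dpos[of x] by (simp add: field_simps power2_eq_square)
      then have 3: "\<bar>m x * ((\<delta>\<^sup>2 - (p x)\<^sup>2) / (D x)\<^sup>2 * p' x)\<bar> \<le> M * (p' x / D x)"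
      proof -
        assume h: "\<bar>(\<delta>\<^sup>2 - (p x)\<^sup>2) / (D x)\<^sup>2\<bar> \<le> 1 / D x"
        have "\<bar>(\<delta>\<^sup>2 - (p x)\<^sup>2) / (D x)\<^sup>2\<bar> * p' x \<le> 1 / D x * p' x"
          by (rule mult_right_mono[OF h p'0])
        then have "m x * (\<bar>(\<delta>\<^sup>2 - (p x)\<^sup>2) / (D x)\<^sup>2\<bar> * p' x) \<le> M * (1 / D x * p' x)"
          by (rule mult_mono[OF mM[OF x] _ M0]) (use p'0 in simp)
        then show ?thesis using m0[OF x] p'0 by (simp add: abs_mult)
      qed
      show ?thesis unfolding R_def distrib_right using 1 2 3 by linarith
    qed
    finally show ?thesis .
  qed
  have "norm (integral {a..b} (\<lambda>x. F x + \<i> * G' x)) \<le> integral {a..b} R"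
    using intF intG intR
    by (intro integral_norm_bound_integral bound) (auto intro!: integrable_add simp: has_integral_integrable_integral)
  also have "integral {a..b} (\<lambda>x. F x + \<i> * G' x) = integral {a..b} F + \<i> * (G b - G a)"
    using intF intG by (subst integral_add) (auto simp: has_integral_integrable_integral)
  finally have "norm (integral {a..b} F + \<i> * (G b - G a)) \<le> integral {a..b} R" .
  then have "norm (integral {a..b} F) \<le> integral {a..b} R + norm (\<i> * (G b - G a))"
    by (smt (verit) norm_diff_ineq)
  also have "norm (\<i> * (G b - G a)) \<le> M / (2 * \<delta>) + M / (2 * \<delta>)"
    using Gb[of a] Gb[of b] ab norm_triangle_ineq4[of "G b" "G a"] by (simp add: norm_mult)
  also have "integral {a..b} R \<le> V / (2 * \<delta>) + (M + \<delta>\<^sup>2 / \<kappa>) * (pi / \<delta>)"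
    using intR V \<delta> M0 \<kappa> Ab
    unfolding integral_unique[OF intR] by (intro add_mono mult_left_mono divide_right_mono) auto
  finally show ?thesis using \<delta> \<kappa> unfolding F_def
    by (simp add: field_simps power2_eq_square)
qed

section \<open>The dispersion relation\<close>

text \<open>The dispersion relation of linear water waves at unit depth. Computations go through its
  square \<open>y * tanh y\<close>.\<close>

definition disp :: "real \<Rightarrow> real" where "disp y = sqrt (y * tanh y)"
definition disp1 :: "real \<Rightarrow> real" where "disp1 y = (tanh y + y * (1 - (tanh y)\<^sup>2)) / (2 * disp y)"
text \<open>The numerator from the quotient rule is regrouped by means of
  \<open>disp^2 = y * tanh y\<close>, so that concavity can be read off from the signs.\<close>

definition disp2 :: "real \<Rightarrow> real" where
  "disp2 y = - ((tanh y - y * (1 - (tanh y)\<^sup>2))\<^sup>2 + 4 * y\<^sup>2 * (tanh y)\<^sup>2 * (1 - (tanh y)\<^sup>2)) / (4 * disp y ^ 3)"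

lemma disp_eq: "disp = (\<lambda>y. sqrt (y * tanh y))" by (rule ext) (rule disp_def)
lemma disp1_eq: "disp1 = (\<lambda>y. (tanh y + y * (1 - (tanh y)\<^sup>2)) / (2 * disp y))" by (rule ext) (rule disp1_def)

lemma tanh_le_self: "tanh y \<le> y" if "y \<ge> 0" for y :: real
proof -
  have "(\<lambda>x. x - tanh x) 0 \<le> (\<lambda>x. x - tanh x) y"
  proof (rule DERIV_nonneg_imp_nondecreasing[OF that])
    fix x :: real
    show "\<exists>d. ((\<lambda>x. x - tanh x) has_real_derivative d) (at x) \<and> 0 \<le> d"
      by (rule exI[of _ "(tanh x)\<^sup>2"]) (auto intro!: derivative_eq_intros)
  qed
  then show ?thesis by simp
qed

text \<open>The difference of the two sides has derivative
  \<open>2 * x * tanh x * (1 - (tanh x)^2)\<close>, which is nonnegative. Besides bounding the group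
  velocity, this controls both terms of \<open>disp2\<close>.\<close>

lemma mult_sech2_le_tanh: "y * (1 - (tanh y)\<^sup>2) \<le> tanh y" if "y \<ge> 0" for y :: real
proof -
  let ?f = "\<lambda>x::real. tanh x - x * (1 - (tanh x)\<^sup>2)"
  have "?f 0 \<le> ?f y"
  proof (rule DERIV_nonneg_imp_nondecreasing[OF that])
    fix x :: real assume "0 \<le> x"
    moreover have "(?f has_real_derivative 2 * x * tanh x * (1 - (tanh x)\<^sup>2)) (at x)"
      by (auto intro!: derivative_eq_intros simp: algebra_simps power2_eq_square)
    moreover have "(tanh x)\<^sup>2 \<le> 1"
      using tanh_real_bounds[of x] by (simp add: abs_square_le_1 abs_le_iff)
    ultimately show "\<exists>d. (?f has_real_derivative d) (at x) \<and> 0 \<le> d"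
      by (intro exI[of _ "2 * x * tanh x * (1 - (tanh x)\<^sup>2)"]) auto
  qed
  then show ?thesis by simp
qed

text \<open>This is \<open>exp (2 * y) \<ge> 1 + 2 * y\<close> in disguise. It later bounds the
  phase from below uniformly in \<mu>.\<close>

lemma tanh_lower: "y / (1 + y) \<le> tanh y" if "y \<ge> 0" for y :: real
proof -
  define E where "E = exp (- 2 * y)"
  have E0: "0 < E" by (simp add: E_def)
  have "(1 + 2 * y) * E \<le> exp (2 * y) * E"
    using exp_ge_add_one_self[of "2 * y"] E0 by (intro mult_right_mono) auto
  also have "exp (2 * y) * E = 1" by (simp add: E_def flip: exp_add)
  finally have "y * (1 + E) \<le> (1 - E) * (1 + y)" by (simp add: algebra_simps)
  then have "y \<le> (1 - E) * (1 + y) / (1 + E)" using E0 by (simp only: pos_le_divide_eq add_pos_pos zero_less_one)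
  also have "\<dots> = tanh y * (1 + y)" by (simp add: tanh_real_altdef E_def)
  finally show ?thesis using that by (simp add: pos_divide_le_eq)
qed

context
  fixes y :: real assumes y: "y > 0"
begin

lemma disp_pos: "disp y > 0" using y by (simp add: disp_def)
lemma disp_sq: "(disp y)\<^sup>2 = y * tanh y" using y by (simp add: disp_def)
lemma sech2_pos: "0 < 1 - (tanh y)\<^sup>2"
  using tanh_real_bounds[of y] by (simp add: abs_square_less_1 abs_less_iff)

lemma disp_deriv: "(disp has_real_derivative disp1 y) (at y)"
proof -
  have "y * tanh y > 0" using y by simp
  have "((\<lambda>y. y * tanh y) has_real_derivative tanh y + y * (1 - (tanh y)\<^sup>2)) (at y)"
    by (auto intro!: derivative_eq_intros)
  from DERIV_chain2[where g = "\<lambda>y. y * tanh y" and f = sqrt,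
      OF DERIV_real_sqrt[OF \<open>y * tanh y > 0\<close>] this]
  have "(disp has_real_derivative inverse (disp y) / 2 * (tanh y + y * (1 - (tanh y)\<^sup>2))) (at y)"
    by (simp only: disp_eq)
  moreover have "inverse g / 2 * N = N / (2 * g)" for g N :: real
    by (simp add: inverse_eq_divide)
  ultimately show ?thesis unfolding disp1_def by (simp only: )
qed

lemma disp1_deriv: "(disp1 has_real_derivative disp2 y) (at y)"
proof -
  let ?T = "tanh y" and ?S = "1 - (tanh y)\<^sup>2" and ?g = "disp y"
  have "((\<lambda>y. (tanh y + y * (1 - (tanh y)\<^sup>2)) / (2 * disp y)) has_real_derivative
     ((2 * ?S - 2 * y * ?T * ?S) * (2 * ?g) - (?T + y * ?S) * (2 * disp1 y)) / (2 * ?g)\<^sup>2) (at y)"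
  proof -
    have N: "((\<lambda>y. tanh y + y * (1 - (tanh y)\<^sup>2)) has_real_derivative 2 * ?S - 2 * y * ?T * ?S) (at y)"
      by (auto intro!: derivative_eq_intros)
    show ?thesis unfolding power2_eq_square[of "2 * ?g"]
      using DERIV_divide[OF N DERIV_cmult[OF disp_deriv], of 2] disp_pos by simp
  qed
  moreover have "((2 * ?S - 2 * y * ?T * ?S) * (2 * ?g) - (?T + y * ?S) * (2 * disp1 y)) / (2 * ?g)\<^sup>2 = disp2 y"
  proof -
    have "((2 * ?S - 2 * y * ?T * ?S) * (2 * ?g) - (?T + y * ?S) * (2 * disp1 y)) / (2 * ?g)\<^sup>2
      = ((2 * ?S - 2 * y * ?T * ?S) * (2 * ?g\<^sup>2) - (?T + y * ?S)\<^sup>2) / (4 * ?g ^ 3)"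
    proof -
      have "(A * (2 * g) - B * (2 * (B / (2 * g)))) / (2 * g)\<^sup>2 = (A * (2 * g\<^sup>2) - B\<^sup>2) / (4 * g ^ 3)"
        if "g > 0" for A B g :: real
        using that by (simp add: field_simps power2_eq_square power3_eq_cube)
      from this[OF disp_pos] show ?thesis unfolding disp1_def .
    qed
    also have "\<dots> = disp2 y" unfolding disp2_def disp_sq
    proof (rule arg_cong[where f="\<lambda>z. z / _"])
      have "(2 * S - 2 * y * T * S) * (2 * (y * T)) - (T + y * S)\<^sup>2 = - ((T - y * S)\<^sup>2 + 4 * y\<^sup>2 * T\<^sup>2 * S)"
        for S T :: real
        by (simp add: algebra_simps power2_eq_square)
      from this[of ?S ?T]
      show "(2 * ?S - 2 * y * ?T * ?S) * (2 * (y * ?T)) - (?T + y * ?S)\<^sup>2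
        = - ((?T - y * ?S)\<^sup>2 + 4 * y\<^sup>2 * ?T\<^sup>2 * ?S)" .
    qed
    finally show ?thesis .
  qed
  ultimately show ?thesis by (simp only: disp1_eq)
qed

text \<open>The group velocity never exceeds the long-wave speed 1, because
  \<open>y * (1 - (tanh y)^2) \<le> tanh y \<le> disp y\<close>.\<close>

lemma disp1_bounds: "0 \<le> disp1 y" "disp1 y \<le> 1"
proof -
  have T0: "0 < tanh y" using y by simp
  show "0 \<le> disp1 y" unfolding disp1_def using y sech2_pos disp_pos T0 by (intro divide_nonneg_pos add_nonneg_nonneg mult_nonneg_nonneg) auto
  have "tanh y \<le> disp y"
    unfolding disp_def using y tanh_le_self[of y] T0
    by (intro real_le_rsqrt) (simp add: power2_eq_square)
  then show "disp1 y \<le> 1" unfolding disp1_def using mult_sech2_le_tanh[of y] y disp_pos by (simp add: field_simps)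
qed

text \<open>Up to a positive factor, \<open>-disp2\<close> is a sum of two nonnegative terms: the second
  dominates where \<open>sech\<^sup>2 y\<close> is not small, the first one elsewhere.\<close>
lemma disp2_upper: "disp y / 16 \<le> - disp2 y * (1 + y\<^sup>2)"
proof -
  let ?T = "tanh y" and ?S = "1 - (tanh y)\<^sup>2" and ?g = "disp y"
  have T0: "0 < ?T" "?T < 1" using y tanh_real_lt_1[of y] by auto
  have key: "y\<^sup>2 * ?T\<^sup>2 \<le> 4 * ((?T - y * ?S)\<^sup>2 + 4 * y\<^sup>2 * ?T\<^sup>2 * ?S) * (1 + y\<^sup>2)"
  \<comment> \<open>Above the threshold the second term alone gives
    \<open>2 * y^2 * (tanh y)^2\<close>. Below it, \<open>tanh y \<ge> 7/8\<close> and
    \<open>y * ?S \<le> 1/16\<close>, so the first square is at least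
    \<open>(tanh y / 2)^2\<close>.\<close>
  proof (cases "?S * (1 + y\<^sup>2) \<ge> 1 / 8")
    case True
    have "y\<^sup>2 * ?T\<^sup>2 * 1 \<le> y\<^sup>2 * ?T\<^sup>2 * (16 * (?S * (1 + y\<^sup>2)))"
      using True by (intro mult_left_mono) auto
    also have "\<dots> \<le> 4 * ((?T - y * ?S)\<^sup>2 + 4 * y\<^sup>2 * ?T\<^sup>2 * ?S) * (1 + y\<^sup>2)"
      by (simp add: algebra_simps)
    finally show ?thesis by simp
  next
    case False
    have S8: "?S \<le> 1 / 8"
    proof -
      have "?S * 1 \<le> ?S * (1 + y\<^sup>2)" using sech2_pos by (intro mult_left_mono) auto
      then show ?thesis using False by (simp only: mult_1_right not_le)
    qed
    have "2 * y \<le> 1 + y\<^sup>2" using zero_le_power2[of "y - 1"] by (simp add: power2_eq_square algebra_simps)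
    then have "?S * (2 * y) \<le> ?S * (1 + y\<^sup>2)" using sech2_pos by (intro mult_left_mono) auto
    then have yS: "y * ?S \<le> 1 / 16" using False by (simp add: mult.commute)
    have "?T\<^sup>2 \<le> ?T" using T0 power_decreasing[of 1 2 ?T] by simp
    then have "7/8 \<le> ?T" using S8 by simp
    then have "?T / 2 \<le> ?T - y * ?S" using yS by linarith
    then have "(?T / 2)\<^sup>2 \<le> (?T - y * ?S)\<^sup>2" using T0 by (intro power_mono) auto
    then have "?T\<^sup>2 \<le> 4 * (?T - y * ?S)\<^sup>2" by (simp add: power_divide)
    also have "\<dots> \<le> 4 * ((?T - y * ?S)\<^sup>2 + 4 * y\<^sup>2 * ?T\<^sup>2 * ?S)" using sech2_pos by simp
    finally have "?T\<^sup>2 * y\<^sup>2 \<le> 4 * ((?T - y * ?S)\<^sup>2 + 4 * y\<^sup>2 * ?T\<^sup>2 * ?S) * (1 + y\<^sup>2)"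
      by (rule mult_mono) (use sech2_pos in auto)
    then show ?thesis by (simp add: mult.commute)
  qed
  have g4: "?g * (4 * ?g ^ 3) = 4 * (y\<^sup>2 * ?T\<^sup>2)"
  proof -
    have "?g * (4 * ?g ^ 3) = 4 * (?g\<^sup>2)\<^sup>2" by (simp add: power2_eq_square power3_eq_cube)
    then show ?thesis unfolding disp_sq power_mult_distrib .
  qed
  have "disp y / 16 = ?g * (4 * ?g ^ 3) / (64 * ?g ^ 3)" using disp_pos by simp
  also have "\<dots> = (y\<^sup>2 * ?T\<^sup>2) / (16 * ?g ^ 3)" unfolding g4 by simp
  also have "\<dots> \<le> (4 * ((?T - y * ?S)\<^sup>2 + 4 * y\<^sup>2 * ?T\<^sup>2 * ?S) * (1 + y\<^sup>2)) / (16 * ?g ^ 3)"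
    using key disp_pos by (intro divide_right_mono) auto
  also have "\<dots> = - disp2 y * (1 + y\<^sup>2)"
  proof -
    have "4 * N * c / (16 * d) = - (- N / (4 * d)) * c" for N c d :: real by simp
    then show ?thesis unfolding disp2_def .
  qed
  finally show ?thesis .
qed

text \<open>Both numerator terms are compared with \<open>disp y ^ 3\<close> through
  \<open>y * (tanh y)^2 \<le> disp y ^ 3\<close>. The bound is crude near 0, but it is only applied
  at frequencies bounded away from 0.\<close>

lemma disp2_abs: "\<bar>disp2 y\<bar> \<le> 1 / (4 * y) + 1"
proof -
  let ?T = "tanh y" and ?S = "1 - (tanh y)\<^sup>2" and ?g = "disp y"
  have T0: "0 < ?T" "?T < 1" using y tanh_real_lt_1[of y] by auto
  have Tg: "?T \<le> ?g" unfolding disp_def using y tanh_le_self[of y] T0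
    by (intro real_le_rsqrt) (simp add: power2_eq_square)
  have yS: "0 \<le> y * ?S" "y * ?S \<le> ?T" using y sech2_pos mult_sech2_le_tanh[of y] by auto
  have 1: "(?T - y * ?S)\<^sup>2 \<le> ?T\<^sup>2" using yS by (intro power_mono) auto
  have "y * ?T\<^sup>2 = ?g\<^sup>2 * ?T" unfolding disp_sq by (simp add: power2_eq_square)
  also have "\<dots> \<le> ?g\<^sup>2 * ?g" using Tg by (intro mult_left_mono) auto
  finally have 2: "y * ?T\<^sup>2 \<le> ?g ^ 3" by (simp add: power2_eq_square power3_eq_cube)
  have "y\<^sup>2 * ?T\<^sup>2 * ?S = (y * ?T\<^sup>2) * (y * ?S)" by (simp add: power2_eq_square)
  also have "\<dots> \<le> ?g ^ 3 * 1" using 2 yS T0 disp_pos by (intro mult_mono) auto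
  finally have 3: "y\<^sup>2 * ?T\<^sup>2 * ?S \<le> ?g ^ 3" by simp
  have "?T\<^sup>2 \<le> ?g ^ 3 / y" using 2 y by (simp add: field_simps)
  then have "(?T - y * ?S)\<^sup>2 \<le> ?g ^ 3 / y" using 1 by (rule order_trans[rotated])
  moreover have "4 * y\<^sup>2 * ?T\<^sup>2 * ?S \<le> 4 * ?g ^ 3" using 3 by (simp only: mult.assoc mult_le_cancel_left_pos zero_less_numeral)
  ultimately have N: "(?T - y * ?S)\<^sup>2 + 4 * y\<^sup>2 * ?T\<^sup>2 * ?S \<le> ?g ^ 3 / y + 4 * ?g ^ 3" by (rule add_mono)
  have "0 \<le> (?T - y * ?S)\<^sup>2 + 4 * y\<^sup>2 * ?T\<^sup>2 * ?S"
    using sech2_pos by (intro add_nonneg_nonneg mult_nonneg_nonneg) auto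
  then have "\<bar>disp2 y\<bar> = ((?T - y * ?S)\<^sup>2 + 4 * y\<^sup>2 * ?T\<^sup>2 * ?S) / (4 * ?g ^ 3)"
    unfolding disp2_def abs_divide abs_minus using disp_pos by (simp only: abs_of_nonneg) simp
  also have "\<dots> \<le> (?g ^ 3 / y + 4 * ?g ^ 3) / (4 * ?g ^ 3)"
    using disp_pos by (intro divide_right_mono[OF N]) simp
  also have "\<dots> = 1 / (4 * y) + 1" using disp_pos y by (simp add: add_divide_distrib)
  finally show ?thesis .
qed

end

section \<open>The phase, the amplitude and the oscillatory kernel\<close>

definition phase :: "real \<Rightarrow> real \<Rightarrow> real" where "phase \<mu> x = x * \<omega> (sqrt \<mu> * x)"

lemma omega_even: "\<omega> (- x) = \<omega> x"
  by (simp add: \<omega>_def)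

lemma phase_minus: "phase \<mu> (- x) = - phase \<mu> x"
  by (simp add: phase_def omega_even)

lemma omega_bounds: "0 \<le> \<omega> x" "\<omega> x \<le> 1"
proof -
  have *: "0 \<le> \<omega> x \<and> \<omega> x \<le> 1" if "x > 0" for x
    using that tanh_le_self[of x] by (simp add: \<omega>_def)
  show "0 \<le> \<omega> x" "\<omega> x \<le> 1"
    using *[of x] *[of "- x"] omega_even[of x] by (cases "x > 0"; cases "x = 0"; auto simp: \<omega>_def)+
qed

lemma abs_phase_le: "\<bar>phase \<mu> x\<bar> \<le> \<bar>x\<bar>"
  using omega_bounds[of "sqrt \<mu> * x"] by (simp add: phase_def abs_mult mult_left_le)

text \<open>At 0 the quotient \<open>tanh h / h\<close> is a difference quotient of tanh, whose
  limit 1 agrees with the value prescribed there.\<close>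

lemma isCont_omega: "isCont \<omega> x"
proof (cases "x = 0")
  case True
  have "((\<lambda>h. (tanh (0 + h) - tanh 0) / h) \<longlongrightarrow> 1 - (tanh (0::real))\<^sup>2) (at 0)"
    by (rule DERIV_D) (auto intro!: derivative_eq_intros)
  then have "((\<lambda>h::real. sqrt (tanh h / h)) \<longlongrightarrow> sqrt 1) (at 0)"
    by (intro tendsto_real_sqrt) simp
  then have "(\<omega> \<longlongrightarrow> sqrt 1) (at 0)"
    by (rule Lim_transform_eventually) (auto simp: \<omega>_def eventually_at_filter)
  then show ?thesis using True by (simp add: isCont_def \<omega>_def)
next
  case False
  have "isCont (\<lambda>x. sqrt (tanh x / x)) x"
    using False by (intro continuous_intros) auto
  moreover have "\<forall>\<^sub>F y in nhds x. \<omega> y = sqrt (tanh y / y)"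
    using t1_space_nhds[OF False] by eventually_elim (simp add: \<omega>_def)
  ultimately show ?thesis using isCont_cong[of \<omega> "\<lambda>x. sqrt (tanh x / x)" x] by simp
qed

lemma continuous_on_omega [continuous_intros]:
  "continuous_on S f \<Longrightarrow> continuous_on S (\<lambda>x. \<omega> (f x))"
  using continuous_on_compose2[of UNIV \<omega> S f] isCont_omega
  by (auto simp: continuous_at_imp_continuous_on)

lemma continuous_on_phase [continuous_intros]:
  "continuous_on S f \<Longrightarrow> continuous_on S (\<lambda>x. phase \<mu> (f x))"
  unfolding phase_def by (intro continuous_intros)

lemma borel_measurable_phase [measurable]: "phase \<mu> \<in> borel_measurable borel"
  by (intro borel_measurable_continuous_onI continuous_intros)

definition amplitude :: "real \<Rightarrow> real \<Rightarrow> real" where "amplitude \<mu> x = phase \<mu> x / (1 + x\<^sup>2)"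

lemma borel_measurable_amplitude [measurable]: "amplitude \<mu> \<in> borel_measurable borel"
  unfolding amplitude_def by measurable

definition osc_kernel :: "real \<Rightarrow> real \<Rightarrow> real \<Rightarrow> real \<Rightarrow> complex" where
  "osc_kernel \<mu> t X x = of_real (amplitude \<mu> x) * cis (X * x - t * phase \<mu> x)"

lemma borel_measurable_osc_kernel [measurable]: "osc_kernel \<mu> t X \<in> borel_measurable borel"
  unfolding osc_kernel_def cis_conv_exp by measurable

lemma one_plus_sq_pos: "0 < 1 + (x::real)\<^sup>2" "1 + x\<^sup>2 \<noteq> 0"
proof -
  show "0 < 1 + x\<^sup>2" by (rule add_pos_nonneg) auto
  then show "1 + x\<^sup>2 \<noteq> 0" by linarith
qed

lemma arctan_integral:
  fixes a b :: real assumes "a \<le> b"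
  shows "((\<lambda>x. 1 / (1 + x\<^sup>2)) has_integral (arctan b - arctan a)) {a..b}"
  using assms
  by (intro fundamental_theorem_of_calculus)
     (auto intro!: derivative_eq_intros simp: inverse_eq_divide simp flip: has_real_derivative_iff_has_vector_derivative)

context
  fixes \<mu> :: real assumes \<mu>: "\<mu> > 0"
begin

text \<open>Restricted to \<open>x > 0\<close> because \<open>disp\<close> is even while
  \<open>phase\<close> is odd. All derivative formulas below therefore live on the positive half
  line.\<close>

lemma phase_eq_disp: "x > 0 \<Longrightarrow> phase \<mu> x = disp (sqrt \<mu> * x) / sqrt \<mu>"
proof -
  assume x: "x > 0"
  define y where "y = sqrt \<mu> * x"
  have y: "y > 0" using x \<mu> by (simp add: y_def)
  have "disp y = sqrt (y\<^sup>2 * (tanh y / y))" using y by (simp add: disp_def power2_eq_square)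
  also have "\<dots> = y * \<omega> y" using y by (simp only: real_sqrt_mult real_sqrt_abs \<omega>_def) simp
  finally show ?thesis using \<mu> by (simp add: phase_def y_def)
qed

text \<open>The deep-water regime, from \<open>tanh y < 1\<close>. The linear bound on the phase
  would leave an amplitude of order \<open>1 / \<bar>x\<bar>\<close>, which is not
  integrable.\<close>

lemma phase_sqrt_bound: "\<bar>phase \<mu> x\<bar> \<le> sqrt \<bar>x\<bar> / sqrt (sqrt \<mu>)"
proof -
  have *: "phase \<mu> x \<le> sqrt x / sqrt (sqrt \<mu>) \<and> phase \<mu> x > 0" if x: "x > 0" for x
  proof -
    define y where "y = sqrt \<mu> * x"
    have y: "y > 0" using x \<mu> by (simp add: y_def)
    have "disp y \<le> sqrt y"
      using y tanh_real_lt_1[of y] unfolding disp_def by (intro real_sqrt_le_mono) simp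
    then have "phase \<mu> x \<le> sqrt y / sqrt \<mu>"
      using \<mu> phase_eq_disp[OF x] by (simp add: y_def divide_right_mono)
    also have "\<dots> = sqrt x / sqrt (sqrt \<mu>)"
    proof -
      define s where "s = sqrt (sqrt \<mu>)"
      have "s > 0" "sqrt \<mu> = s * s" "sqrt y = s * sqrt x"
        using \<mu> by (simp_all add: s_def y_def real_sqrt_mult)
      then show ?thesis by (simp flip: s_def)
    qed
    finally show ?thesis using phase_eq_disp[OF x] disp_pos[OF y] \<mu> by (simp add: y_def)
  qed
  show ?thesis
    using *[of x] *[of "- x"] phase_minus[of \<mu> x] by (cases "x > 0"; cases "x = 0"; simp add: phase_def)
qed

lemma phase_pos: "x > 0 \<Longrightarrow> phase \<mu> x > 0"
  using phase_eq_disp disp_pos[of "sqrt \<mu> * x"] \<mu> by simp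

lemma phase_deriv:
  assumes x: "x > 0"
  shows "(phase \<mu> has_real_derivative disp1 (sqrt \<mu> * x)) (at x)"
proof -
  have y: "sqrt \<mu> * x > 0" using x \<mu> by simp
  have "((\<lambda>x. disp (sqrt \<mu> * x)) has_real_derivative disp1 (sqrt \<mu> * x) * sqrt \<mu>) (at x)"
    by (rule DERIV_chain2[where g = "\<lambda>x. sqrt \<mu> * x", OF disp_deriv[OF y]]) (auto intro!: derivative_eq_intros)
  then have "((\<lambda>x. disp (sqrt \<mu> * x) / sqrt \<mu>) has_real_derivative disp1 (sqrt \<mu> * x)) (at x)"
    using DERIV_cdivide[of _ _ x UNIV "sqrt \<mu>"] \<mu> by fastforce
  then show ?thesis
    by (rule DERIV_cong_ev[THEN iffD1, OF refl _ refl, rotated])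
       (use eventually_nhds_in_open[of "{0<..}" x] x phase_eq_disp in \<open>auto elim!: eventually_mono\<close>)
qed

lemma phase_deriv2:
  assumes x: "x > 0"
  shows "((\<lambda>x. disp1 (sqrt \<mu> * x)) has_real_derivative sqrt \<mu> * disp2 (sqrt \<mu> * x)) (at x)"
proof -
  have y: "sqrt \<mu> * x > 0" using x \<mu> by simp
  have "((\<lambda>x. disp1 (sqrt \<mu> * x)) has_real_derivative disp2 (sqrt \<mu> * x) * sqrt \<mu>) (at x)"
    by (rule DERIV_chain2[where g = "\<lambda>x. sqrt \<mu> * x", OF disp1_deriv[OF y]]) (auto intro!: derivative_eq_intros)
  then show ?thesis by (simp add: mult.commute)
qed

lemma continuous_disp2: "continuous_on {a..b} (\<lambda>x. disp2 (sqrt \<mu> * x))" if "a > 0"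
proof -
  have y: "sqrt \<mu> * x > 0" if "x \<in> {a..b}" for x using that \<open>a > 0\<close> \<mu> by simp
  have "continuous_on {a..b} (\<lambda>x. disp (sqrt \<mu> * x))"
    unfolding disp_def by (intro continuous_intros) auto
  then show ?thesis unfolding disp2_def
    using disp_pos[OF y] by (intro continuous_intros) (auto simp: less_imp_neq[symmetric])
qed

section \<open>Integrability of the amplitude and the uniform kernel bound\<close>

lemma integrable_amplitude: "integrable lborel (amplitude \<mu>)"
proof -
  \<comment> \<open>A multiple of the power -3/2 of \<open>1 + x\<close>: it has the decay of the
    amplitude, no singularity at 0, and an elementary antiderivative. The 2 comes from
    \<open>(1 + u)^2 \<le> 2 * (1 + u^2)\<close>.\<close>
  define h where "h x = 2 / sqrt (sqrt \<mu>) * (1 / ((1 + x) * sqrt (1 + x)))" for x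
  have hb: "\<bar>amplitude \<mu> x\<bar> \<le> h \<bar>x\<bar>" for x
  proof -
    define u where "u = \<bar>x\<bar>"
    have u: "u \<ge> 0" by (simp add: u_def)
    have "sqrt u * ((1 + u) * sqrt (1 + u)) \<le> sqrt (1 + u) * ((1 + u) * sqrt (1 + u))"
      using u by (intro mult_right_mono) auto
    also have "\<dots> = (1 + u) * (sqrt (1 + u))\<^sup>2" by (simp only: power2_eq_square mult.left_commute)
    also have "\<dots> = (1 + u) * (1 + u)" using u by simp
    also have "\<dots> \<le> 2 * (1 + u\<^sup>2)"
      using zero_le_power2[of "u - 1"] by (simp add: power2_eq_square algebra_simps)
    finally have "sqrt u / (1 + u\<^sup>2) \<le> 2 / ((1 + u) * sqrt (1 + u))"
      using u one_plus_sq_pos[of u] by (simp add: pos_divide_le_eq pos_le_divide_eq mult.commute)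
    then have "sqrt u / (1 + u\<^sup>2) / sqrt (sqrt \<mu>) \<le> 2 / ((1 + u) * sqrt (1 + u)) / sqrt (sqrt \<mu>)"
      using \<mu> by (intro divide_right_mono) auto
    moreover have "\<bar>amplitude \<mu> x\<bar> \<le> (sqrt u / sqrt (sqrt \<mu>)) / (1 + u\<^sup>2)"
    proof -
      have "\<bar>phase \<mu> x\<bar> / (1 + x\<^sup>2) \<le> (sqrt \<bar>x\<bar> / sqrt (sqrt \<mu>)) / (1 + x\<^sup>2)"
        by (rule divide_right_mono[OF phase_sqrt_bound]) simp
      then show ?thesis
        by (simp only: amplitude_def u_def abs_divide power2_abs abs_of_pos[OF one_plus_sq_pos(1)])
    qed
    ultimately show ?thesis unfolding h_def u_def[symmetric] by (simp add: mult.commute)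
  qed
  have ih: "integrable lborel (\<lambda>x. indicator {0..} x * h x)"
  proof -
    have "(\<integral>\<^sup>+x. ennreal (1 / ((1 + x) * sqrt (1 + x))) * indicator {0..} x \<partial>lborel) = ennreal (0 - (- 2 / sqrt (1 + 0)))"
    proof (rule nn_integral_FTC_atLeast[where F = "\<lambda>x. - 2 / sqrt (1 + x)" and T = 0 and a = 0])
      show "((\<lambda>x::real. - 2 / sqrt (1 + x)) \<longlongrightarrow> 0) at_top"
        by real_asymp
      show "((\<lambda>x. - 2 / sqrt (1 + x)) has_real_derivative 1 / ((1 + x) * sqrt (1 + x))) (at x)" if "0 \<le> x" for x :: real
      proof -
        define s where "s = sqrt (1 + x)"
        have s: "s > 0" "1 + x = s * s" using that by (simp_all add: s_def)
        have "((\<lambda>x. 1 + x) has_real_derivative 1) (at x)" by (auto intro!: derivative_eq_intros)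
        from DERIV_chain2[where g = "\<lambda>x. 1 + x" and f = sqrt, OF DERIV_real_sqrt this]
        have D: "((\<lambda>x. sqrt (1 + x)) has_real_derivative inverse s / 2) (at x)"
          using that by (simp add: s_def)
        have "((\<lambda>x. - 2 / sqrt (1 + x)) has_real_derivative (0 * s - (- 2) * (inverse s / 2)) / (s * s)) (at x)"
          unfolding s_def by (rule DERIV_divide[OF DERIV_const D[unfolded s_def]]) (use that in simp)
        moreover have "(0 * s - (- 2) * (inverse s / 2)) / (s * s) = 1 / ((1 + x) * sqrt (1 + x))"
          unfolding s_def[symmetric] unfolding s(2) using s(1) by (simp add: inverse_eq_divide)
        ultimately show ?thesis by (simp only:)
      qed
    qed auto
    then have "integrable lborel (\<lambda>x. 1 / ((1 + x) * sqrt (1 + x)) * indicator {0..} x)"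
    proof (intro integrableI_nonneg)
      assume *: "(\<integral>\<^sup>+x. ennreal (1 / ((1 + x) * sqrt (1 + x))) * indicator {0..} x \<partial>lborel)
        = ennreal (0 - (- 2 / sqrt (1 + 0)))"
      have "ennreal (1 / ((1 + x) * sqrt (1 + x)) * indicator {0..} x)
          = ennreal (1 / ((1 + x) * sqrt (1 + x))) * indicator {0..} x" for x :: real
        by (cases "x \<in> {0..}") simp_all
      then show "(\<integral>\<^sup>+x. ennreal (1 / ((1 + x) * sqrt (1 + x)) * indicator {0..} x) \<partial>lborel) < \<infinity>"
        by (simp only: * ennreal_less_top infinity_ennreal_def)
    qed (auto simp: indicator_def)
    then have "integrable lborel (\<lambda>x. 2 / sqrt (sqrt \<mu>) * (1 / ((1 + x) * sqrt (1 + x)) * indicator {0..} x))"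
      by (rule integrable_mult_right)
    then show ?thesis unfolding h_def by (simp add: mult_ac)
  qed
  have ih2: "integrable lborel (\<lambda>x. indicator {0..} (- x) * h (- x))"
    using lborel_integrable_real_affine[OF ih, of "-1" 0] by simp
  show ?thesis
  proof (rule Bochner_Integration.integrable_bound[OF Bochner_Integration.integrable_add[OF ih ih2]])
    have "\<bar>amplitude \<mu> x\<bar> \<le> \<bar>indicator {0..} x * h x + indicator {0..} (- x) * h (- x)\<bar>" for x
      using hb[of x] hb[of "- x"] by (cases x "0 :: real" rule: linorder_cases) (auto simp: indicator_def)
    then show "AE x in lborel. norm (amplitude \<mu> x) \<le> norm (indicator {0..} x * h x + indicator {0..} (- x) * h (- x))"
      by (intro AE_I2) simp
  qed simp
qed

text \<open>The constant does not depend on \<open>a\<close> and \<open>b\<close>, so the bound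
  survives the passage to the whole half line.\<close>

lemma half_line_bound:
  assumes \<mu>m: "\<mu> \<le> \<mu>m" and t: "t > 0" and ab: "0 < a" "a \<le> b"
  shows "norm (integral {a..b} (\<lambda>x. of_real (amplitude \<mu> x) * cis (X * x - t * phase \<mu> x)))
    \<le> (16 * pi * (1 + \<mu>m) + 1 + 5 * pi / 2) / sqrt (t * \<mu>)"
proof -
  \<comment> \<open>The 16 is the constant of \<open>disp2_upper\<close>, and
    \<open>1 + \<mu>m\<close> is the cost of replacing \<open>1 + \<mu> * x^2\<close> by
    \<open>1 + x^2\<close>. Taking \<open>\<delta>\<close> of the order of the square root of
    \<open>\<kappa>\<close> balances the terms \<open>\<delta> / \<kappa>\<close> and
    \<open>1 / \<delta>\<close>.\<close>
  define \<kappa> where "\<kappa> = t * \<mu> / (16 * (1 + \<mu>m))"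
  define \<delta> where "\<delta> = sqrt (t * \<mu>)"
  define m' where "m' x = disp1 (sqrt \<mu> * x) / (1 + x\<^sup>2) - 2 * x * phase \<mu> x / (1 + x\<^sup>2)\<^sup>2" for x
  have pos: "\<kappa> > 0" "\<delta> > 0" using \<mu> \<mu>m t by (simp_all add: \<kappa>_def \<delta>_def)
  have x0: "x > 0" if "x \<in> {a..b}" for x using that ab by simp
  have cg1: "continuous_on {a..b} (\<lambda>x. disp1 (sqrt \<mu> * x))"
    using DERIV_isCont[OF phase_deriv2[OF x0]] by (auto intro!: continuous_at_imp_continuous_on)
  have cm': "continuous_on {a..b} m'"
    unfolding m'_def by (intro continuous_intros cg1) (auto simp: one_plus_sq_pos)
  \<comment> \<open>An arctangent derivative as majorant bounds the total variation of the amplitude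
    by \<open>3 * pi\<close> on every interval.\<close>
  have m'b: "\<bar>m' x\<bar> \<le> 3 * (1 / (1 + x\<^sup>2))" if x: "x > 0" for x
  proof -
    have "\<bar>disp1 (sqrt \<mu> * x) / (1 + x\<^sup>2)\<bar> \<le> 1 / (1 + x\<^sup>2)"
      using disp1_bounds[of "sqrt \<mu> * x"] x \<mu> one_plus_sq_pos[of x] by (simp add: divide_right_mono)
    moreover have "\<bar>2 * x * phase \<mu> x / (1 + x\<^sup>2)\<^sup>2\<bar> \<le> 2 * (1 / (1 + x\<^sup>2))"
    proof -
      have "x * phase \<mu> x \<le> x * x"
        using abs_phase_le[of \<mu> x] x by (intro mult_left_mono) auto
      then have "2 * x * phase \<mu> x \<le> 2 * (1 + x\<^sup>2)" by (simp add: power2_eq_square)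
      then have "2 * x * phase \<mu> x / (1 + x\<^sup>2)\<^sup>2 \<le> 2 * (1 + x\<^sup>2) / (1 + x\<^sup>2)\<^sup>2"
        by (intro divide_right_mono) auto
      also have "\<dots> = 2 * (1 / (1 + x\<^sup>2))"
      proof -
        have "2 * w / w\<^sup>2 = 2 * (1 / w)" if "w \<noteq> 0" for w :: real
          using that by (simp add: power2_eq_square)
        from this[OF one_plus_sq_pos(2)] show ?thesis .
      qed
      finally show ?thesis using x phase_pos[OF x] by simp
    qed
    moreover have "\<bar>u - v\<bar> \<le> 3 * w" if "\<bar>u\<bar> \<le> w" "\<bar>v\<bar> \<le> 2 * w" for u v w :: real
      using that by linarith
    ultimately show ?thesis unfolding m'_def by blast
  qed
  \<comment> \<open>Here \<open>M = 1\<close> and \<open>V = 3 * pi\<close>, so the second numerator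
    equals \<open>1 + 5 * pi / 2\<close>.\<close>
  have "norm (integral {a..b} (\<lambda>x. of_real (amplitude \<mu> x) * cis (X * x - t * phase \<mu> x)))
    \<le> pi * \<delta> / \<kappa> + (1 + (3 * pi) / 2 + pi * 1) / \<delta>"
  proof (rule vdc_weighted[where m' = m' and p = "\<lambda>x. X - t * disp1 (sqrt \<mu> * x)"
        and p' = "\<lambda>x. - t * (sqrt \<mu> * disp2 (sqrt \<mu> * x))", OF \<open>a \<le> b\<close> pos])
    fix x assume x: "x \<in> {a..b}"
    note xp = x0[OF x]
    have "(amplitude \<mu> has_real_derivative (disp1 (sqrt \<mu> * x) * (1 + x\<^sup>2) - phase \<mu> x * (2 * x)) / ((1 + x\<^sup>2) * (1 + x\<^sup>2))) (at x)"
      unfolding amplitude_def[abs_def]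
      by (rule DERIV_divide[OF phase_deriv[OF xp]]) (auto intro!: derivative_eq_intros simp: one_plus_sq_pos)
    also have "(disp1 (sqrt \<mu> * x) * (1 + x\<^sup>2) - phase \<mu> x * (2 * x)) / ((1 + x\<^sup>2) * (1 + x\<^sup>2)) = m' x"
      unfolding m'_def using one_plus_sq_pos[of x]
      by (simp add: diff_divide_distrib power2_eq_square[of "1 + _"] mult_ac)
    finally show "(amplitude \<mu> has_real_derivative m' x) (at x)" .
    show "((\<lambda>x. X * x - t * phase \<mu> x) has_real_derivative X - t * disp1 (sqrt \<mu> * x)) (at x)"
      by (auto intro!: derivative_eq_intros phase_deriv xp)
    show "((\<lambda>x. X - t * disp1 (sqrt \<mu> * x)) has_real_derivative - t * (sqrt \<mu> * disp2 (sqrt \<mu> * x))) (at x)"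
      by (rule DERIV_cong[OF DERIV_diff[OF DERIV_const DERIV_cmult[OF phase_deriv2[OF xp]]]]) simp
    show "0 \<le> amplitude \<mu> x"
      using phase_pos[OF xp] one_plus_sq_pos[of x] by (simp add: amplitude_def)
    have "phase \<mu> x \<le> 1 + x\<^sup>2"
      using abs_phase_le[of \<mu> x] xp zero_le_power2[of "x - 1"] by (simp add: power2_eq_square algebra_simps)
    then show "amplitude \<mu> x \<le> 1"
      using one_plus_sq_pos[of x] by (simp add: amplitude_def)
    show "\<kappa> * amplitude \<mu> x \<le> - t * (sqrt \<mu> * disp2 (sqrt \<mu> * x))"
    proof -
      define y where "y = sqrt \<mu> * x"
      have y: "y > 0" using xp \<mu> by (simp add: y_def)
      have y2: "y\<^sup>2 = \<mu> * x\<^sup>2" using \<mu> by (simp add: y_def power_mult_distrib)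
      have g: "disp y = sqrt \<mu> * phase \<mu> x" using phase_eq_disp[OF xp] \<mu> by (simp add: y_def)
      have le: "1 + y\<^sup>2 \<le> (1 + \<mu>m) * (1 + x\<^sup>2)"
      proof -
        have "\<mu> * x\<^sup>2 \<le> \<mu>m * x\<^sup>2" using \<mu>m by (intro mult_right_mono) auto
        moreover have "(1 + \<mu>m) * (1 + x\<^sup>2) = 1 + \<mu>m + x\<^sup>2 + \<mu>m * x\<^sup>2" by (simp add: algebra_simps)
        ultimately show ?thesis unfolding y2 using \<mu> \<mu>m zero_le_power2[of x] by linarith
      qed
      have ng: "0 \<le> - disp2 y"
      proof -
        have "0 \<le> - disp2 y * (1 + y\<^sup>2)" using disp2_upper[OF y] disp_pos[OF y] by linarith
        then show ?thesis using one_plus_sq_pos[of y] by (simp add: mult_le_0_iff)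
      qed
      have "disp y / 16 \<le> - disp2 y * ((1 + \<mu>m) * (1 + x\<^sup>2))"
        using disp2_upper[OF y] mult_left_mono[OF le ng] by linarith
      then have "disp y / 16 / ((1 + \<mu>m) * (1 + x\<^sup>2)) \<le> - disp2 y"
        using \<mu> \<mu>m one_plus_sq_pos[of x] by (subst pos_divide_le_eq) auto
      then have "t * sqrt \<mu> * (disp y / 16 / ((1 + \<mu>m) * (1 + x\<^sup>2))) \<le> t * sqrt \<mu> * (- disp2 y)"
        using t \<mu> by (intro mult_left_mono) auto
      moreover have "t * sqrt \<mu> * (disp y / 16 / ((1 + \<mu>m) * (1 + x\<^sup>2))) = \<kappa> * amplitude \<mu> x"
      proof -
        have "t * sqrt \<mu> * (disp y / 16 / ((1 + \<mu>m) * (1 + x\<^sup>2)))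
          = t * (sqrt \<mu> * sqrt \<mu>) * phase \<mu> x / (16 * ((1 + \<mu>m) * (1 + x\<^sup>2)))"
          unfolding g by (simp only: times_divide_eq_right times_divide_eq_left divide_divide_eq_left mult.assoc)
        also have "sqrt \<mu> * sqrt \<mu> = \<mu>" using \<mu> by simp
        finally show ?thesis by (simp only: \<kappa>_def amplitude_def times_divide_times_eq mult.assoc)
      qed
      ultimately show ?thesis unfolding y_def by (simp add: mult.assoc)
    qed
  next
    show "continuous_on {a..b} m'" by (rule cm')
    show "continuous_on {a..b} (\<lambda>x. - t * (sqrt \<mu> * disp2 (sqrt \<mu> * x)))"
      by (intro continuous_intros continuous_disp2 ab)
    have I: "((\<lambda>x. 3 * (1 / (1 + x\<^sup>2))) has_integral 3 * (arctan b - arctan a)) {a..b}"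
      by (intro has_integral_mult_right arctan_integral ab)
    have "integral {a..b} (\<lambda>x. \<bar>m' x\<bar>) \<le> integral {a..b} (\<lambda>x. 3 * (1 / (1 + x\<^sup>2)))"
      using I m'b x0 by (intro integral_le integrable_continuous_real continuous_intros cm') (auto simp: has_integral_integrable_integral one_plus_sq_pos)
    also have "\<dots> = 3 * (arctan b - arctan a)" using I by (rule integral_unique)
    also have "\<dots> \<le> 3 * pi"
    proof -
      have "arctan b - arctan a \<le> pi" using arctan_bounded[of b] arctan_bounded[of a] by linarith
      then show ?thesis by simp
    qed
    finally show "integral {a..b} (\<lambda>x. \<bar>m' x\<bar>) \<le> 3 * pi" .
  qed
  also have "\<dots> = (16 * pi * (1 + \<mu>m) + 1 + 5 * pi / 2) / \<delta>"
  proof -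
    have "\<delta> * \<delta> = t * \<mu>" using t \<mu> by (simp add: \<delta>_def)
    then have "\<kappa> = \<delta> * \<delta> / (16 * (1 + \<mu>m))" by (simp add: \<kappa>_def)
    then have "\<delta> / \<kappa> = 16 * (1 + \<mu>m) / \<delta>" using pos by simp
    moreover have "pi * \<delta> / \<kappa> = pi * (\<delta> / \<kappa>)" by simp
    ultimately have "pi * \<delta> / \<kappa> = 16 * pi * (1 + \<mu>m) / \<delta>" by (simp only: times_divide_eq_right mult_ac)
    then show ?thesis by (simp add: add_divide_distrib)
  qed
  finally show ?thesis unfolding \<delta>_def .
qed

lemma integrable_osc_kernel: "integrable lborel (osc_kernel \<mu> t X)"
  by (rule Bochner_Integration.integrable_bound[OF integrable_amplitude])
     (auto simp: osc_kernel_def norm_mult)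

lemma osc_kernel_bound:
  assumes \<mu>m: "\<mu> \<le> \<mu>m" and t: "t > 0"
  shows "norm (LINT x|lborel. osc_kernel \<mu> t X x) \<le> 2 * ((16 * pi * (1 + \<mu>m) + 1 + 5 * pi / 2) / sqrt (t * \<mu>))"
    (is "_ \<le> 2 * ?C")
proof -
  let ?F = "osc_kernel \<mu> t X"
  note iF = integrable_osc_kernel[of t X]
  have mF: "?F \<in> borel_measurable borel" using iF by simp
  have half: "norm (LINT x|lborel. indicator {0<..} x *\<^sub>R ?F x) \<le> ?C"
  proof (rule LIMSEQ_le_const2)
    \<comment> \<open>Compact intervals that avoid 0, where the derivative formulas for the phase
      are available.\<close>
    define I where "I n = {1 / real (Suc n)..real (Suc n)}" for n
    have "(\<lambda>n. LINT x|lborel. indicator (I n) x *\<^sub>R ?F x) \<longlonglongrightarrow> (LINT x|lborel. indicator {0<..} x *\<^sub>R ?F x)"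
    proof (rule integral_dominated_convergence[where w = "\<lambda>x. norm (?F x)"])
      show "AE x in lborel. (\<lambda>n. indicator (I n) x *\<^sub>R ?F x) \<longlonglongrightarrow> indicator {0<..} x *\<^sub>R ?F x"
      proof (rule AE_I2)
        fix x :: real
        have "\<forall>\<^sub>F n in sequentially. indicator (I n) x = (indicator {0<..} x :: real)"
        proof (cases "x > 0")
          case True
          have "\<forall>\<^sub>F n in sequentially. 1 / real (Suc n) < x \<and> x < real (Suc n)"
            using True by (intro eventually_conj) real_asymp+
          then show ?thesis by eventually_elim (use True in \<open>auto simp: I_def indicator_def\<close>)
        next
          case False
          have "\<not> 1 / real (Suc n) \<le> x" for n
            using False by (smt (verit) of_nat_0_less_iff zero_less_Suc zero_less_divide_1_iff)
          then show ?thesis using False by (simp add: I_def indicator_def)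
        qed
        then show "(\<lambda>n. indicator (I n) x *\<^sub>R ?F x) \<longlonglongrightarrow> indicator {0<..} x *\<^sub>R ?F x"
          by (rule Lim_transform_eventually[OF tendsto_const, OF eventually_mono]) simp
      qed
    qed (use mF iF in \<open>auto simp: I_def indicator_def intro!: AE_I2\<close>)
    then show "(\<lambda>n. norm (LINT x|lborel. indicator (I n) x *\<^sub>R ?F x)) \<longlonglongrightarrow> norm (LINT x|lborel. indicator {0<..} x *\<^sub>R ?F x)"
      by (rule tendsto_norm)
    show "\<exists>N. \<forall>n\<ge>N. norm (LINT x|lborel. indicator (I n) x *\<^sub>R ?F x) \<le> ?C"
    proof (intro exI allI impI)
      fix n
      have n: "0 < 1 / real (Suc n)" "1 / real (Suc n) \<le> real (Suc n)"
        by (auto simp: divide_simps) (metis One_nat_def Suc_le_mono le_square of_nat_1 of_nat_Suc of_nat_le_iff of_nat_mult zero_le mult_1 mult_le_mono)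
      have "set_integrable lborel (I n) ?F"
        unfolding set_integrable_def using iF by (intro integrable_mult_indicator) (auto simp: I_def)
      then have "(LINT x|lborel. indicator (I n) x *\<^sub>R ?F x) = integral (I n) ?F"
        using set_borel_integral_eq_integral(2) unfolding set_lebesgue_integral_def by blast
      then show "norm (LINT x|lborel. indicator (I n) x *\<^sub>R ?F x) \<le> ?C"
        using half_line_bound[OF \<mu>m t n, of X] unfolding I_def osc_kernel_def by simp
    qed
  qed
  have i1: "integrable lborel (\<lambda>x. indicator {0<..} x *\<^sub>R ?F x)"
    and i2: "integrable lborel (\<lambda>x. indicator {..<0} x *\<^sub>R ?F x)"
    using iF by (intro integrable_mult_indicator; simp)+
  have "(LINT x|lborel. ?F x) = (LINT x|lborel. indicator {0<..} x *\<^sub>R ?F x + indicator {..<0} x *\<^sub>R ?F x)"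
    by (rule integral_cong_AE)
       (use mF AE_lborel_singleton[of 0] in \<open>auto simp: indicator_def elim!: eventually_mono\<close>)
  also have "\<dots> = (LINT x|lborel. indicator {0<..} x *\<^sub>R ?F x) + (LINT x|lborel. indicator {..<0} x *\<^sub>R ?F x)"
    using i1 i2 by (rule Bochner_Integration.integral_add)
  also have "(LINT x|lborel. indicator {..<0} x *\<^sub>R ?F x) = (LINT x|lborel. indicator {..<0} (- x) *\<^sub>R ?F (- x))"
    using lborel_integral_real_affine[of "-1" "\<lambda>x. indicator {..<0} x *\<^sub>R ?F x" 0] by simp
  \<comment> \<open>Amplitude and phase are both odd, so reflection turns the integrand into minus
    its conjugate: the negative half line obeys the same bound, whence the factor 2.\<close>
  also have "\<dots> = (LINT x|lborel. cnj (- (indicator {0<..} x *\<^sub>R ?F x)))"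
    by (rule Bochner_Integration.integral_cong)
       (auto simp: indicator_def osc_kernel_def amplitude_def phase_minus cis_cnj)
  also have "\<dots> = cnj (- (LINT x|lborel. indicator {0<..} x *\<^sub>R ?F x))"
    by (simp only: Bochner_Integration.integral_cnj Bochner_Integration.integral_minus)
  also have "norm ((LINT x|lborel. indicator {0<..} x *\<^sub>R ?F x) + \<dots>) \<le> ?C + ?C"
    by (rule norm_triangle_le) (simp only: complex_mod_cnj norm_minus_cancel add_mono half)
  finally show ?thesis by simp
qed

end

section \<open>Test functions and weak derivatives\<close>

text \<open>A finite order of differentiability supports induction: the derivative of a product is a
  sum of products of other functions with one order less, so closure has to be proved for all
  functions simultaneously.\<close>

definition diff_upto :: "nat \<Rightarrow> (real \<Rightarrow> real) \<Rightarrow> bool" where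
  "diff_upto n f \<longleftrightarrow> (\<forall>m<n. \<forall>x. (deriv ^^ m) f field_differentiable at x)"

definition smooth :: "(real \<Rightarrow> real) \<Rightarrow> bool" where
  "smooth f \<longleftrightarrow> (\<forall>n. diff_upto n f)"

lemma diff_upto_0 [simp]: "diff_upto 0 f"
  by (simp add: diff_upto_def)

lemma diff_upto_Suc:
  "diff_upto (Suc n) f \<longleftrightarrow> (\<forall>x. f field_differentiable at x) \<and> diff_upto n (deriv f)"
  unfolding diff_upto_def
  by (auto simp: All_less_Suc2 simp flip: funpow_Suc_right simp: funpow_swap1)

lemma diff_upto_Suc_I:
  assumes "\<And>x. (f has_real_derivative f' x) (at x)" "diff_upto n f'"
  shows "diff_upto (Suc n) f"
proof -
  have "deriv f = f'" using assms(1) by (auto simp: DERIV_imp_deriv)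
  then show ?thesis using assms by (auto simp: diff_upto_Suc field_differentiable_def)
qed

lemma diff_upto_mono: "diff_upto n f \<Longrightarrow> m \<le> n \<Longrightarrow> diff_upto m f"
  by (auto simp: diff_upto_def)

lemma has_deriv_of_diff_upto:
  "diff_upto (Suc n) f \<Longrightarrow> (f has_real_derivative deriv f x) (at x)"
  by (simp add: diff_upto_Suc DERIV_deriv_iff_field_differentiable)

lemma diff_upto_add:
  "diff_upto n f \<Longrightarrow> diff_upto n g \<Longrightarrow> diff_upto n (\<lambda>x. f x + g x)"
proof (induction n arbitrary: f g)
  case (Suc n)
  show ?case
    by (rule diff_upto_Suc_I[where f' = "\<lambda>x. deriv f x + deriv g x"])
       (use Suc in \<open>auto intro!: DERIV_add has_deriv_of_diff_upto simp: diff_upto_Suc\<close>)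
qed simp

lemma diff_upto_mult:
  "diff_upto n f \<Longrightarrow> diff_upto n g \<Longrightarrow> diff_upto n (\<lambda>x. f x * g x)"
proof (induction n arbitrary: f g)
  case (Suc n)
  show ?case
  proof (rule diff_upto_Suc_I)
    show "((\<lambda>x. f x * g x) has_real_derivative f x * deriv g x + deriv f x * g x) (at x)" for x
      by (rule DERIV_mult') (use Suc.prems in \<open>auto intro: has_deriv_of_diff_upto\<close>)
    have "diff_upto n f" "diff_upto n g" using Suc.prems by (auto intro: diff_upto_mono)
    then show "diff_upto n (\<lambda>x. f x * deriv g x + deriv f x * g x)"
      using Suc.prems by (intro diff_upto_add Suc.IH) (auto simp: diff_upto_Suc)
  qed
qed simp

lemma diff_upto_const: "diff_upto n (\<lambda>x. c)"
  by (induction n arbitrary: c) (auto intro!: diff_upto_Suc_I derivative_eq_intros)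

lemma diff_upto_affine: "diff_upto n f \<Longrightarrow> diff_upto n (\<lambda>x. f (c * x + d))"
proof (induction n arbitrary: f)
  case (Suc n)
  show ?case
  proof (rule diff_upto_Suc_I)
    show "((\<lambda>x. f (c * x + d)) has_real_derivative deriv f (c * x + d) * c) (at x)" for x
      by (rule DERIV_chain2[where g = "\<lambda>x. c * x + d"])
         (use Suc.prems in \<open>auto intro!: has_deriv_of_diff_upto derivative_eq_intros\<close>)
    show "diff_upto n (\<lambda>x. deriv f (c * x + d) * c)"
      using Suc by (intro diff_upto_mult diff_upto_const) (auto simp: diff_upto_Suc)
  qed
qed simp

lemma diff_upto_id: "diff_upto n (\<lambda>x. x)"
  by (cases n) (auto intro!: diff_upto_Suc_I[where f' = "\<lambda>_. 1"] diff_upto_const derivative_eq_intros)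

lemma diff_upto_sin_cos: "diff_upto n sin \<and> diff_upto n cos"
proof (induction n)
  case (Suc n)
  have "diff_upto n (\<lambda>x. (- 1) * sin x)"
    using Suc by (intro diff_upto_mult diff_upto_const) auto
  then show ?case
    using Suc by (auto intro!: diff_upto_Suc_I[where f = sin and f' = cos] diff_upto_Suc_I[where f = cos and f' = "\<lambda>x. (-1) * sin x"] derivative_eq_intros)
qed simp

lemma smooth_mult: "smooth f \<Longrightarrow> smooth g \<Longrightarrow> smooth (\<lambda>x. f x * g x)"
  by (simp add: smooth_def diff_upto_mult)

lemma smooth_affine: "smooth f \<Longrightarrow> smooth (\<lambda>x. f (c * x + d))"
  by (simp add: smooth_def diff_upto_affine)

lemma smooth_id: "smooth (\<lambda>x. x)"
  by (simp add: smooth_def diff_upto_id)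

lemma smooth_sin: "smooth sin" and smooth_cos: "smooth cos"
  by (simp_all add: smooth_def diff_upto_sin_cos)

lemma smooth_has_deriv: "smooth f \<Longrightarrow> (f has_real_derivative deriv f x) (at x)"
  unfolding smooth_def using has_deriv_of_diff_upto by blast

lemma smooth_deriv: "smooth f \<Longrightarrow> smooth (deriv f)"
  unfolding smooth_def using diff_upto_Suc by blast

lemma smooth_deriv_n: "smooth f \<Longrightarrow> smooth ((deriv ^^ n) f)"
  by (induction n) (auto intro: smooth_deriv)

lemma smooth_continuous: "smooth f \<Longrightarrow> continuous_on S f"
  using smooth_has_deriv DERIV_isCont by (blast intro: continuous_at_imp_continuous_on)

lemma test_function_iff: "test_function \<phi> \<longleftrightarrow> smooth \<phi> \<and> (\<exists>R. \<forall>x. \<bar>x\<bar> > R \<longrightarrow> \<phi> x = 0)"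
  unfolding test_function_def smooth_def diff_upto_def by blast

lemma test_function_mult_smooth: "test_function \<phi> \<Longrightarrow> smooth f \<Longrightarrow> test_function (\<lambda>x. \<phi> x * f x)"
  unfolding test_function_iff by (auto intro: smooth_mult)

lemma deriv_mult_smooth:
  "smooth f \<Longrightarrow> smooth g \<Longrightarrow> deriv (\<lambda>x. f x * g x) = (\<lambda>x. f x * deriv g x + deriv f x * g x)"
  by (auto intro!: DERIV_imp_deriv DERIV_mult' smooth_has_deriv)

lemma deriv2_mult_smooth:
  assumes "smooth f" "smooth g"
  shows "(deriv ^^ 2) (\<lambda>x. f x * g x) =
    (\<lambda>x. (deriv ^^ 2) f x * g x + 2 * (deriv f x * deriv g x) + f x * (deriv ^^ 2) g x)"
proof -
  have "(deriv ^^ 2) (\<lambda>x. f x * g x) = deriv (\<lambda>x. f x * deriv g x + deriv f x * g x)"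
    by (simp add: numeral_2_eq_2 deriv_mult_smooth assms)
  also have "\<dots> = (\<lambda>x. (f x * deriv (deriv g) x + deriv f x * deriv g x) + (deriv f x * deriv g x + deriv (deriv f) x * g x))"
    by (rule ext, rule DERIV_imp_deriv, rule DERIV_add; rule DERIV_mult')
       (use assms in \<open>auto intro: smooth_has_deriv smooth_deriv\<close>)
  finally show ?thesis by (simp add: numeral_2_eq_2 algebra_simps)
qed

lemma deriv_affine_smooth:
  "smooth f \<Longrightarrow> deriv (\<lambda>x. f (c * x + d)) = (\<lambda>x. c * deriv f (c * x + d))"
proof (rule ext, rule DERIV_imp_deriv)
  fix x assume f: "smooth f"
  have "((\<lambda>x. f (c * x + d)) has_real_derivative deriv f (c * x + d) * c) (at x)"
    by (rule DERIV_chain2[where g = "\<lambda>x. c * x + d"])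
       (use f in \<open>auto intro!: smooth_has_deriv derivative_eq_intros\<close>)
  then show "((\<lambda>x. f (c * x + d)) has_real_derivative c * deriv f (c * x + d)) (at x)"
    by (simp add: mult.commute)
qed

lemma deriv2_affine_smooth:
  assumes "smooth f"
  shows "(deriv ^^ 2) (\<lambda>x. f (c * x + d)) = (\<lambda>x. c\<^sup>2 * (deriv ^^ 2) f (c * x + d))"
proof (rule ext)
  fix x
  have "(deriv ^^ 2) (\<lambda>x. f (c * x + d)) x = deriv (\<lambda>x. c * deriv f (c * x + d)) x"
    by (simp add: numeral_2_eq_2 deriv_affine_smooth assms)
  also have "deriv (\<lambda>x. c * deriv f (c * x + d)) x = c * (c * deriv (deriv f) (c * x + d))"
  proof (rule DERIV_imp_deriv, rule DERIV_cmult)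
    have "smooth (\<lambda>x. deriv f (c * x + d))" by (intro smooth_affine smooth_deriv assms)
    from smooth_has_deriv[OF this]
    show "((\<lambda>x. deriv f (c * x + d)) has_real_derivative c * deriv (deriv f) (c * x + d)) (at x)"
      by (simp add: deriv_affine_smooth assms smooth_deriv)
  qed
  finally show "(deriv ^^ 2) (\<lambda>x. f (c * x + d)) x = c\<^sup>2 * (deriv ^^ 2) f (c * x + d)"
    by (simp add: numeral_2_eq_2)
qed

lemma test_function_deriv_n:
  assumes "test_function \<phi>"
  shows "test_function ((deriv ^^ n) \<phi>)"
proof -
  from assms obtain R where sm: "smooth \<phi>" and R: "\<And>x. \<bar>x\<bar> > R \<Longrightarrow> \<phi> x = 0"
    by (auto simp: test_function_iff)
  have "(deriv ^^ n) \<phi> x = 0" if "\<bar>x\<bar> > R" for x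
    using that
  proof (induction n arbitrary: x)
    case (Suc n)
    have "open {x. \<bar>x\<bar> > R}" by (intro open_Collect_less continuous_intros)
    then have "\<forall>\<^sub>F y in nhds x. y \<in> {x. \<bar>x\<bar> > R}"
      by (rule eventually_nhds_in_open) (use Suc.prems in simp)
    then have "\<forall>\<^sub>F y in nhds x. (deriv ^^ n) \<phi> y = (\<lambda>_. 0) y"
      by eventually_elim (use Suc.IH in simp)
    then have "deriv ((deriv ^^ n) \<phi>) x = deriv (\<lambda>_. 0) x"
      by (rule deriv_cong_ev) simp
    then show ?case by simp
  qed (use R in simp)
  then show ?thesis using smooth_deriv_n[OF sm] by (auto simp: test_function_iff)
qed

lemma test_function_bounded:
  assumes "test_function \<phi>"
  shows "\<exists>R B. (\<forall>x. \<bar>x\<bar> > R \<longrightarrow> \<phi> x = 0) \<and> (\<forall>x. \<bar>\<phi> x\<bar> \<le> B)"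
proof -
  from assms obtain R where sm: "smooth \<phi>" and R: "\<And>x. \<bar>x\<bar> > R \<Longrightarrow> \<phi> x = 0"
    by (auto simp: test_function_iff)
  have "compact (\<phi> ` {-R..R})"
    by (intro compact_continuous_image smooth_continuous sm compact_Icc)
  then obtain B where B: "\<And>x. x \<in> {-R..R} \<Longrightarrow> \<bar>\<phi> x\<bar> \<le> B"
    by (metis bounded_iff compact_imp_bounded imageI real_norm_def)
  have "\<bar>\<phi> x\<bar> \<le> max B 0" for x
  proof (cases "\<bar>x\<bar> > R")
    case True
    then show ?thesis by (simp add: R)
  next
    case False
    then have "x \<in> {-R..R}" by auto
    then show ?thesis using B[of x] by simp
  qed
  with R show ?thesis by blast
qed

section \<open>Smooth cutoffs and bumps\<close>

definition exp_cutoff :: "nat \<Rightarrow> real \<Rightarrow> real" where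
  "exp_cutoff k x = (if x > 0 then exp (- 1 / x) / x ^ k else 0)"

text \<open>The powers of \<open>x\<close> in the denominator are there to close the family under
  differentiation, which turns smoothness of the standard function \<open>exp (- 1 / x)\<close> into
  an induction over all \<open>k\<close>.\<close>

lemma exp_cutoff_deriv:
  "(exp_cutoff k has_real_derivative exp_cutoff (k + 2) x + (- real k) * exp_cutoff (k + 1) x) (at x)"
proof -
  consider "x > 0" | "x < 0" | "x = 0" by linarith
  then show ?thesis
  proof cases
    case 1
    have d: "((\<lambda>x. - 1 / x) has_real_derivative 1 / x\<^sup>2) (at x)"
      using 1 by (auto intro!: derivative_eq_intros simp: power2_eq_square)
    have e: "((\<lambda>x. exp (- 1 / x)) has_real_derivative exp (- 1 / x) * (1 / x\<^sup>2)) (at x)"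
      by (rule DERIV_chain2[OF DERIV_exp d])
    have "((\<lambda>x. exp (- 1 / x) / x ^ k) has_real_derivative
      (exp (- 1 / x) * (1 / x\<^sup>2) * x ^ k - exp (- 1 / x) * (real k * x ^ (k - 1))) / (x ^ k * x ^ k)) (at x)"
      by (rule DERIV_divide[OF e]) (use 1 in \<open>auto intro!: derivative_eq_intros\<close>)
    also have "(exp (- 1 / x) * (1 / x\<^sup>2) * x ^ k - exp (- 1 / x) * (real k * x ^ (k - 1))) / (x ^ k * x ^ k)
      = exp_cutoff (k + 2) x + (- real k) * exp_cutoff (k + 1) x"
    proof -
      have "x ^ k * x = x ^ (k - 1) * x\<^sup>2" if "k > 0"
        using that by (cases k) (auto simp: power2_eq_square)
      then have 2: "real k * x ^ (k - 1) / (x ^ k * x ^ k) = real k / x ^ (k + 1)"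
        using 1 by (cases k) (auto simp: field_simps)
      have 3: "1 / x\<^sup>2 * x ^ k / (x ^ k * x ^ k) = 1 / x ^ (k + 2)"
        using 1 by (simp add: power_add power2_eq_square)
      have "(E * a * p - E * b) / q = E * (a * p / q) - E * (b / q)" for E a b p q :: real
        by (simp add: diff_divide_distrib)
      then have "(exp (- 1 / x) * (1 / x\<^sup>2) * x ^ k - exp (- 1 / x) * (real k * x ^ (k - 1))) / (x ^ k * x ^ k)
        = exp (- 1 / x) * (1 / x ^ (k + 2)) - exp (- 1 / x) * (real k / x ^ (k + 1))"
        unfolding 2[symmetric] 3[symmetric] by blast
      then show ?thesis using 1 by (simp add: exp_cutoff_def)
    qed
    finally have "((\<lambda>x. exp (- 1 / x) / x ^ k) has_real_derivative exp_cutoff (k + 2) x + (- real k) * exp_cutoff (k + 1) x) (at x)" .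
    moreover have ev: "\<forall>\<^sub>F y in nhds x. exp_cutoff k y = exp (- 1 / y) / y ^ k"
      using eventually_nhds_in_open[of "{0<..}" x] 1 by (auto simp: exp_cutoff_def elim!: eventually_mono)
    ultimately show ?thesis using DERIV_cong_ev[OF refl ev refl] by blast
  next
    case 2
    have ev: "\<forall>\<^sub>F y in nhds x. exp_cutoff k y = 0"
      using eventually_nhds_in_open[of "{..<0}" x] 2 by (auto simp: exp_cutoff_def elim!: eventually_mono)
    have "(exp_cutoff k has_real_derivative 0) (at x)"
      using DERIV_cong_ev[OF refl ev refl, of 0] by simp
    then show ?thesis using 2 by (simp add: exp_cutoff_def)
  next
    case 3
    \<comment> \<open>In the variable \<open>1 / h\<close> the right difference quotient is a power
      divided by an exponential.\<close>
    have "((\<lambda>h. exp_cutoff k h / h) \<longlongrightarrow> 0) (at_right 0)"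
    proof (rule Lim_transform_eventually)
      have "((\<lambda>h. inverse h ^ (k + 1) / exp (inverse h)) \<longlongrightarrow> (0::real)) (at_right 0)"
        by (rule filterlim_compose[OF tendsto_power_div_exp_0 filterlim_inverse_at_top_right])
      then show "((\<lambda>h. inverse h ^ (k + 1) / exp (inverse h)) \<longlongrightarrow> (0::real)) (at_right 0)" .
      show "\<forall>\<^sub>F h in at_right 0. inverse h ^ (k + 1) / exp (inverse h) = exp_cutoff k h / h"
        by (auto simp: eventually_at_filter exp_cutoff_def exp_minus inverse_eq_divide power_divide)
    qed
    moreover have "((\<lambda>h. exp_cutoff k h / h) \<longlongrightarrow> 0) (at_left 0)"
      by (rule Lim_transform_eventually[OF tendsto_const])
         (auto simp: eventually_at_filter exp_cutoff_def)
    ultimately have "((\<lambda>h. exp_cutoff k h / h) \<longlongrightarrow> 0) (at 0)"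
      by (simp add: filterlim_split_at)
    then show ?thesis using 3 by (simp add: DERIV_def exp_cutoff_def)
  qed
qed

lemma smooth_exp_cutoff: "smooth (exp_cutoff k)"
proof -
  have "diff_upto n (exp_cutoff k)" for n
  proof (induction n arbitrary: k)
    case (Suc n)
    show ?case
      by (rule diff_upto_Suc_I[OF exp_cutoff_deriv]) (intro diff_upto_add diff_upto_mult diff_upto_const Suc)
  qed simp
  then show ?thesis by (simp add: smooth_def)
qed

text \<open>The parameter \<open>s\<close> is a steepness: scaling inside the cutoffs sharpens the
  flanks while the support and the range within [0, 1] stay fixed.\<close>

definition bump :: "real \<Rightarrow> real \<Rightarrow> real \<Rightarrow> real \<Rightarrow> real" where
  "bump s a b x = exp_cutoff 0 (s * x - s * a) * exp_cutoff 0 (s * b - s * x)"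

lemma test_function_bump: "s > 0 \<Longrightarrow> test_function (bump s a b)"
  unfolding test_function_iff
proof (intro conjI exI[of _ "\<bar>a\<bar> + \<bar>b\<bar>"] allI impI)
  have "smooth (\<lambda>x. exp_cutoff 0 (s * x + (- s * a)) * exp_cutoff 0 ((- s) * x + s * b))"
    by (intro smooth_mult smooth_affine smooth_exp_cutoff)
  then show "smooth (bump s a b)" by (simp add: bump_def[abs_def])
  fix x assume s: "s > 0" and "\<bar>a\<bar> + \<bar>b\<bar> < \<bar>x\<bar>"
  then have "x < a \<or> b < x" by linarith
  then have "s * x < s * a \<or> s * b < s * x" using s by simp
  then show "bump s a b x = 0" by (auto simp: bump_def exp_cutoff_def)
qed

lemma bump_bounds: "0 \<le> bump s a b x" "bump s a b x \<le> 1"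
proof -
  have "0 \<le> exp_cutoff 0 y \<and> exp_cutoff 0 y \<le> 1" for y by (simp add: exp_cutoff_def)
  then show "0 \<le> bump s a b x" "bump s a b x \<le> 1"
    by (auto simp: bump_def mult_le_one)
qed

lemma bump_tendsto: "(\<lambda>n. bump (real (Suc n)) a b x) \<longlonglongrightarrow> indicator {a<..<b} x"
proof (cases "x \<in> {a<..<b}")
  case True
  have e: "bump (real (Suc n)) a b x = exp (- 1 / (real (Suc n) * (x - a))) * exp (- 1 / (real (Suc n) * (b - x)))" for n
    using True by (simp add: bump_def exp_cutoff_def right_diff_distrib[symmetric])
  have "x - a > 0" "b - x > 0" using True by auto
  then have "(\<lambda>n. exp (- 1 / (real (Suc n) * (x - a))) * exp (- 1 / (real (Suc n) * (b - x)))) \<longlonglongrightarrow> 1"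
    by real_asymp
  then show ?thesis using True unfolding e by simp
next
  case False
  then have "bump (real (Suc n)) a b x = 0" for n
    by (auto simp: bump_def exp_cutoff_def right_diff_distrib[symmetric] zero_less_mult_iff simp del: of_nat_Suc)
  then show ?thesis using False by simp
qed

section \<open>The fundamental lemma of the calculus of variations\<close>

text \<open>Weak derivatives and norms refer to the completed measure, whereas generator arguments
  and Fubini need Borel functions. This lemma moves between the two settings.\<close>

lemma lebesgue_borel_version:
  fixes h :: "real \<Rightarrow> real"
  assumes "integrable lebesgue h"
  obtains h' where "integrable lborel h'" "AE x in lebesgue. h x = h' x"
proof -
  have "h \<in> borel_measurable (completion lborel)" using assms by simp
  then obtain h' where h': "h' \<in> borel_measurable lborel" and ae: "AE x in lborel. h x = h' x"
    using completion_ex_borel_measurable_real by blast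
  from ae have ae': "AE x in lebesgue. h x = h' x" by (rule AE_completion)
  have "integrable lebesgue h'"
    using assms h' ae' by (subst integrable_cong_AE[of _ _ h]) (auto simp: measurable_completion elim: eventually_mono)
  then have "integrable lborel h'" using h' integrable_completion by blast
  then show ?thesis using ae' by (rule that)
qed

lemma borel_measurable_lebesgue_mult:
  fixes f g :: "real \<Rightarrow> real"
  assumes "f \<in> borel_measurable borel" "g \<in> borel_measurable lebesgue"
  shows "(\<lambda>x. f x * g x) \<in> borel_measurable lebesgue"
  using assms by (intro borel_measurable_times) (auto intro: measurable_completion)

text \<open>A Dynkin argument: open intervals are an intersection-stable generator of the Borel
  sets, and vanishing of the integral passes to complements and disjoint unions. Uniqueness of
  densities then gives the claim.\<close>

lemma AE_zero_if_interval_integrals_zero: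
  fixes h :: "real \<Rightarrow> real"
  assumes h: "integrable lebesgue h"
    and zero: "\<And>a b. (LINT x|lebesgue. indicator {a<..<b} x * h x) = 0"
  shows "AE x in lebesgue. h x = 0"
proof -
  obtain h' where h': "integrable lborel h'" and ae: "AE x in lebesgue. h x = h' x"
    using lebesgue_borel_version[OF h] .
  have [measurable]: "h' \<in> borel_measurable borel" using h' by simp
  have set_int: "set_integrable lborel A h'" if "A \<in> sets borel" for A
    unfolding set_integrable_def using h' that by (intro integrable_mult_indicator) auto
  have box0: "(LINT x:{a<..<b}|lborel. h' x) = 0" for a b
  proof -
    have "(LINT x:{a<..<b}|lborel. h' x) = (LINT x|lebesgue. indicator {a<..<b} x * h' x)"
      unfolding set_lebesgue_integral_def real_scaleR_def
      by (rule integral_completion[symmetric]) measurable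
    also have "\<dots> = (LINT x|lebesgue. indicator {a<..<b} x * h x)"
      using ae h by (intro integral_cong_AE borel_measurable_lebesgue_mult)
        (auto intro: measurable_completion elim: eventually_mono)
    finally show ?thesis using zero by simp
  qed
  \<comment> \<open>The integral over the whole line is needed for complements; it is not itself an
    interval integral and is reached by exhaustion.\<close>
  have UNIV0: "(LINT x|lborel. h' x) = 0"
  proof -
    have "(\<lambda>n. LINT x|lborel. indicator {- real n<..<real n} x * h' x) \<longlonglongrightarrow> (LINT x|lborel. h' x)"
    proof (rule integral_dominated_convergence[where w = "\<lambda>x. \<bar>h' x\<bar>"])
      show "AE x in lborel. (\<lambda>n. indicator {- real n<..<real n} x * h' x) \<longlonglongrightarrow> h' x"
      proof (rule AE_I2)
        fix x
        have "\<forall>\<^sub>F n in sequentially. \<bar>x\<bar> < real n" by real_asymp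
        then have "\<forall>\<^sub>F n in sequentially. h' x = indicator {- real n<..<real n} x * h' x"
          by eventually_elim (auto simp: indicator_def)
        then show "(\<lambda>n. indicator {- real n<..<real n} x * h' x) \<longlonglongrightarrow> h' x"
          by (rule Lim_transform_eventually[OF tendsto_const])
      qed
    qed (use h' in \<open>auto simp: indicator_def intro!: AE_I2\<close>)
    moreover have "(LINT x|lborel. indicator {- real n<..<real n} x * h' x) = 0" for n
      using box0[of "- real n" "real n"] by (simp add: set_lebesgue_integral_def)
    ultimately show ?thesis by (simp add: LIMSEQ_const_iff)
  qed
  define G where "G = range (\<lambda>(a, b). box a b :: real set)"
  have borel_G: "sets borel = sigma_sets UNIV G" unfolding G_def by (subst borel_eq_box) simp
  have all0: "(LINT x:A|lborel. h' x) = 0" if "A \<in> sigma_sets UNIV G" for A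
  proof (rule sigma_sets_induct_disjoint[of G UNIV A])
    show "Int_stable G"
    proof (rule Int_stableI)
      fix A B assume "A \<in> G" "B \<in> G"
      then obtain a b c d where "A = box a b" "B = box c d" by (auto simp: G_def)
      then have "A \<inter> B = box (max a c) (min b d)" by auto
      then show "A \<inter> B \<in> G" by (auto simp: G_def)
    qed
    show "(LINT x:B|lborel. h' x) = 0" if "B \<in> G" for B
      using that box0 by (auto simp: G_def)
    show "(LINT x:UNIV - B|lborel. h' x) = 0"
      if "B \<in> sigma_sets UNIV G" "(LINT x:B|lborel. h' x) = 0" for B
    proof -
      have B: "B \<in> sets borel" using that borel_G by simp
      have "(LINT x:UNIV - B|lborel. h' x) = (LINT x|lborel. h' x - indicator B x *\<^sub>R h' x)"
        unfolding set_lebesgue_integral_def by (rule Bochner_Integration.integral_cong) (auto simp: indicator_def)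
      also have "\<dots> = (LINT x|lborel. h' x) - (LINT x:B|lborel. h' x)"
        unfolding set_lebesgue_integral_def
        by (rule Bochner_Integration.integral_diff[OF h' set_int[OF B, unfolded set_integrable_def]])
      finally show ?thesis using that UNIV0 by simp
    qed
    show "(LINT x:(\<Union>i. B i)|lborel. h' x) = 0"
      if "disjoint_family B" "range B \<subseteq> sigma_sets UNIV G" "\<And>i. (LINT x:B i|lborel. h' x) = 0" for B :: "nat \<Rightarrow> real set"
    proof -
      have B: "B i \<in> sets borel" for i using that(2) borel_G by auto
      have "(LINT x:(\<Union>i. B i)|lborel. h' x) = (\<Sum>i. (LINT x:(B i)|lborel. h' x))"
      proof (rule lebesgue_integral_countable_add)
        show "B i \<in> sets lborel" for i using B by simp
        show "B i \<inter> B j = {}" if "i \<noteq> j" for i j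
          using that \<open>disjoint_family B\<close> by (simp add: disjoint_family_on_def)
        show "set_integrable lborel (\<Union>i. B i) h'" using B by (intro set_int) auto
      qed
      then show ?thesis using that(3) by simp
    qed
  qed (auto simp: set_lebesgue_integral_def that)
  have "AE x in lborel. h' x = 0"
    by (rule density_unique_real[OF h' integrable_zero]) (use all0 borel_G in \<open>simp add: set_lebesgue_integral_def\<close>)
  then have "AE x in lebesgue. h' x = 0" by (rule AE_completion)
  then show ?thesis using ae by eventually_elim simp
qed

lemma locally_integrable_iff: "locally_integrable f \<longleftrightarrow> (\<forall>R. integrable lebesgue (\<lambda>x. indicator {-R..R} x * f x))"
  by (simp add: locally_integrable_def set_integrable_def)

lemma locally_integrable_measurable:
  assumes "locally_integrable f"
  shows "f \<in> borel_measurable lebesgue"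
proof (rule borel_measurable_LIMSEQ_real)
  fix x
  have "\<forall>\<^sub>F n in sequentially. \<bar>x\<bar> \<le> real n" by real_asymp
  then have "\<forall>\<^sub>F n in sequentially. f x = indicator {- real n..real n} x * f x"
    by eventually_elim (auto simp: indicator_def)
  then show "(\<lambda>n. indicator {- real n..real n} x * f x) \<longlonglongrightarrow> f x"
    by (rule Lim_transform_eventually[OF tendsto_const])
next
  show "(\<lambda>x. indicator {- real n..real n} x * f x) \<in> borel_measurable lebesgue" for n
    using assms by (auto simp: locally_integrable_iff dest: borel_measurable_integrable)
qed

lemma integrable_mult_bounded_support:
  assumes f: "locally_integrable f" and [measurable]: "\<phi> \<in> borel_measurable borel"
    and R: "\<And>x. \<bar>x\<bar> > R \<Longrightarrow> \<phi> x = 0" and B: "\<And>x. \<bar>\<phi> x\<bar> \<le> B"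
  shows "integrable lebesgue (\<lambda>x. f x * \<phi> x)"
proof (rule Bochner_Integration.integrable_bound)
  show "integrable lebesgue (\<lambda>x. B * (indicator {-R..R} x * f x))"
    using f by (intro integrable_mult_right) (simp add: locally_integrable_iff)
  show "(\<lambda>x. f x * \<phi> x) \<in> borel_measurable lebesgue"
    using borel_measurable_lebesgue_mult[OF _ locally_integrable_measurable[OF f], of \<phi>]
    by (simp add: mult.commute)
  have "\<bar>f x * \<phi> x\<bar> \<le> \<bar>B * (indicator {-R..R} x * f x)\<bar>" for x
  proof (cases "x \<in> {-R..R}")
    case True
    have "\<bar>\<phi> x\<bar> \<le> \<bar>B\<bar>" using B[of x] by linarith
    then have "\<bar>f x\<bar> * \<bar>\<phi> x\<bar> \<le> \<bar>f x\<bar> * \<bar>B\<bar>" by (rule mult_left_mono) simp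
    then show ?thesis using True by (simp add: abs_mult mult.commute)
  next
    case False
    then have "\<phi> x = 0" using R[of x] by (cases "x < -R") auto
    then show ?thesis by simp
  qed
  then show "AE x in lebesgue. norm (f x * \<phi> x) \<le> norm (B * (indicator {-R..R} x * f x))"
    by (intro AE_I2) simp
qed

lemma integrable_mult_test:
  assumes f: "locally_integrable f" and \<phi>: "test_function \<phi>"
  shows "integrable lebesgue (\<lambda>x. f x * \<phi> x)"
proof -
  obtain R B where "\<And>x. \<bar>x\<bar> > R \<Longrightarrow> \<phi> x = 0" "\<And>x. \<bar>\<phi> x\<bar> \<le> B"
    using test_function_bounded[OF \<phi>] by blast
  moreover have "\<phi> \<in> borel_measurable borel"
    using \<phi> by (intro borel_measurable_continuous_onI smooth_continuous) (simp add: test_function_iff)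
  ultimately show ?thesis using integrable_mult_bounded_support[OF f] by blast
qed

lemma locally_integrable_mult_continuous:
  assumes f: "locally_integrable f" and c: "continuous_on UNIV c"
  shows "locally_integrable (\<lambda>x. c x * f x)"
  unfolding locally_integrable_iff
proof
  fix R :: real
  have "compact (c ` {-R..R})"
    using c by (intro compact_continuous_image compact_Icc) (auto intro: continuous_on_subset)
  then obtain B where B: "\<And>x. x \<in> {-R..R} \<Longrightarrow> \<bar>c x\<bar> \<le> B"
    by (metis bounded_iff compact_imp_bounded imageI real_norm_def)
  have "integrable lebesgue (\<lambda>x. f x * (indicator {-R..R} x * c x))"
  proof (rule integrable_mult_bounded_support[OF f, where R = R and B = "max B 0"])
    show "(\<lambda>x. indicator {-R..R} x * c x) \<in> borel_measurable borel"
      using borel_measurable_continuous_onI[OF c] by measurable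
    show "\<bar>indicator {-R..R} x * c x\<bar> \<le> max B 0" for x
      using B[of x] by (cases "x \<in> {-R..R}") auto
  qed (auto simp: indicator_def)
  then show "integrable lebesgue (\<lambda>x. indicator {-R..R} x * (c x * f x))" by (simp add: mult_ac)
qed

lemma locally_integrable_add:
  "locally_integrable f \<Longrightarrow> locally_integrable g \<Longrightarrow> locally_integrable (\<lambda>x. f x + g x)"
  by (simp add: locally_integrable_iff distrib_left)

text \<open>The bumps increase to the indicators of open intervals, so testing against them
  determines all interval integrals.\<close>
lemma AE_zero_if_test_integrals_zero:
  assumes h: "locally_integrable h"
    and zero: "\<And>\<phi>. test_function \<phi> \<Longrightarrow> (LINT x|lebesgue. h x * \<phi> x) = 0"
  shows "AE x in lebesgue. h x = 0"
proof -
  note hm = locally_integrable_measurable[OF h]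
  have int0: "(LINT x|lebesgue. indicator {a<..<b} x * h x) = 0" for a b
  proof -
    define R where "R = \<bar>a\<bar> + \<bar>b\<bar>"
    have "(\<lambda>n. LINT x|lebesgue. h x * bump (real (Suc n)) a b x) \<longlonglongrightarrow> (LINT x|lebesgue. indicator {a<..<b} x * h x)"
    proof (rule integral_dominated_convergence[where w = "\<lambda>x. \<bar>indicator {-R..R} x * h x\<bar>"])
      show "(\<lambda>x. indicator {a<..<b} x * h x) \<in> borel_measurable lebesgue"
        by (intro borel_measurable_lebesgue_mult hm) simp
      show "integrable lebesgue (\<lambda>x. \<bar>indicator {-R..R} x * h x\<bar>)"
        using h by (intro integrable_abs) (simp add: locally_integrable_iff)
      show "(\<lambda>x. h x * bump (real (Suc n)) a b x) \<in> borel_measurable lebesgue" for n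
        by (rule borel_measurable_integrable, rule integrable_mult_test[OF h])
           (simp add: test_function_bump del: of_nat_Suc)
      show "AE x in lebesgue. (\<lambda>n. h x * bump (real (Suc n)) a b x) \<longlonglongrightarrow> indicator {a<..<b} x * h x"
        by (rule AE_I2) (subst mult.commute, intro tendsto_mult tendsto_const bump_tendsto)
      show "AE x in lebesgue. norm (h x * bump (real (Suc n)) a b x) \<le> \<bar>indicator {-R..R} x * h x\<bar>" for n
      proof (rule AE_I2)
        fix x
        show "norm (h x * bump (real (Suc n)) a b x) \<le> \<bar>indicator {-R..R} x * h x\<bar>"
        proof (cases "x \<in> {-R..R}")
          case True
          then show ?thesis
            using bump_bounds[of "real (Suc n)" a b x] by (simp add: abs_mult mult_left_le del: of_nat_Suc)
        next
          case False
          then have "x < a \<or> b < x" unfolding R_def by auto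
          then have "bump (real (Suc n)) a b x = 0"
            by (auto simp: bump_def exp_cutoff_def right_diff_distrib[symmetric] zero_less_mult_iff simp del: of_nat_Suc)
          then show ?thesis by simp
        qed
      qed
    qed
    moreover have "(LINT x|lebesgue. h x * bump (real (Suc n)) a b x) = 0" for n
      by (rule zero) (simp add: test_function_bump del: of_nat_Suc)
    ultimately show ?thesis by (simp add: LIMSEQ_const_iff)
  qed
  \<comment> \<open>The function is only locally integrable, so it is truncated to
    \<open>{- n..n}\<close>. Intersecting with an open interval gives an open interval again, up to
    two endpoints of measure zero.\<close>
  have "AE x in lebesgue. \<forall>n::nat. indicator {- real n..real n} x * h x = 0"
  proof (subst AE_all_countable, rule allI)
    fix n :: nat
    have "(LINT x|lebesgue. indicator {a<..<b} x * (indicator {- real n..real n} x * h x)) = 0" for a b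
    proof -
      have "(LINT x|lebesgue. indicator {a<..<b} x * (indicator {- real n..real n} x * h x))
          = (LINT x|lebesgue. indicator {max a (- real n)<..<min b (real n)} x * h x)"
      proof (rule integral_cong_AE)
        have "AE x in lebesgue. x \<noteq> - real n \<and> x \<noteq> real n"
          using AE_completion[OF AE_lborel_singleton[of "- real n"]] AE_completion[OF AE_lborel_singleton[of "real n"]]
          by eventually_elim simp
        then show "AE x in lebesgue. indicator {a<..<b} x * (indicator {- real n..real n} x * h x)
            = indicator {max a (- real n)<..<min b (real n)} x * h x"
          by eventually_elim (auto simp: indicator_def)
      qed (intro borel_measurable_lebesgue_mult hm; simp)+
      then show ?thesis using int0 by simp
    qed
    then show "AE x in lebesgue. indicator {- real n..real n} x * h x = 0"
      using h by (intro AE_zero_if_interval_integrals_zero) (auto simp: locally_integrable_iff)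
  qed
  then show ?thesis
  proof eventually_elim
    case (elim x)
    obtain n :: nat where "\<bar>x\<bar> \<le> real n" using real_arch_simple by blast
    then show ?case using elim[rule_format, of n] by (auto simp: indicator_def split: if_splits)
  qed
qed

section \<open>Uniqueness of weak derivatives and multiplication by the variable\<close>

lemma weak_derivD:
  "weak_deriv k f g \<Longrightarrow> test_function \<phi> \<Longrightarrow>
    (LINT x|lebesgue. f x * (deriv ^^ k) \<phi> x) = (- 1) ^ k * (LINT x|lebesgue. g x * \<phi> x)"
  unfolding weak_deriv_def by blast

text \<open>This makes the choice by \<open>SOME\<close> in the Sobolev norm harmless: every other
  weak derivative has the same integrals.\<close>

lemma weak_deriv_unique:
  assumes "weak_deriv k f g1" "weak_deriv k f g2"
  shows "AE x in lebesgue. g1 x = g2 x"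
proof -
  have l: "locally_integrable g1" "locally_integrable g2" using assms by (auto simp: weak_deriv_def)
  have "AE x in lebesgue. g1 x + (- 1) * g2 x = 0"
  proof (rule AE_zero_if_test_integrals_zero)
    show "locally_integrable (\<lambda>x. g1 x + (- 1) * g2 x)"
      by (intro locally_integrable_add locally_integrable_mult_continuous l continuous_intros)
    fix \<phi> assume \<phi>: "test_function \<phi>"
    have "(- 1) ^ k * (LINT x|lebesgue. g1 x * \<phi> x) = (- 1) ^ k * (LINT x|lebesgue. g2 x * \<phi> x)"
      using weak_derivD[OF assms(1) \<phi>] weak_derivD[OF assms(2) \<phi>] by (rule subst)
    then have "(LINT x|lebesgue. g1 x * \<phi> x) = (LINT x|lebesgue. g2 x * \<phi> x)" by simp
    then have "(LINT x|lebesgue. g1 x * \<phi> x - g2 x * \<phi> x) = 0"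
      using integrable_mult_test[OF l(1) \<phi>] integrable_mult_test[OF l(2) \<phi>] by simp
    then show "(LINT x|lebesgue. (g1 x + (- 1) * g2 x) * \<phi> x) = 0" by (simp add: left_diff_distrib)
  qed
  then show ?thesis by eventually_elim simp
qed

text \<open>Testing \<open>f\<close> against \<open>x * \<phi>\<close>, whose second derivative is
  \<open>x * \<phi>'' + 2 * \<phi>'\<close>, leaves a term with \<open>\<phi>'\<close> that the
  first weak derivative absorbs.\<close>

lemma weak_deriv_2_times_id:
  assumes "weak_deriv 1 f g1" "weak_deriv 2 f g2"
  shows "weak_deriv 2 (\<lambda>x. x * f x) (\<lambda>x. x * g2 x + 2 * g1 x)"
proof -
  have l: "locally_integrable f" "locally_integrable g1" "locally_integrable g2"
    using assms by (auto simp: weak_deriv_def)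
  have "(LINT x|lebesgue. x * f x * (deriv ^^ 2) \<phi> x) = (LINT x|lebesgue. (x * g2 x + 2 * g1 x) * \<phi> x)"
    if \<phi>: "test_function \<phi>" for \<phi>
  proof -
    have sm: "smooth \<phi>" using \<phi> by (simp add: test_function_iff)
    have x\<phi>: "test_function (\<lambda>x. \<phi> x * x)" by (rule test_function_mult_smooth[OF \<phi> smooth_id])
    have d: "deriv (\<lambda>x::real. x) = (\<lambda>x. 1)" by (auto intro!: DERIV_imp_deriv)
    have e: "(deriv ^^ 2) (\<lambda>x. \<phi> x * x) = (\<lambda>x. (deriv ^^ 2) \<phi> x * x + 2 * deriv \<phi> x)"
      unfolding deriv2_mult_smooth[OF sm smooth_id] using d by (simp add: numeral_2_eq_2)
    have i1: "integrable lebesgue (\<lambda>x. f x * (deriv ^^ 2) (\<lambda>x. \<phi> x * x) x)"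
      by (rule integrable_mult_test[OF l(1) test_function_deriv_n[OF x\<phi>]])
    have i2: "integrable lebesgue (\<lambda>x. f x * deriv \<phi> x)"
      using integrable_mult_test[OF l(1) test_function_deriv_n[OF \<phi>, of 1]] by simp
    have i3: "integrable lebesgue (\<lambda>x. g2 x * (\<phi> x * x))"
      by (rule integrable_mult_test[OF l(3) x\<phi>])
    have i4: "integrable lebesgue (\<lambda>x. g1 x * \<phi> x)"
      by (rule integrable_mult_test[OF l(2) \<phi>])
    have "(LINT x|lebesgue. x * f x * (deriv ^^ 2) \<phi> x)
      = (LINT x|lebesgue. f x * (deriv ^^ 2) (\<lambda>x. \<phi> x * x) x - 2 * (f x * deriv \<phi> x))"
      unfolding e by (simp add: algebra_simps)
    also have "\<dots> = (LINT x|lebesgue. f x * (deriv ^^ 2) (\<lambda>x. \<phi> x * x) x) - 2 * (LINT x|lebesgue. f x * deriv \<phi> x)"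
      using i1 i2 by simp
    also have "\<dots> = (LINT x|lebesgue. g2 x * (\<phi> x * x)) + 2 * (LINT x|lebesgue. g1 x * \<phi> x)"
      using weak_derivD[OF assms(1) \<phi>] weak_derivD[OF assms(2) x\<phi>] by simp
    also have "\<dots> = (LINT x|lebesgue. g2 x * (\<phi> x * x) + 2 * (g1 x * \<phi> x))"
      using i3 i4 by simp
    finally show ?thesis by (simp add: algebra_simps)
  qed
  moreover have "locally_integrable (\<lambda>x. x * f x)" "locally_integrable (\<lambda>x. x * g2 x + 2 * g1 x)"
    by (intro locally_integrable_add locally_integrable_mult_continuous l continuous_intros)+
  ultimately show ?thesis by (simp add: weak_deriv_def)
qed

section \<open>Fourier transform and norms of the data\<close>

lemma integrable_lebesgue_mult_bounded:
  fixes P e :: "real \<Rightarrow> real"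
  assumes P: "integrable lebesgue P" and e: "e \<in> borel_measurable borel" and B: "\<And>x. \<bar>e x\<bar> \<le> B"
  shows "integrable lebesgue (\<lambda>x. P x * e x)"
proof (rule Bochner_Integration.integrable_bound[where f = "\<lambda>x. B * P x"])
  show "(\<lambda>x. P x * e x) \<in> borel_measurable lebesgue"
    using borel_measurable_lebesgue_mult[OF e borel_measurable_integrable[OF P]] by (simp add: mult.commute)
  show "AE x in lebesgue. norm (P x * e x) \<le> norm (B * P x)"
  proof (rule AE_I2)
    fix x
    have "\<bar>e x\<bar> \<le> \<bar>B\<bar>" using B[of x] by linarith
    then have "\<bar>P x\<bar> * \<bar>e x\<bar> \<le> \<bar>P x\<bar> * \<bar>B\<bar>" by (rule mult_left_mono) simp
    then show "norm (P x * e x) \<le> norm (B * P x)" by (simp add: abs_mult mult.commute)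
  qed
qed (use P in simp)

text \<open>Weak derivatives are tested against real functions, so the complex exponential has to be
  split before they can be applied.\<close>

lemma fourier_eq_cos_sin:
  assumes P: "integrable lebesgue P"
  shows "fourier P \<xi> = of_real (LINT x|lebesgue. P x * cos (\<xi> * x)) - \<i> * of_real (LINT x|lebesgue. P x * sin (\<xi> * x))"
proof -
  have c: "integrable lebesgue (\<lambda>x. P x * cos (\<xi> * x))" and s: "integrable lebesgue (\<lambda>x. P x * sin (\<xi> * x))"
    by (rule integrable_lebesgue_mult_bounded[OF P, where B = 1]; simp)+
  have "complex_of_real (P x) * exp (- (\<i> * complex_of_real (x * \<xi>)))
      = of_real (P x * cos (\<xi> * x)) - \<i> * of_real (P x * sin (\<xi> * x))" for x
  proof -
    have "exp (- (\<i> * complex_of_real (x * \<xi>))) = cis (- (\<xi> * x))"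
      by (simp add: cis_conv_exp mult.commute)
    also have "\<dots> = of_real (cos (\<xi> * x)) - \<i> * of_real (sin (\<xi> * x))"
      by (simp add: complex_eq_iff)
    finally show ?thesis by (simp add: right_diff_distrib mult.left_commute)
  qed
  then have "fourier P \<xi> = (LINT x|lebesgue. complex_of_real (P x * cos (\<xi> * x)) - \<i> * complex_of_real (P x * sin (\<xi> * x)))"
    unfolding fourier_def by simp
  also have "\<dots> = (LINT x|lebesgue. complex_of_real (P x * cos (\<xi> * x))) - (LINT x|lebesgue. \<i> * complex_of_real (P x * sin (\<xi> * x)))"
    by (intro Bochner_Integration.integral_diff integrable_mult_right integrable_of_real c s)
  also have "\<dots> = of_real (LINT x|lebesgue. P x * cos (\<xi> * x)) - \<i> * of_real (LINT x|lebesgue. P x * sin (\<xi> * x))"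
    by (simp only: Bochner_Integration.integral_mult_right_zero integral_complex_of_real)
  finally show ?thesis .
qed

text \<open>Sine and cosine are not compactly supported, so they are multiplied by widening cutoffs.
  Integrability of \<open>P\<close> and \<open>g\<close> then permits dominated convergence.\<close>

lemma weak_deriv_2_integral:
  assumes w: "weak_deriv 2 P g" and P: "integrable lebesgue P" and g: "integrable lebesgue g"
    and e: "smooth e" and eb: "\<And>x. \<bar>e x\<bar> \<le> 1" and e'b: "\<And>x. \<bar>deriv e x\<bar> \<le> M"
    and e'': "(deriv ^^ 2) e = (\<lambda>x. - \<xi>\<^sup>2 * e x)"
  shows "(LINT x|lebesgue. g x * e x) = - \<xi>\<^sup>2 * (LINT x|lebesgue. P x * e x)"
proof -
  \<comment> \<open>This cutoff is not 1 near the origin. Its value \<open>K 0\<close> survives in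
    the limit on both sides and is cancelled at the end, so nonvanishing suffices.\<close>
  define K where "K = bump 1 (- 1) 1"
  have tK: "test_function K" by (simp add: K_def test_function_bump)
  have sK: "smooth K" using tK by (simp add: test_function_iff)
  have K0: "K 0 \<noteq> 0" by (simp add: K_def bump_def exp_cutoff_def)
  obtain R B0 where R: "\<And>x. \<bar>x\<bar> > R \<Longrightarrow> K x = 0" and B0: "\<And>x. \<bar>K x\<bar> \<le> B0"
    using test_function_bounded[OF tK] by blast
  obtain B1 where B1': "\<And>x. \<bar>(deriv ^^ 1) K x\<bar> \<le> B1"
    using test_function_bounded[OF test_function_deriv_n[OF tK, of 1]] by blast
  have B1: "\<bar>deriv K x\<bar> \<le> B1" for x using B1'[of x] by simp
  obtain B2 where B2: "\<And>x. \<bar>(deriv ^^ 2) K x\<bar> \<le> B2"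
    using test_function_bounded[OF test_function_deriv_n[OF tK, of 2]] by blast
  \<comment> \<open>Every derivative that falls on the dilated cutoff carries a factor
    \<open>c n\<close>, so in the limit only the term with both derivatives on \<open>e\<close>
    remains.\<close>
  define c where "c n = 1 / real (Suc n)" for n
  have c0: "c n > 0" "c n \<le> 1" for n by (simp_all add: c_def)
  define X where "X n x = K (c n * x + 0)" for n x
  have sX: "smooth (X n)" for n
    unfolding X_def by (rule smooth_affine[OF sK])
  have X1: "deriv (X n) = (\<lambda>x. c n * deriv K (c n * x + 0))" for n
    unfolding X_def by (rule deriv_affine_smooth[OF sK])
  have X2: "(deriv ^^ 2) (X n) = (\<lambda>x. (c n)\<^sup>2 * (deriv ^^ 2) K (c n * x + 0))" for n
    unfolding X_def by (rule deriv2_affine_smooth[OF sK])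
  have tX: "test_function (X n)" for n
    unfolding test_function_iff
  proof (intro conjI sX exI[of _ "R / c n"] allI impI)
    fix x assume "R / c n < \<bar>x\<bar>"
    then have "R < \<bar>c n * x + 0\<bar>" using c0[of n] by (simp add: abs_mult pos_divide_less_eq mult.commute)
    then show "X n x = 0" unfolding X_def by (rule R)
  qed
  have clim: "c \<longlonglongrightarrow> 0" unfolding c_def[abs_def] by real_asymp
  have isc: "isCont K 0"
    using smooth_continuous[OF sK, of UNIV] by (simp add: continuous_on_eq_continuous_at)
  have Xlim: "(\<lambda>n. X n x) \<longlonglongrightarrow> K 0" for x
  proof -
    have "(\<lambda>n. c n * x + 0) \<longlonglongrightarrow> 0 * x + 0" by (intro tendsto_intros clim)
    then have "(\<lambda>n. c n * x + 0) \<longlonglongrightarrow> 0" by simp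
    then show ?thesis unfolding X_def by (rule isCont_tendsto_compose[OF isc])
  qed
  have tXe: "test_function (\<lambda>x. X n x * e x)" for n by (rule test_function_mult_smooth[OF tX e])
  define F where "F n = (deriv ^^ 2) (\<lambda>x. X n x * e x)" for n
  have F: "F n x = (c n)\<^sup>2 * (deriv ^^ 2) K (c n * x + 0) * e x
      + 2 * (c n * deriv K (c n * x + 0) * deriv e x) + X n x * (- \<xi>\<^sup>2 * e x)" for n x
    unfolding F_def deriv2_mult_smooth[OF sX e] X1 X2 e'' by simp
  have Fb: "\<bar>F n x\<bar> \<le> B2 + 2 * (B1 * M) + \<xi>\<^sup>2 * B0" for n x
  proof -
    have 0: "0 \<le> B0" "0 \<le> B1" "0 \<le> B2" "0 \<le> M"
      using B0[of 0] B1[of 0] B2[of 0] e'b[of 0] by linarith+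
    have a: "\<bar>(c n)\<^sup>2 * (deriv ^^ 2) K (c n * x + 0) * e x\<bar> \<le> 1 * B2 * 1"
      unfolding abs_mult using c0[of n] eb[of x] B2 0
      by (intro mult_mono) (auto simp: power_le_one)
    have b: "\<bar>c n * deriv K (c n * x + 0) * deriv e x\<bar> \<le> 1 * B1 * M"
      unfolding abs_mult using c0[of n] e'b[of x] B1 0 by (intro mult_mono) auto
    have d: "\<bar>X n x * (- \<xi>\<^sup>2 * e x)\<bar> \<le> B0 * (\<xi>\<^sup>2 * 1)"
      unfolding abs_mult using eb[of x] B0 0 by (intro mult_mono) (auto simp: X_def)
    have "\<bar>u + 2 * v + w\<bar> \<le> U + 2 * V + W"
      if "\<bar>u\<bar> \<le> U" "\<bar>v\<bar> \<le> V" "\<bar>w\<bar> \<le> W" for u v w U V W :: real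
      using that by linarith
    from this[OF a b d] show ?thesis unfolding F by (simp only: mult_1 mult_1_right mult.commute[of B0])
  qed
  have Flim: "(\<lambda>n. F n x) \<longlonglongrightarrow> K 0 * (- \<xi>\<^sup>2 * e x)" for x
  proof -
    have bz: "(\<lambda>n. c n ^ k * d n) \<longlonglongrightarrow> 0" if "k > 0" "\<And>n. \<bar>d n\<bar> \<le> D" for k d and D :: real
    proof (rule Lim_null_comparison)
      show "\<forall>\<^sub>F n in sequentially. norm (c n ^ k * d n) \<le> c n ^ k * D"
        using c0 that by (intro always_eventually allI) (simp add: abs_mult mult_left_mono less_imp_le)
      have "(\<lambda>n. c n ^ k * D) \<longlonglongrightarrow> 0 ^ k * D" by (intro tendsto_intros clim)
      then show "(\<lambda>n. c n ^ k * D) \<longlonglongrightarrow> 0" using that(1) by (simp add: zero_power)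
    qed
    have "(\<lambda>n. (c n)\<^sup>2 * (deriv ^^ 2) K (c n * x + 0)) \<longlonglongrightarrow> 0" by (rule bz[OF _ B2]) simp
    moreover have "(\<lambda>n. c n * deriv K (c n * x + 0)) \<longlonglongrightarrow> 0" using bz[of 1, OF _ B1] by simp
    ultimately have "(\<lambda>n. F n x) \<longlonglongrightarrow> 0 * e x + 2 * (0 * deriv e x) + K 0 * (- \<xi>\<^sup>2 * e x)"
      unfolding F by (intro tendsto_intros Xlim)
    then show ?thesis by simp
  qed
  have meas: "f \<in> borel_measurable borel" if "smooth f" for f
    using that by (intro borel_measurable_continuous_onI smooth_continuous)
  have sF: "smooth (F n)" for n
    unfolding F_def by (intro smooth_deriv_n smooth_mult sX e)
  have 1: "(\<lambda>n. LINT x|lebesgue. P x * F n x) \<longlonglongrightarrow> (LINT x|lebesgue. P x * (K 0 * (- \<xi>\<^sup>2 * e x)))"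
  proof (rule integral_dominated_convergence[where w = "\<lambda>x. \<bar>P x\<bar> * (B2 + 2 * (B1 * M) + \<xi>\<^sup>2 * B0)"])
    show "(\<lambda>x. P x * (K 0 * (- \<xi>\<^sup>2 * e x))) \<in> borel_measurable lebesgue"
      using borel_measurable_lebesgue_mult[OF _ borel_measurable_integrable[OF P], of "\<lambda>x. K 0 * (- \<xi>\<^sup>2 * e x)"] meas[OF e]
      by (simp add: mult.commute)
    show "(\<lambda>x. P x * F n x) \<in> borel_measurable lebesgue" for n
      using borel_measurable_lebesgue_mult[OF meas[OF sF] borel_measurable_integrable[OF P]]
      by (simp add: mult.commute)
    show "integrable lebesgue (\<lambda>x. \<bar>P x\<bar> * (B2 + 2 * (B1 * M) + \<xi>\<^sup>2 * B0))"
      using P by (intro integrable_mult_left integrable_abs)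
    show "AE x in lebesgue. (\<lambda>n. P x * F n x) \<longlonglongrightarrow> P x * (K 0 * (- \<xi>\<^sup>2 * e x))"
      by (intro AE_I2 tendsto_mult tendsto_const Flim)
    show "AE x in lebesgue. norm (P x * F n x) \<le> \<bar>P x\<bar> * (B2 + 2 * (B1 * M) + \<xi>\<^sup>2 * B0)" for n
      using Fb by (intro AE_I2) (simp only: real_norm_def abs_mult mult_left_mono abs_ge_zero)
  qed
  have 2: "(\<lambda>n. LINT x|lebesgue. g x * (X n x * e x)) \<longlonglongrightarrow> (LINT x|lebesgue. g x * (K 0 * e x))"
  proof (rule integral_dominated_convergence[where w = "\<lambda>x. \<bar>g x\<bar> * B0"])
    show "(\<lambda>x. g x * (K 0 * e x)) \<in> borel_measurable lebesgue"
      using borel_measurable_lebesgue_mult[OF _ borel_measurable_integrable[OF g], of "\<lambda>x. K 0 * e x"] meas[OF e]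
      by (simp add: mult.commute)
    show "(\<lambda>x. g x * (X n x * e x)) \<in> borel_measurable lebesgue" for n
      using borel_measurable_lebesgue_mult[OF meas[OF smooth_mult[OF sX e]] borel_measurable_integrable[OF g]]
      by (simp add: mult.commute)
    show "integrable lebesgue (\<lambda>x. \<bar>g x\<bar> * B0)"
      using g by (intro integrable_mult_left integrable_abs)
    show "AE x in lebesgue. (\<lambda>n. g x * (X n x * e x)) \<longlonglongrightarrow> g x * (K 0 * e x)"
      by (intro AE_I2 tendsto_mult tendsto_const Xlim)
    have "\<bar>X n x * e x\<bar> \<le> B0" for n x
      using mult_mono[OF B0[of "c n * x + 0"] eb[of x]] B0[of 0] by (simp add: X_def abs_mult)
    then show "AE x in lebesgue. norm (g x * (X n x * e x)) \<le> \<bar>g x\<bar> * B0" for n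
      by (intro AE_I2) (simp only: real_norm_def abs_mult[of "g _"] mult_left_mono abs_ge_zero)
  qed
  have "(LINT x|lebesgue. P x * F n x) = (LINT x|lebesgue. g x * (X n x * e x))" for n
    using weak_derivD[OF w tXe] by (simp add: F_def)
  with 1 2 have "(LINT x|lebesgue. P x * (K 0 * (- \<xi>\<^sup>2 * e x))) = (LINT x|lebesgue. g x * (K 0 * e x))"
    using LIMSEQ_unique by simp
  moreover have "(LINT x|lebesgue. P x * (K 0 * (- \<xi>\<^sup>2 * e x))) = (LINT x|lebesgue. (K 0 * - \<xi>\<^sup>2) * (P x * e x))"
    by (simp add: mult_ac)
  moreover have "(LINT x|lebesgue. g x * (K 0 * e x)) = (LINT x|lebesgue. K 0 * (g x * e x))"
    by (simp add: mult_ac)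
  ultimately have "K 0 * - \<xi>\<^sup>2 * (LINT x|lebesgue. P x * e x) = K 0 * (LINT x|lebesgue. g x * e x)"
    by (simp only: Bochner_Integration.integral_mult_right_zero)
  then have "K 0 * (- \<xi>\<^sup>2 * (LINT x|lebesgue. P x * e x)) = K 0 * (LINT x|lebesgue. g x * e x)"
    by (simp only: mult.assoc)
  then show ?thesis by (rule mult_left_cancel[OF K0, THEN iffD1, THEN sym])
qed

lemma fourier_weak_deriv_2:
  assumes w: "weak_deriv 2 P g" and P: "integrable lebesgue P" and g: "integrable lebesgue g"
  shows "fourier g \<xi> = - of_real (\<xi>\<^sup>2) * fourier P \<xi>"
proof -
  have d: "deriv (\<lambda>x. sin (\<xi> * x)) = (\<lambda>x. \<xi> * cos (\<xi> * x))" "deriv (\<lambda>x. cos (\<xi> * x)) = (\<lambda>x. - (\<xi> * sin (\<xi> * x)))"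
    "deriv (\<lambda>x. \<xi> * cos (\<xi> * x)) = (\<lambda>x. - (\<xi> * (\<xi> * sin (\<xi> * x))))"
    "deriv (\<lambda>x. - (\<xi> * sin (\<xi> * x))) = (\<lambda>x. - (\<xi> * (\<xi> * cos (\<xi> * x))))"
    by (rule ext, rule DERIV_imp_deriv, auto intro!: derivative_eq_intros simp: power2_eq_square)+
  have sm: "smooth (\<lambda>x. sin (\<xi> * x))" "smooth (\<lambda>x. cos (\<xi> * x))"
    using smooth_affine[OF smooth_sin, of \<xi> 0] smooth_affine[OF smooth_cos, of \<xi> 0] by simp_all
  have "(LINT x|lebesgue. g x * sin (\<xi> * x)) = - \<xi>\<^sup>2 * (LINT x|lebesgue. P x * sin (\<xi> * x))"
    by (rule weak_deriv_2_integral[OF w P g sm(1), where M = "\<bar>\<xi>\<bar>"])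
       (simp_all add: d numeral_2_eq_2 power2_eq_square mult.assoc abs_mult mult_left_le)
  moreover have "(LINT x|lebesgue. g x * cos (\<xi> * x)) = - \<xi>\<^sup>2 * (LINT x|lebesgue. P x * cos (\<xi> * x))"
    by (rule weak_deriv_2_integral[OF w P g sm(2), where M = "\<bar>\<xi>\<bar>"])
       (simp_all add: d numeral_2_eq_2 power2_eq_square mult.assoc abs_mult mult_left_le)
  ultimately show ?thesis
    unfolding fourier_eq_cos_sin[OF P] fourier_eq_cos_sin[OF g] by (simp add: algebra_simps)
qed

section \<open>Sobolev norms and the second weak derivative in L1\<close>

lemma abs_powr_2: "\<bar>x\<bar> powr 2 = (x::real)\<^sup>2"
  by (cases "x = 0") simp_all

lemma Lp_cong_AE:
  assumes "Lp p f" "AE x in lebesgue. f x = g x"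
  shows "Lp p g"
proof -
  have g: "g \<in> borel_measurable lebesgue" using assms borel_measurable_AE by (auto simp: Lp_def)
  have "integrable lebesgue (\<lambda>x. \<bar>g x\<bar> powr p)"
    using assms g by (subst integrable_cong_AE[of _ _ "\<lambda>x. \<bar>f x\<bar> powr p"]) (auto simp: Lp_def elim: eventually_mono)
  then show ?thesis using g by (simp add: Lp_def)
qed

lemma sobolev_weak_deriv_Lp:
  "sobolev k p f \<Longrightarrow> j \<le> k \<Longrightarrow> weak_deriv j f g \<Longrightarrow> Lp p g"
  unfolding sobolev_def using Lp_cong_AE weak_deriv_unique by blast

text \<open>The norm is computed from the derivatives picked by \<open>SOME\<close>; almost
  everywhere uniqueness transfers one summand to the given \<open>g\<close>.\<close>

lemma H3_norm_ge:
  assumes f: "H3 f" and j: "j \<le> 3" and w: "weak_deriv j f g"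
  shows "integrable lebesgue (\<lambda>x. (g x)\<^sup>2)" "(LINT x|lebesgue. (g x)\<^sup>2) \<le> (H3_norm f)\<^sup>2"
proof -
  define D where "D i = (SOME g. weak_deriv i f g)" for i
  have Lg: "Lp 2 g" by (rule sobolev_weak_deriv_Lp[OF f j w])
  then show "integrable lebesgue (\<lambda>x. (g x)\<^sup>2)" by (simp add: Lp_def abs_powr_2)
  have wD: "weak_deriv j f (D j)" unfolding D_def by (rule someI[of "weak_deriv j f", OF w])
  have LD: "Lp 2 (D j)" by (rule sobolev_weak_deriv_Lp[OF f j wD])
  have "(LINT x|lebesgue. (g x)\<^sup>2) = (LINT x|lebesgue. (D j x)\<^sup>2)"
    using weak_deriv_unique[OF w wD] Lg LD
    by (intro integral_cong_AE) (auto simp: Lp_def elim: eventually_mono)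
  also have "\<dots> = Lp_norm 2 (D j) powr 2"
    by (simp add: Lp_norm_def abs_powr_2 powr_powr)
  also have "\<dots> \<le> (\<Sum>i\<le>3. Lp_norm 2 (D i) powr 2)"
    using j by (intro member_le_sum) auto
  also have "\<dots> = (H3_norm f)\<^sup>2"
    unfolding sobolev_norm_def D_def[symmetric] by (simp add: sum_nonneg powr_powr flip: powr_numeral)
  finally show "(LINT x|lebesgue. (g x)\<^sup>2) \<le> (H3_norm f)\<^sup>2" .
qed

lemma H3_norm_nonneg: "0 \<le> H3_norm f"
  by (simp add: sobolev_norm_def)

lemma integral_inverse_one_plus_sq:
  "integrable lebesgue (\<lambda>x::real. inverse (1 + x\<^sup>2))" "(LINT x|lebesgue. inverse (1 + x\<^sup>2)) = pi"
proof -
  have m: "(\<lambda>x::real. inverse (1 + x\<^sup>2)) \<in> borel_measurable lborel" by measurable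
  have e: "einterval (- \<infinity>) \<infinity> = UNIV" by (auto simp: einterval_def)
  show "integrable lebesgue (\<lambda>x::real. inverse (1 + x\<^sup>2))"
    using integrable_inverse_1_plus_square integrable_completion[OF m] by (simp add: e set_integrable_def)
  show "(LINT x|lebesgue. inverse (1 + x\<^sup>2)) = pi"
    using LBINT_inverse_1_plus_square integral_completion[OF m]
    by (simp add: interval_lebesgue_integral_def e set_lebesgue_integral_def)
qed

text \<open>Cauchy--Schwarz against \<open>(1 + x\<^sup>2)\<^sup>-\<^sup>1\<close>, where \<open>x f'' = (x f)'' - 2 f'\<close> supplies the weight.\<close>
lemma second_weak_deriv_L1:
  assumes P: "H3 P" and XP: "H3 (\<lambda>x. x * P x)" and w: "weak_deriv 2 P g" and g: "integrable lebesgue g"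
  shows "(LINT x|lebesgue. \<bar>g x\<bar>) \<le> 7 * (H3_norm P + H3_norm (\<lambda>x. x * P x))"
proof -
  define N where "N = H3_norm P + H3_norm (\<lambda>x. x * P x)"
  obtain g1 where w1: "weak_deriv 1 P g1" using P unfolding sobolev_def by (meson one_le_numeral)
  define h where "h x = x * g x + 2 * g1 x" for x
  have wh: "weak_deriv 2 (\<lambda>x. x * P x) h" unfolding h_def by (rule weak_deriv_2_times_id[OF w1 w])
  note ig = H3_norm_ge[OF P _ w, simplified] and ig1 = H3_norm_ge[OF P _ w1, simplified]
    and ih = H3_norm_ge[OF XP _ wh, simplified]
  have ptw: "(1 + x\<^sup>2) * (g x)\<^sup>2 \<le> (g x)\<^sup>2 + 2 * (h x)\<^sup>2 + 8 * (g1 x)\<^sup>2" for x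
  proof -
    have "x\<^sup>2 * (g x)\<^sup>2 = (h x - 2 * g1 x)\<^sup>2" by (simp add: h_def power_mult_distrib)
    also have "\<dots> \<le> 2 * (h x)\<^sup>2 + 8 * (g1 x)\<^sup>2"
      using zero_le_power2[of "h x + 2 * g1 x"] by (simp add: power2_eq_square algebra_simps)
    finally show ?thesis by (simp add: distrib_right)
  qed
  have iA: "integrable lebesgue (\<lambda>x. (g x)\<^sup>2 + 2 * (h x)\<^sup>2 + 8 * (g1 x)\<^sup>2)"
    using ig ih ig1 by simp
  have A: "(LINT x|lebesgue. (g x)\<^sup>2 + 2 * (h x)\<^sup>2 + 8 * (g1 x)\<^sup>2) \<le> 9 * N\<^sup>2"
  proof -
    \<comment> \<open>The coefficients 1 and 8 both go with derivatives of \<open>P\<close>, giving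
      9; the coefficient 2 goes with \<open>x * P\<close>.\<close>
    have "(LINT x|lebesgue. (g x)\<^sup>2 + 2 * (h x)\<^sup>2 + 8 * (g1 x)\<^sup>2) \<le> 9 * (H3_norm P)\<^sup>2 + 2 * (H3_norm (\<lambda>x. x * P x))\<^sup>2"
      using ig ih ig1 by simp
    also have "\<dots> \<le> 9 * N\<^sup>2"
      using H3_norm_nonneg[of P] H3_norm_nonneg[of "\<lambda>x. x * P x"] unfolding N_def
      by (simp add: power2_sum)
    finally show ?thesis .
  qed
  have N0: "0 \<le> N" using H3_norm_nonneg by (simp add: N_def)
  \<comment> \<open>Cauchy--Schwarz is carried out as a pointwise inequality of means with the
    weight \<open>L = N + \<epsilon>\<close>. The \<open>\<epsilon>\<close> only serves to divide by
    a positive number when \<open>N = 0\<close>.\<close>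
  have "(LINT x|lebesgue. \<bar>g x\<bar>) \<le> 7 * (N + \<epsilon>)" if \<epsilon>: "\<epsilon> > 0" for \<epsilon>
  proof -
    define L where "L = N + \<epsilon>"
    have L: "L > 0" using N0 \<epsilon> by (simp add: L_def)
    have pt: "\<bar>g x\<bar> \<le> ((g x)\<^sup>2 + 2 * (h x)\<^sup>2 + 8 * (g1 x)\<^sup>2) / (2 * L) + L / 2 * inverse (1 + x\<^sup>2)" for x
    proof -
      define s where "s = sqrt (1 + x\<^sup>2)"
      have s: "s > 0" "s\<^sup>2 = 1 + x\<^sup>2" using one_plus_sq_pos[of x] by (simp_all add: s_def)
      have "0 \<le> (s * \<bar>g x\<bar> - L / s)\<^sup>2" by simp
      also have "\<dots> = s\<^sup>2 * (g x)\<^sup>2 - 2 * L * \<bar>g x\<bar> + L\<^sup>2 / s\<^sup>2"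
        using s(1) by (simp add: power2_diff power_mult_distrib power_divide)
      finally have "2 * L * \<bar>g x\<bar> \<le> (1 + x\<^sup>2) * (g x)\<^sup>2 + L\<^sup>2 * inverse (1 + x\<^sup>2)"
        unfolding s(2) by (simp add: inverse_eq_divide)
      also have "\<dots> \<le> ((g x)\<^sup>2 + 2 * (h x)\<^sup>2 + 8 * (g1 x)\<^sup>2) + L\<^sup>2 * inverse (1 + x\<^sup>2)"
        using ptw[of x] by simp
      finally have "\<bar>g x\<bar> \<le> (((g x)\<^sup>2 + 2 * (h x)\<^sup>2 + 8 * (g1 x)\<^sup>2) + L\<^sup>2 * inverse (1 + x\<^sup>2)) / (2 * L)"
        using L by (simp add: pos_le_divide_eq mult.commute)
      also have "\<dots> = ((g x)\<^sup>2 + 2 * (h x)\<^sup>2 + 8 * (g1 x)\<^sup>2) / (2 * L) + L / 2 * inverse (1 + x\<^sup>2)"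
        using L by (simp add: add_divide_distrib power2_eq_square)
      finally show ?thesis .
    qed
    have "(LINT x|lebesgue. \<bar>g x\<bar>) \<le> (LINT x|lebesgue. ((g x)\<^sup>2 + 2 * (h x)\<^sup>2 + 8 * (g1 x)\<^sup>2) / (2 * L) + L / 2 * inverse (1 + x\<^sup>2))"
      by (intro integral_mono pt integrable_abs g Bochner_Integration.integrable_add integrable_divide_zero integrable_mult_right iA integral_inverse_one_plus_sq)
    also have "\<dots> = (LINT x|lebesgue. (g x)\<^sup>2 + 2 * (h x)\<^sup>2 + 8 * (g1 x)\<^sup>2) / (2 * L) + L / 2 * pi"
      by (subst Bochner_Integration.integral_add)
         (intro integrable_divide_zero integrable_mult_right iA integral_inverse_one_plus_sq |
          simp only: integral_divide_zero Bochner_Integration.integral_mult_right_zero integral_inverse_one_plus_sq)+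
    also have "\<dots> \<le> 9 * L\<^sup>2 / (2 * L) + L / 2 * pi"
    proof -
      have "N\<^sup>2 \<le> L\<^sup>2" using N0 \<epsilon> by (intro power_mono) (auto simp: L_def)
      then show ?thesis using A L by (intro add_right_mono divide_right_mono) auto
    qed
    \<comment> \<open>Since \<open>pi < 4\<close>, the factor is at most 13/2, rounded up to
      7.\<close>
    also have "\<dots> = (9 / 2 + pi / 2) * L" using L by (simp add: power2_eq_square algebra_simps)
    also have "\<dots> \<le> 7 * L" using L pi_less_4 by (intro mult_right_mono) auto
    finally show ?thesis by (simp add: L_def)
  qed
  then have "(LINT x|lebesgue. \<bar>g x\<bar>) \<le> 7 * N + e" if "e > 0" for e
    using that[THEN half_gt_zero] \<open>\<And>\<epsilon>. 0 < \<epsilon> \<Longrightarrow> _\<close>[of "e / 7"] that by simp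
  then show ?thesis unfolding N_def[symmetric] by (rule field_le_epsilon)
qed

section \<open>The Borel form of the Fourier transform and the convolution bound\<close>

definition fhat :: "(real \<Rightarrow> real) \<Rightarrow> real \<Rightarrow> complex" where
  "fhat f \<xi> = (LINT y|lborel. of_real (f y) * cis (- (y * \<xi>)))"

lemma borel_measurable_cis [measurable]:
  "f \<in> borel_measurable M \<Longrightarrow> (\<lambda>x. cis (f x)) \<in> borel_measurable M"
  unfolding cis_conv_exp by measurable

lemma Lp_1_iff: "Lp 1 f \<longleftrightarrow> integrable lebesgue f"
  by (auto simp: Lp_def intro: integrable_norm_cancel)

lemma Lp_norm_1: "Lp_norm 1 f = (LINT x|lebesgue. \<bar>f x\<bar>)"
  by (simp add: Lp_norm_def)

lemma fourier_diff:
  assumes P: "integrable lebesgue P" and g: "integrable lebesgue g"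
  shows "fourier (\<lambda>x. P x - g x) \<xi> = fourier P \<xi> - fourier g \<xi>"
proof -
  have i: "integrable lebesgue (\<lambda>x. h x * cos (\<xi> * x))" "integrable lebesgue (\<lambda>x. h x * sin (\<xi> * x))"
    if "integrable lebesgue h" for h
    by (rule integrable_lebesgue_mult_bounded[OF that, where B = 1]; simp)+
  show ?thesis
    using i[OF P] i[OF g]
    unfolding fourier_eq_cos_sin[OF P] fourier_eq_cos_sin[OF g]
      fourier_eq_cos_sin[OF Bochner_Integration.integrable_diff[OF P g]]
    by (simp add: left_diff_distrib algebra_simps)
qed

text \<open>The norms of the data enter the upper bound only through this L1 estimate of
  \<open>f\<close>.\<close>

lemma fourier_representation:
  assumes P: "H3 P" and P1: "sobolev 2 1 P" and XP: "H3 (\<lambda>x. x * P x)"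
  shows "\<exists>f. integrable lborel f \<and> (\<forall>\<xi>. of_real (1 + \<xi>\<^sup>2) * fourier P \<xi> = fhat f \<xi>) \<and>
    (LINT y|lborel. \<bar>f y\<bar>) \<le> Lp_norm 1 P + 7 * (H3_norm P + H3_norm (\<lambda>x. x * P x))"
proof -
  have iP: "integrable lebesgue P" using P1 by (simp add: sobolev_def Lp_1_iff)
  obtain g where w: "weak_deriv 2 P g" and ig: "integrable lebesgue g"
    using P1 unfolding sobolev_def Lp_1_iff by blast
  define f0 where "f0 x = P x - g x" for x
  have if0: "integrable lebesgue f0" unfolding f0_def by (rule Bochner_Integration.integrable_diff[OF iP ig])
  obtain f where f: "integrable lborel f" and ae: "AE x in lebesgue. f0 x = f x"
    using lebesgue_borel_version[OF if0] by blast
  have [measurable]: "f \<in> borel_measurable borel" using f by simp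
  have "of_real (1 + \<xi>\<^sup>2) * fourier P \<xi> = fhat f \<xi>" for \<xi>
  proof -
    have "of_real (1 + \<xi>\<^sup>2) * fourier P \<xi> = fourier P \<xi> - fourier g \<xi>"
      unfolding fourier_weak_deriv_2[OF w iP ig] by (simp add: algebra_simps)
    also have "\<dots> = fourier f0 \<xi>" unfolding f0_def by (rule fourier_diff[OF iP ig, symmetric])
    also have "\<dots> = (LINT y|lebesgue. of_real (f0 y) * cis (- (y * \<xi>)))"
      unfolding fourier_def cis_conv_exp by simp
    also have "\<dots> = (LINT y|lebesgue. of_real (f y) * cis (- (y * \<xi>)))"
    proof (rule integral_cong_AE)
      have c: "(\<lambda>y. cis (- (y * \<xi>))) \<in> borel_measurable lebesgue"
        by (rule measurable_completion) measurable
      show "(\<lambda>y. of_real (f0 y) * cis (- (y * \<xi>))) \<in> borel_measurable lebesgue"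
        by (intro borel_measurable_times borel_measurable_integrable[OF integrable_of_real[OF if0]] c)
      show "(\<lambda>y. of_real (f y) * cis (- (y * \<xi>))) \<in> borel_measurable lebesgue"
        by (rule measurable_completion) measurable
      show "AE y in lebesgue. complex_of_real (f0 y) * cis (- (y * \<xi>)) = of_real (f y) * cis (- (y * \<xi>))"
        using ae by eventually_elim simp
    qed
    also have "\<dots> = fhat f \<xi>" unfolding fhat_def by (rule integral_completion) measurable
    finally show ?thesis .
  qed
  moreover have "(LINT y|lborel. \<bar>f y\<bar>) \<le> Lp_norm 1 P + 7 * (H3_norm P + H3_norm (\<lambda>x. x * P x))"
  proof -
    have "(LINT y|lborel. \<bar>f y\<bar>) = (LINT y|lebesgue. \<bar>f y\<bar>)"
      by (rule integral_completion[symmetric]) measurable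
    also have "\<dots> = (LINT y|lebesgue. \<bar>f0 y\<bar>)"
      using ae if0 by (intro integral_cong_AE) (auto intro: measurable_completion elim: eventually_mono)
    also have "\<dots> \<le> (LINT y|lebesgue. \<bar>P y\<bar> + \<bar>g y\<bar>)"
      using if0 iP ig by (intro integral_mono) (auto simp: f0_def)
    also have "\<dots> = Lp_norm 1 P + (LINT y|lebesgue. \<bar>g y\<bar>)"
      using iP ig by (simp add: Lp_norm_1)
    finally show ?thesis using second_weak_deriv_L1[OF P XP w ig] by linarith
  qed
  ultimately show ?thesis using f by blast
qed

context
  fixes f :: "real \<Rightarrow> real"
  assumes f: "integrable lborel f"
begin

lemma lborel_integrable_measurable: "f \<in> borel_measurable borel"
  using f by simp

lemma fhat_measurable: "fhat f \<in> borel_measurable borel"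
proof -
  note [measurable] = lborel_integrable_measurable
  show ?thesis unfolding fhat_def by measurable
qed

lemma fhat_osc_measurable:
  "(\<lambda>\<xi>. fhat f \<xi> * osc_kernel \<mu> t X \<xi>) \<in> borel_measurable borel"
  by (intro borel_measurable_times fhat_measurable borel_measurable_osc_kernel)

lemma fhat_integrand_integrable: "integrable lborel (\<lambda>y. of_real (f y) * cis (- (y * \<xi>)))"
proof -
  note [measurable] = lborel_integrable_measurable
  show ?thesis by (rule Bochner_Integration.integrable_bound[OF f]) (auto simp: norm_mult)
qed

lemma fhat_bound: "norm (fhat f \<xi>) \<le> (LINT y|lborel. \<bar>f y\<bar>)"
  unfolding fhat_def
  using integral_norm_bound[of lborel "\<lambda>y. of_real (f y) * cis (- (y * \<xi>))"] by (simp add: norm_mult)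

lemma isCont_fhat: "isCont (fhat f) x"
  unfolding continuous_at_sequentially
proof (intro allI impI)
  note [measurable] = lborel_integrable_measurable
  fix u assume u: "u \<longlonglongrightarrow> x"
  show "(fhat f \<circ> u) \<longlonglongrightarrow> fhat f x"
    unfolding o_def fhat_def
  proof (rule integral_dominated_convergence[where w = "\<lambda>y. \<bar>f y\<bar>"])
    show "AE y in lborel. (\<lambda>i. of_real (f y) * cis (- (y * u i))) \<longlonglongrightarrow> of_real (f y) * cis (- (y * x))"
      unfolding cis_conv_exp by (intro AE_I2 tendsto_intros u)
  qed (use f in \<open>auto simp: norm_mult\<close>)
qed

lemma integrable_fhat_osc:
  assumes \<mu>: "\<mu> > 0"
  shows "integrable lborel (\<lambda>\<xi>. fhat f \<xi> * osc_kernel \<mu> t X \<xi>)"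
proof (rule Bochner_Integration.integrable_bound)
  show "integrable lborel (\<lambda>\<xi>. (LINT y|lborel. \<bar>f y\<bar>) * amplitude \<mu> \<xi>)"
    by (intro integrable_mult_right integrable_amplitude \<mu>)
  show "AE \<xi> in lborel. norm (fhat f \<xi> * osc_kernel \<mu> t X \<xi>) \<le> norm ((LINT y|lborel. \<bar>f y\<bar>) * amplitude \<mu> \<xi>)"
    using fhat_bound by (intro AE_I2) (auto simp: norm_mult osc_kernel_def abs_mult intro!: mult_right_mono)
qed (simp add: fhat_osc_measurable)

lemma zeta_R_eq:
  assumes \<mu>: "\<mu> > 0" and P: "\<And>\<xi>. of_real (1 + \<xi>\<^sup>2) * fourier P \<xi> = fhat f \<xi>"
  shows "zeta_R \<mu> P t X = - (\<i> * of_real (t / 2)) * (LINT \<xi>|lborel. fhat f \<xi> * osc_kernel \<mu> t X \<xi>)"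
proof -
  have "of_real (\<xi> * \<omega> (sqrt \<mu> * \<xi>)) * fourier P \<xi> * exp (- (\<i> * of_real (t * \<xi> * \<omega> (sqrt \<mu> * \<xi>)))) * exp (\<i> * of_real (X * \<xi>))
     = fhat f \<xi> * osc_kernel \<mu> t X \<xi>" for \<xi>
  proof -
    have p: "of_real (1 + \<xi>\<^sup>2) \<noteq> (0 :: complex)" using one_plus_sq_pos(2)[of \<xi>] by (simp only: of_real_eq_0_iff not_False_eq_True)
    have "fhat f \<xi> * of_real (amplitude \<mu> \<xi>) = of_real (phase \<mu> \<xi>) * fourier P \<xi>"
      unfolding P[symmetric] amplitude_def of_real_divide using p by simp
    moreover have "exp (- (\<i> * of_real (t * \<xi> * \<omega> (sqrt \<mu> * \<xi>)))) * exp (\<i> * of_real (X * \<xi>)) = cis (X * \<xi> - t * phase \<mu> \<xi>)"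
      by (simp add: cis_conv_exp phase_def exp_add[symmetric] algebra_simps)
    ultimately show ?thesis unfolding osc_kernel_def phase_def by (simp add: mult.assoc[symmetric])
  qed
  then have "zeta_R \<mu> P t X = - (\<i> * of_real (t / 2)) * (LINT \<xi>|lebesgue. fhat f \<xi> * osc_kernel \<mu> t X \<xi>)"
    unfolding zeta_R_def by simp
  also have "(LINT \<xi>|lebesgue. fhat f \<xi> * osc_kernel \<mu> t X \<xi>) = (LINT \<xi>|lborel. fhat f \<xi> * osc_kernel \<mu> t X \<xi>)"
    by (rule integral_completion) (simp add: fhat_osc_measurable)
  finally show ?thesis .
qed

text \<open>By Fubini the frequency integral is the convolution of \<open>f\<close> with the oscillatory kernel.\<close>
lemma fhat_osc_bound:
  assumes \<mu>: "\<mu> > 0" and K: "\<And>X. norm (LINT \<xi>|lborel. osc_kernel \<mu> t X \<xi>) \<le> K"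
  shows "norm (LINT \<xi>|lborel. fhat f \<xi> * osc_kernel \<mu> t X \<xi>) \<le> (LINT y|lborel. \<bar>f y\<bar>) * K"
proof -
  \<comment> \<open>The factor \<open>cis (- (y * \<xi>))\<close> from the transform of
    \<open>f\<close> translates the kernel from \<open>X\<close> to \<open>X - y\<close>, and the
    bound on the kernel is uniform in its position.\<close>
  define F where "F \<xi> y = of_real (f y) * osc_kernel \<mu> t (X - y) \<xi>" for \<xi> y
  note [measurable] = lborel_integrable_measurable
  have Fe: "F \<xi> y = of_real (f y) * cis (- (y * \<xi>)) * osc_kernel \<mu> t X \<xi>" for \<xi> y
    unfolding F_def osc_kernel_def
    by (simp add: cis_mult left_diff_distrib algebra_simps)
  have "integrable (lborel \<Otimes>\<^sub>M lborel) (\<lambda>(\<xi>, y). F \<xi> y)"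
  proof (rule lborel_pair.Fubini_integrable)
    show "(\<lambda>(\<xi>, y). F \<xi> y) \<in> borel_measurable (lborel \<Otimes>\<^sub>M lborel)"
      unfolding Fe osc_kernel_def by measurable
    have "integrable lborel (\<lambda>\<xi>. (LINT y|lborel. \<bar>f y\<bar>) * \<bar>amplitude \<mu> \<xi>\<bar>)"
      by (intro integrable_mult_right integrable_abs integrable_amplitude \<mu>)
    then show "integrable lborel (\<lambda>\<xi>. LINT y|lborel. norm (case (\<xi>, y) of (\<xi>, y) \<Rightarrow> F \<xi> y))"
      unfolding Fe osc_kernel_def by (simp add: norm_mult)
    show "AE \<xi> in lborel. integrable lborel (\<lambda>y. case (\<xi>, y) of (\<xi>, y) \<Rightarrow> F \<xi> y)"
      unfolding Fe using fhat_integrand_integrable by (intro AE_I2) simp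
  qed
  from lborel_pair.Fubini_integral[OF this]
  have "(LINT \<xi>|lborel. LINT y|lborel. F \<xi> y) = (LINT y|lborel. LINT \<xi>|lborel. F \<xi> y)" by simp
  moreover have "(LINT \<xi>|lborel. LINT y|lborel. F \<xi> y) = (LINT \<xi>|lborel. fhat f \<xi> * osc_kernel \<mu> t X \<xi>)"
    unfolding Fe fhat_def by simp
  ultimately have "(LINT \<xi>|lborel. fhat f \<xi> * osc_kernel \<mu> t X \<xi>) = (LINT y|lborel. of_real (f y) * (LINT \<xi>|lborel. osc_kernel \<mu> t (X - y) \<xi>))"
    unfolding F_def by simp
  also have "norm \<dots> \<le> (LINT y|lborel. norm (of_real (f y) * (LINT \<xi>|lborel. osc_kernel \<mu> t (X - y) \<xi>)))"
    by (rule integral_norm_bound)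
  also have "\<dots> \<le> (LINT y|lborel. \<bar>f y\<bar> * K)"
  proof (rule integral_mono')
    show "integrable lborel (\<lambda>y. \<bar>f y\<bar> * K)" using f by (intro integrable_mult_left integrable_abs)
    show "norm (of_real (f y) * (LINT \<xi>|lborel. osc_kernel \<mu> t (X - y) \<xi>)) \<le> \<bar>f y\<bar> * K" for y
      using K by (simp add: norm_mult mult_left_mono)
    have "0 \<le> K" using K[of 0] by (meson norm_ge_zero order_trans)
    then show "0 \<le> \<bar>f y\<bar> * K" for y by simp
  qed
  also have "\<dots> = (LINT y|lborel. \<bar>f y\<bar>) * K" by simp
  finally show ?thesis .
qed

lemma borel_measurable_fhat_osc:
  "(\<lambda>X. LINT \<xi>|lborel. fhat f \<xi> * osc_kernel \<mu> t X \<xi>) \<in> borel_measurable borel"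
proof -
  note [measurable] = fhat_measurable
  show ?thesis unfolding osc_kernel_def by measurable
qed

end

section \<open>The upper bound\<close>

lemma zeta_R_upper:
  assumes P: "H3 P" "sobolev 2 1 P" "H3 (\<lambda>x. x * P x)"
    and \<mu>: "0 < \<mu>" "\<mu> \<le> \<mu>m" and t: "0 < t"
  shows "Linf_norm (zeta_R \<mu> P t) \<le> ereal (7 * (16 * pi * (1 + \<mu>m) + 1 + 5 * pi / 2) * sqrt (t / \<mu>) *
    (H3_norm P + Lp_norm 1 P + H3_norm (\<lambda>x. x * P x)))"
proof -
  define C where "C = 16 * pi * (1 + \<mu>m) + 1 + 5 * pi / 2"
  define N where "N = H3_norm P + Lp_norm 1 P + H3_norm (\<lambda>x. x * P x)"
  obtain f where f: "integrable lborel f" and fh: "\<And>\<xi>. of_real (1 + \<xi>\<^sup>2) * fourier P \<xi> = fhat f \<xi>"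
    and fN: "(LINT y|lborel. \<bar>f y\<bar>) \<le> Lp_norm 1 P + 7 * (H3_norm P + H3_norm (\<lambda>x. x * P x))"
    using fourier_representation[OF P] by blast
  have C0: "C > 0" using \<mu> unfolding C_def by (simp add: add_nonneg_pos add_pos_pos)
  have "0 \<le> Lp_norm 1 P" by (simp add: Lp_norm_1)
  then have fN: "(LINT y|lborel. \<bar>f y\<bar>) \<le> 7 * N" using fN unfolding N_def by simp
  have "norm (zeta_R \<mu> P t X) \<le> 7 * C * sqrt (t / \<mu>) * N" for X
  proof -
    have "norm (zeta_R \<mu> P t X) = t / 2 * norm (LINT \<xi>|lborel. fhat f \<xi> * osc_kernel \<mu> t X \<xi>)"
      unfolding zeta_R_eq[OF f \<mu>(1) fh] using t by (simp add: norm_mult)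
    also have "\<dots> \<le> t / 2 * ((LINT y|lborel. \<bar>f y\<bar>) * (2 * (C / sqrt (t * \<mu>))))"
      using t osc_kernel_bound[OF \<mu> t] unfolding C_def
      by (intro mult_left_mono fhat_osc_bound[OF f \<mu>(1)]) auto
    also have "\<dots> \<le> t / 2 * ((7 * N) * (2 * (C / sqrt (t * \<mu>))))"
      using t C0 \<mu> by (intro mult_left_mono mult_right_mono fN) auto
    \<comment> \<open>The 2 of the two half lines cancels the 1/2 in \<open>zeta_R\<close>, so only
      the 7 of the L1 estimate remains in front of \<open>C\<close>.\<close>
    also have "\<dots> = 7 * C * (t / sqrt (t * \<mu>)) * N" by simp
    also have "t / sqrt (t * \<mu>) = sqrt (t / \<mu>)"
    proof -
      have "t = sqrt t * sqrt t" using t by simp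
      then show ?thesis using t \<mu> by (simp add: real_sqrt_mult real_sqrt_divide divide_simps)
    qed
    finally show ?thesis .
  qed
  \<comment> \<open>The essential supremum of a non-measurable function is top by definition, so the
    pointwise bound alone would not be enough.\<close>
  moreover have "(\<lambda>X. ereal (norm (zeta_R \<mu> P t X))) \<in> borel_measurable lebesgue"
  proof (rule measurable_completion)
    define L where "L X = (LINT \<xi>|lborel. fhat f \<xi> * osc_kernel \<mu> t X \<xi>)" for X
    have [measurable]: "L \<in> borel_measurable borel"
      using borel_measurable_fhat_osc[OF f] by (simp add: L_def[abs_def])
    show "(\<lambda>X. ereal (norm (zeta_R \<mu> P t X))) \<in> borel_measurable lborel"
      unfolding zeta_R_eq[OF f \<mu>(1) fh] L_def[symmetric] by measurable
  qed
  ultimately show ?thesis unfolding Linf_norm_def C_def[symmetric] N_def[symmetric]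
    by (intro esssup_I AE_I2) auto
qed

section \<open>The lower bound\<close>

lemma std_normal_fourier:
  "(LINT z|lborel. of_real (std_normal_density z) * cis (s * z)) = of_real (exp (- s\<^sup>2 / 2))"
proof -
  have "(LINT z|lborel. of_real (std_normal_density z) * cis (s * z)) = char std_normal_distribution s"
    unfolding char_def
    by (subst integral_density) (auto simp: cis_conv_exp scaleR_conv_of_real)
  then show ?thesis by (simp add: char_std_normal_distribution)
qed

lemma integral_std_normal: "integrable lborel std_normal_density" "(LINT z|lborel. std_normal_density z) = 1"
  using std_normal_moment_even[of 0]
  by (auto simp: has_bochner_integral_iff)

lemma integral_std_normal_4:
  "integrable lborel (\<lambda>z. std_normal_density z * z ^ 4)" "(LINT z|lborel. std_normal_density z * z ^ 4) = 3"
  using std_normal_moment_even[of 2]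
  by (auto simp: has_bochner_integral_iff fact_numeral)

lemma phase_taylor:
  assumes \<mu>: "0 < \<mu>" "\<mu> \<le> \<mu>m" and x0: "0 < x0"
  shows "\<bar>phase \<mu> (x0 + h) - phase \<mu> x0 - disp1 (sqrt \<mu> * x0) * h\<bar> \<le> (24 / x0 + sqrt \<mu>m) * h\<^sup>2 / 2"
proof (cases "\<bar>h\<bar> \<le> x0 / 2")
  case False
  have y: "sqrt \<mu> * x0 > 0" using \<mu> x0 by simp
  have "\<bar>disp1 (sqrt \<mu> * x0) * h\<bar> \<le> 1 * \<bar>h\<bar>"
    unfolding abs_mult using disp1_bounds[OF y] by (intro mult_right_mono) auto
  moreover have "\<bar>phase \<mu> (x0 + h)\<bar> \<le> x0 + \<bar>h\<bar>" using abs_phase_le[of \<mu> "x0 + h"] x0 by linarith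
  moreover have "\<bar>phase \<mu> x0\<bar> \<le> x0" using abs_phase_le[of \<mu> x0] x0 by linarith
  ultimately have "\<bar>phase \<mu> (x0 + h) - phase \<mu> x0 - disp1 (sqrt \<mu> * x0) * h\<bar> \<le> 6 * \<bar>h\<bar>"
    using False by linarith
  \<comment> \<open>The 24 is dictated by this far region: \<open>x0 < 2 * \<bar>h\<bar>\<close>
    turns the trivial bound \<open>6 * \<bar>h\<bar>\<close> into
    \<open>12 * h^2 / x0\<close>.\<close>
  also have "\<dots> \<le> 24 / x0 * h\<^sup>2 / 2"
  proof -
    have "x0 * \<bar>h\<bar> \<le> (2 * \<bar>h\<bar>) * \<bar>h\<bar>" using False by (intro mult_right_mono) auto
    then have "x0 * (6 * \<bar>h\<bar>) \<le> 12 * h\<^sup>2" by (simp add: power2_eq_square)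
    then have "6 * \<bar>h\<bar> \<le> 12 * h\<^sup>2 / x0" using x0 by (simp add: pos_le_divide_eq mult.commute)
    then show ?thesis by simp
  qed
  also have "\<dots> \<le> (24 / x0 + sqrt \<mu>m) * h\<^sup>2 / 2"
    using \<mu> by (intro divide_right_mono mult_right_mono) auto
  finally show ?thesis .
next
  case True
  show ?thesis
  proof (cases "h = 0")
    case False
    define diff where "diff n = (if n = 0 then phase \<mu> else if n = 1 then (\<lambda>x. disp1 (sqrt \<mu> * x))
      else (\<lambda>x. sqrt \<mu> * disp2 (sqrt \<mu> * x)))" for n :: nat
    have "\<exists>z. (if x0 + h < x0 then x0 + h < z \<and> z < x0 else x0 < z \<and> z < x0 + h) \<and>
        phase \<mu> (x0 + h) = (\<Sum>m<2. (diff m x0 / fact m) * (x0 + h - x0) ^ m) + (diff 2 z / fact 2) * (x0 + h - x0) ^ 2"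
    proof (rule Taylor[where a = "x0 / 2" and b = "3 * x0 / 2"])
      show "\<forall>m t. m < 2 \<and> x0 / 2 \<le> t \<and> t \<le> 3 * x0 / 2 \<longrightarrow> (diff m has_real_derivative diff (Suc m) t) (at t)"
        using phase_deriv[OF \<mu>(1)] phase_deriv2[OF \<mu>(1)] x0 by (auto simp: diff_def less_2_cases_iff)
    qed (use True False x0 in \<open>auto simp: diff_def\<close>)
    then obtain z where z: "if x0 + h < x0 then x0 + h < z \<and> z < x0 else x0 < z \<and> z < x0 + h"
      and e: "phase \<mu> (x0 + h) = (\<Sum>m<2. (diff m x0 / fact m) * h ^ m) + (diff 2 z / fact 2) * h ^ 2"
      by auto
    have z2: "x0 / 2 \<le> z" using z True by (auto split: if_splits)
    then have z0: "z > 0" using x0 by linarith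
    then have y: "sqrt \<mu> * z > 0" using \<mu> by simp
    have "\<bar>sqrt \<mu> * disp2 (sqrt \<mu> * z)\<bar> \<le> sqrt \<mu> * (1 / (4 * (sqrt \<mu> * z)) + 1)"
      unfolding abs_mult using disp2_abs[OF y] \<mu> by (auto intro!: mult_left_mono)
    also have "\<dots> = 1 / (4 * z) + sqrt \<mu>" using \<mu> z0 by (simp add: distrib_left)
    also have "\<dots> \<le> 24 / x0 + sqrt \<mu>m"
    proof (rule add_mono)
      have "1 / (4 * z) \<le> 1 / (4 * (x0 / 2))" using z2 x0 by (intro divide_left_mono) auto
      also have "\<dots> \<le> 24 / x0" using x0 by (simp add: divide_simps)
      finally show "1 / (4 * z) \<le> 24 / x0" .
    qed (use \<mu> in simp)
    finally have b: "\<bar>sqrt \<mu> * disp2 (sqrt \<mu> * z)\<bar> \<le> 24 / x0 + sqrt \<mu>m" .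
    have "phase \<mu> (x0 + h) - phase \<mu> x0 - disp1 (sqrt \<mu> * x0) * h = sqrt \<mu> * disp2 (sqrt \<mu> * z) * (h\<^sup>2 / 2)"
      using e by (simp add: diff_def numeral_2_eq_2)
    also have "\<bar>\<dots>\<bar> = \<bar>sqrt \<mu> * disp2 (sqrt \<mu> * z)\<bar> * (h\<^sup>2 / 2)" by (simp only: abs_mult) simp
    also have "\<dots> \<le> (24 / x0 + sqrt \<mu>m) * (h\<^sup>2 / 2)" by (rule mult_right_mono[OF b]) simp
    finally show ?thesis by simp
  qed simp
qed

text \<open>The lower bound \<open>1 / (1 + y)\<close> for \<open>tanh y / y\<close> decreases in
  \<mu>, so inserting \<open>\<mu>m\<close> gives a constant free of \<mu>.\<close>

lemma phase_lower:
  assumes \<mu>: "0 < \<mu>" "\<mu> \<le> \<mu>m" and x: "0 < x"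
  shows "x / sqrt (1 + sqrt \<mu>m * x) \<le> phase \<mu> x"
proof -
  define y where "y = sqrt \<mu> * x"
  have y: "y > 0" "y \<le> sqrt \<mu>m * x" using \<mu> x by (auto simp: y_def intro: mult_right_mono)
  have "1 / (1 + sqrt \<mu>m * x) \<le> 1 / (1 + y)" using y by (intro divide_left_mono) auto
  also have "\<dots> \<le> tanh y / y"
    using tanh_lower[of y] y by (simp add: pos_le_divide_eq)
  finally have "sqrt (1 / (1 + sqrt \<mu>m * x)) \<le> \<omega> y" using y by (simp only: \<omega>_def real_sqrt_le_iff) simp
  then have "x * sqrt (1 / (1 + sqrt \<mu>m * x)) \<le> x * \<omega> y" using x by (intro mult_left_mono) auto
  then show ?thesis by (simp add: phase_def y_def real_sqrt_divide)
qed

text \<open>The real part of the oscillating factor is controlled by \<open>cos x \<ge> 1 - x\<^sup>2 / 2\<close>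
  and the fourth moment of the Gaussian.\<close>
lemma gaussian_oscillation_lower:
  assumes [measurable]: "\<theta> \<in> borel_measurable borel" and \<theta>: "\<And>z. \<bar>\<theta> z\<bar> \<le> z\<^sup>2 / 2"
  shows "5 / 8 \<le> norm (LINT z|lborel. of_real (std_normal_density z) * cis (\<theta> z))"
proof -
  have i: "integrable lborel (\<lambda>z. of_real (std_normal_density z) * cis (\<theta> z))"
    by (rule Bochner_Integration.integrable_bound[OF integral_std_normal(1)]) (auto simp: norm_mult)
  have i2: "integrable lborel (\<lambda>z. std_normal_density z * cos (\<theta> z))"
    by (rule Bochner_Integration.integrable_bound[OF integral_std_normal(1)])
       (auto simp: abs_mult mult_left_le)
  have pt: "std_normal_density z - std_normal_density z * z ^ 4 / 8 \<le> std_normal_density z * cos (\<theta> z)" for z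
  proof -
    have "(\<theta> z)\<^sup>2 \<le> (z\<^sup>2 / 2)\<^sup>2" using power_mono[OF \<theta>[of z], of 2] by simp
    then have "(\<theta> z)\<^sup>2 \<le> z ^ 4 / 4" by (simp add: power_divide)
    moreover have "1 - (\<theta> z)\<^sup>2 / 2 \<le> cos (\<theta> z)"
    proof -
      have "(sin (\<theta> z / 2))\<^sup>2 \<le> (\<theta> z / 2)\<^sup>2"
        using abs_sin_x_le_abs_x[of "\<theta> z / 2"] by (simp only: abs_le_square_iff)
      then show ?thesis using cos_double_sin[of "\<theta> z / 2"] by (simp add: power_divide)
    qed
    ultimately have "1 - z ^ 4 / 8 \<le> cos (\<theta> z)" by linarith
    then have "std_normal_density z * (1 - z ^ 4 / 8) \<le> std_normal_density z * cos (\<theta> z)"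
      by (intro mult_left_mono) auto
    then show ?thesis by (simp add: right_diff_distrib)
  qed
  \<comment> \<open>The correction to the cosine is at most \<open>z ^ 4 / 8\<close> and the fourth
    moment is 3, hence \<open>1 - 3/8\<close>.\<close>
  have "5 / 8 = (LINT z|lborel. std_normal_density z - std_normal_density z * z ^ 4 / 8)"
    using integral_std_normal integral_std_normal_4 by simp
  also have "\<dots> \<le> (LINT z|lborel. std_normal_density z * cos (\<theta> z))"
    using integral_std_normal integral_std_normal_4 i2 by (intro integral_mono pt) auto
  also have "\<dots> = Re (LINT z|lborel. of_real (std_normal_density z) * cis (\<theta> z))"
    using i by (subst integral_Re[symmetric]) auto
  also have "\<dots> \<le> norm (LINT z|lborel. of_real (std_normal_density z) * cis (\<theta> z))"
    by (rule complex_Re_le_cmod)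
  finally show ?thesis .
qed

text \<open>Testing \<open>\<zeta>\<^sub>R\<close> against the unit-mass wave packet
  \<open>\<epsilon> g(\<epsilon> (X - X0)) e\<^sup>-\<^sup>i\<^sup>x\<^sup>0\<^sup>X\<close>, where \<open>g\<close> is the standard Gaussian.\<close>
lemma zeta_R_pairing:
  assumes f: "integrable lborel f" and fh: "\<And>\<xi>. of_real (1 + \<xi>\<^sup>2) * fourier P \<xi> = fhat f \<xi>"
    and \<mu>: "0 < \<mu>" and t: "0 < t" and \<epsilon>: "0 < \<epsilon>"
    and ae: "AE X in lebesgue. norm (zeta_R \<mu> P t X) \<le> c"
  shows "t / 2 * (\<epsilon> * sqrt (2 * pi) * norm (LINT z|lborel. of_real (std_normal_density z) *
    (fhat f (x0 + \<epsilon> * z) * of_real (amplitude \<mu> (x0 + \<epsilon> * z)) * cis (\<epsilon> * z * X0 - t * phase \<mu> (x0 + \<epsilon> * z))))) \<le> c"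
    (is "t / 2 * (_ * norm ?I) \<le> c")
proof -
  note [measurable] = lborel_integrable_measurable[OF f] fhat_measurable[OF f]
  define L where "L X = (LINT \<xi>|lborel. fhat f \<xi> * osc_kernel \<mu> t X \<xi>)" for X
  have Lm [measurable]: "L \<in> borel_measurable borel"
    using borel_measurable_fhat_osc[OF f] by (simp add: L_def[abs_def])
  \<comment> \<open>A probability density, so the pairing with \<open>w\<close> cannot exceed an
    essential bound for the function paired with it.\<close>
  define w where "w X = \<epsilon> * std_normal_density (\<epsilon> * (X - X0))" for X
  have wm [measurable]: "w \<in> borel_measurable borel" unfolding w_def by measurable
  have w0: "0 \<le> w X" for X using \<epsilon> by (simp add: w_def)
  have affine: "- (\<epsilon> * X0) + \<epsilon> * X = \<epsilon> * (X - X0)" for X by (simp add: right_diff_distrib)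
  have iw: "integrable lborel w"
    using lborel_integrable_real_affine[OF integral_std_normal(1), of \<epsilon> "- (\<epsilon> * X0)"] \<epsilon>
    unfolding w_def affine by simp
  have w1: "(LINT X|lborel. w X) = 1"
    using lborel_integral_real_affine[of \<epsilon> std_normal_density "- (\<epsilon> * X0)"] \<epsilon> integral_std_normal(2)
    unfolding w_def affine by simp
  define b where "b \<xi> = fhat f \<xi> * of_real (amplitude \<mu> \<xi>) * cis (- (t * phase \<mu> \<xi>))" for \<xi>
  have bm [measurable]: "b \<in> borel_measurable borel" unfolding b_def by measurable
  have ib: "integrable lborel b"
  proof (rule Bochner_Integration.integrable_bound)
    show "integrable lborel (\<lambda>\<xi>. (LINT y|lborel. \<bar>f y\<bar>) * amplitude \<mu> \<xi>)"
      by (intro integrable_mult_right integrable_amplitude \<mu>)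
    show "AE \<xi> in lborel. norm (b \<xi>) \<le> norm ((LINT y|lborel. \<bar>f y\<bar>) * amplitude \<mu> \<xi>)"
      using fhat_bound[OF f] by (intro AE_I2) (auto simp: b_def norm_mult abs_mult intro!: mult_right_mono)
  qed simp
  define W where "W X = of_real (w X) * cis (- (x0 * X))" for X
  have Wm [measurable]: "W \<in> borel_measurable borel" unfolding W_def by measurable
  define G where "G X \<xi> = b \<xi> * (of_real (w X) * cis ((\<xi> - x0) * X))" for X \<xi>
  have Ge: "G X \<xi> = W X * (fhat f \<xi> * osc_kernel \<mu> t X \<xi>)" for X \<xi>
  proof -
    have "cis (- (t * phase \<mu> \<xi>)) * cis ((\<xi> - x0) * X) = cis (- (x0 * X)) * cis (X * \<xi> - t * phase \<mu> \<xi>)"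
      by (simp add: cis_mult algebra_simps)
    then show ?thesis unfolding G_def b_def W_def osc_kernel_def by (simp add: mult_ac)
  qed
  have iG: "integrable (lborel \<Otimes>\<^sub>M lborel) (\<lambda>(X, \<xi>). G X \<xi>)"
  proof (rule lborel_pair.Fubini_integrable)
    show "(\<lambda>(X, \<xi>). G X \<xi>) \<in> borel_measurable (lborel \<Otimes>\<^sub>M lborel)"
      unfolding G_def by measurable
    have "integrable lborel (\<lambda>X. w X * (LINT \<xi>|lborel. norm (b \<xi>)))"
      by (intro integrable_mult_left iw)
    moreover have "(LINT \<xi>|lborel. norm (case (X, \<xi>) of (X, \<xi>) \<Rightarrow> G X \<xi>)) = w X * (LINT \<xi>|lborel. norm (b \<xi>))" for X
      using w0[of X] by (simp add: G_def norm_mult mult.commute)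
    ultimately show "integrable lborel (\<lambda>X. LINT \<xi>|lborel. norm (case (X, \<xi>) of (X, \<xi>) \<Rightarrow> G X \<xi>))" by simp
    show "AE X in lborel. integrable lborel (\<lambda>\<xi>. case (X, \<xi>) of (X, \<xi>) \<Rightarrow> G X \<xi>)"
    proof (rule AE_I2)
      fix X
      show "integrable lborel (\<lambda>\<xi>. case (X, \<xi>) of (X, \<xi>) \<Rightarrow> G X \<xi>)"
        unfolding Ge using integrable_fhat_osc[OF f \<mu>] by simp
    qed
  qed
  \<comment> \<open>On the frequency side the packet is again a Gaussian, centred at
    \<open>x0\<close> with width \<open>\<epsilon>\<close>.\<close>
  have V: "(LINT X|lborel. of_real (w X) * cis ((\<xi> - x0) * X))
      = cis ((\<xi> - x0) * X0) * of_real (exp (- ((\<xi> - x0) / \<epsilon>)\<^sup>2 / 2))" for \<xi>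
  proof -
    define s where "s = (\<xi> - x0) / \<epsilon>"
    have se: "\<xi> - x0 = s * \<epsilon>" using \<epsilon> by (simp add: s_def)
    have "of_real (exp (- s\<^sup>2 / 2)) = (LINT z|lborel. of_real (std_normal_density z) * cis (s * z))"
      by (rule std_normal_fourier[symmetric])
    also have "\<dots> = \<epsilon> *\<^sub>R (LINT X|lborel. of_real (std_normal_density (\<epsilon> * (X - X0))) * cis (s * (\<epsilon> * (X - X0))))"
      using lborel_integral_real_affine[of \<epsilon> "\<lambda>z. of_real (std_normal_density z) * cis (s * z)" "- (\<epsilon> * X0)"] \<epsilon>
      unfolding affine by simp
    also have "\<dots> = (LINT X|lborel. of_real (w X) * cis (s * (\<epsilon> * (X - X0))))"
      by (simp add: w_def scaleR_conv_of_real mult.assoc flip: Bochner_Integration.integral_mult_right_zero)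
    finally have *: "of_real (exp (- s\<^sup>2 / 2)) = (LINT X|lborel. of_real (w X) * cis (s * (\<epsilon> * (X - X0))))" .
    have pt: "of_real (w X) * cis ((\<xi> - x0) * X) = cis ((\<xi> - x0) * X0) * (of_real (w X) * cis (s * (\<epsilon> * (X - X0))))" for X
    proof -
      have "cis ((\<xi> - x0) * X) = cis ((\<xi> - x0) * X0) * cis (s * (\<epsilon> * (X - X0)))"
        unfolding se by (simp add: cis_mult algebra_simps)
      then show ?thesis by simp
    qed
    show ?thesis unfolding s_def[symmetric] * pt by (simp only: Bochner_Integration.integral_mult_right_zero)
  qed
  have "(LINT X|lborel. W X * L X) = (LINT X|lborel. LINT \<xi>|lborel. G X \<xi>)"
    unfolding Ge L_def by simp
  also have "\<dots> = (LINT \<xi>|lborel. LINT X|lborel. G X \<xi>)"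
    using lborel_pair.Fubini_integral[OF iG] by simp
  also have "\<dots> = (LINT \<xi>|lborel. b \<xi> * (cis ((\<xi> - x0) * X0) * of_real (exp (- ((\<xi> - x0) / \<epsilon>)\<^sup>2 / 2))))"
    unfolding G_def V[symmetric] by simp
  \<comment> \<open>Substituting \<open>\<xi> = x0 + \<epsilon> * z\<close> restores a standard
    Gaussian; \<open>exp (- z^2 / 2)\<close> is \<open>sqrt (2 * pi)\<close> times its density,
    which explains that factor in the statement.\<close>
  also have "\<dots> = \<epsilon> *\<^sub>R (LINT z|lborel. b (x0 + \<epsilon> * z) * (cis (\<epsilon> * z * X0) * of_real (exp (- z\<^sup>2 / 2))))"
    using lborel_integral_real_affine[of \<epsilon> "\<lambda>\<xi>. b \<xi> * (cis ((\<xi> - x0) * X0) * of_real (exp (- ((\<xi> - x0) / \<epsilon>)\<^sup>2 / 2)))" x0] \<epsilon>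
    by simp
  also have "(LINT z|lborel. b (x0 + \<epsilon> * z) * (cis (\<epsilon> * z * X0) * of_real (exp (- z\<^sup>2 / 2)))) = of_real (sqrt (2 * pi)) * ?I"
  proof -
    have "b (x0 + \<epsilon> * z) * (cis (\<epsilon> * z * X0) * of_real (exp (- z\<^sup>2 / 2))) = of_real (sqrt (2 * pi)) *
      (of_real (std_normal_density z) * (fhat f (x0 + \<epsilon> * z) * of_real (amplitude \<mu> (x0 + \<epsilon> * z)) *
        cis (\<epsilon> * z * X0 - t * phase \<mu> (x0 + \<epsilon> * z))))" for z
    proof -
      have e: "exp (- z\<^sup>2 / 2) = sqrt (2 * pi) * std_normal_density z"
        by (simp add: std_normal_density_def)
      have ph: "cis (- (t * phase \<mu> (x0 + \<epsilon> * z))) * cis (\<epsilon> * z * X0) = cis (\<epsilon> * z * X0 - t * phase \<mu> (x0 + \<epsilon> * z))"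
        by (simp add: cis_mult)
      show ?thesis unfolding b_def e of_real_mult ph[symmetric] by (simp only: mult_ac)
    qed
    then show ?thesis by simp
  qed
  finally have WL: "norm (LINT X|lborel. W X * L X) = \<epsilon> * sqrt (2 * pi) * norm ?I"
    using \<epsilon> by (simp add: norm_mult)
  have "AE X in lborel. norm (zeta_R \<mu> P t X) \<le> c" using ae by (simp add: AE_completion_iff)
  then have aeL: "AE X in lborel. norm (W X * L X) \<le> w X * (2 * c / t)"
  proof eventually_elim
    case (elim X)
    have "norm (zeta_R \<mu> P t X) = t / 2 * norm (L X)"
      unfolding zeta_R_eq[OF f \<mu> fh] L_def using t by (simp add: norm_mult)
    then have "norm (L X) \<le> 2 * c / t" using elim t by (simp add: pos_le_divide_eq mult.commute)
    then have "w X * norm (L X) \<le> w X * (2 * c / t)" using w0 by (rule mult_left_mono)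
    then show ?case using w0[of X] by (simp add: W_def norm_mult)
  qed
  have iR: "integrable lborel (\<lambda>X. w X * (2 * c / t))" by (intro integrable_mult_left iw)
  have "norm (LINT X|lborel. W X * L X) \<le> (LINT X|lborel. norm (W X * L X))"
    by (rule integral_norm_bound)
  also have "\<dots> \<le> (LINT X|lborel. w X * (2 * c / t))"
  proof (rule integral_mono_AE[OF _ iR aeL])
    have "AE X in lborel. norm (norm (W X * L X)) \<le> norm (w X * (2 * c / t))"
    proof -
      have imp: "norm (norm u) \<le> norm v" if "norm u \<le> v" for u :: complex and v :: real
        using that by (simp add: order_trans[OF that abs_ge_self])
      show ?thesis using aeL by eventually_elim (rule imp)
    qed
    then show "integrable lborel (\<lambda>X. norm (W X * L X))"
      by (rule Bochner_Integration.integrable_bound[OF iR, rotated]) measurable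
  qed
  also have "\<dots> = 2 * c / t" using w1 by simp
  finally show ?thesis unfolding WL using t by (simp add: pos_le_divide_eq mult.commute)
qed

lemma zeta_R_lower:
  assumes P: "H3 P" "sobolev 2 1 P" "H3 (\<lambda>x. x * P x)" and P0: "fourier P 0 \<noteq> 0" and \<mu>m: "\<mu>m > 0"
  shows "\<exists>c>0. \<forall>\<mu>. 0 < \<mu> \<and> \<mu> \<le> \<mu>m \<longrightarrow>
    Liminf at_top (\<lambda>t::real. Linf_norm (\<lambda>X. complex_of_real (1 / sqrt t) * zeta_R \<mu> P t X)) \<ge> ereal c"
proof -
  obtain f where f: "integrable lborel f" and fh: "\<And>\<xi>. of_real (1 + \<xi>\<^sup>2) * fourier P \<xi> = fhat f \<xi>"
    using fourier_representation[OF P] by blast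
  note [measurable] = lborel_integrable_measurable[OF f] fhat_measurable[OF f]
  have "fhat f 0 \<noteq> 0" using fh[of 0] P0 by simp
  have "(fhat f \<longlongrightarrow> fhat f 0) (at_right 0)"
    using isCont_fhat[OF f, of 0] by (simp add: isCont_def filterlim_at_split)
  then have "\<forall>\<^sub>F x in at_right 0. fhat f x \<noteq> 0"
    using \<open>fhat f 0 \<noteq> 0\<close> by (rule tendsto_imp_eventually_ne)
  then have "\<forall>\<^sub>F x in at_right 0. fhat f x \<noteq> 0 \<and> x > 0"
    using eventually_at_right_less by (rule eventually_conj)
  then have "\<exists>x0. fhat f x0 \<noteq> 0 \<and> x0 > 0"
    by (rule eventually_happens'[OF trivial_limit_at_right_real])
  then obtain x0 where x0: "fhat f x0 \<noteq> 0" "x0 > 0" by blast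
  define B where "B = 24 / x0 + sqrt \<mu>m"
  have B: "B > 0" using x0 \<mu>m by (simp add: B_def add_pos_pos)
  define q where "q = x0 / sqrt (1 + sqrt \<mu>m * x0) / (1 + x0\<^sup>2) * norm (fhat f x0)"
  have q: "q > 0" using x0 \<mu>m one_plus_sq_pos[of x0] by (simp add: q_def add_pos_pos)
  define c where "c = q / (4 * sqrt B)"
  have c: "c > 0" using q B by (simp add: c_def)
  have "ereal c \<le> Liminf at_top (\<lambda>t::real. Linf_norm (\<lambda>X. complex_of_real (1 / sqrt t) * zeta_R \<mu> P t X))"
    if \<mu>: "0 < \<mu>" "\<mu> \<le> \<mu>m" for \<mu>
  proof (rule Liminf_bounded)
    define a where "a \<xi> = fhat f \<xi> * of_real (amplitude \<mu> \<xi>)" for \<xi>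
    have am [measurable]: "a \<in> borel_measurable borel" unfolding a_def by measurable
    define M where "M = (LINT y|lborel. \<bar>f y\<bar>)"
    have ab: "norm (a \<xi>) \<le> M" for \<xi>
    proof -
      have "\<bar>phase \<mu> \<xi>\<bar> \<le> 1 + \<xi>\<^sup>2"
        using abs_phase_le[of \<mu> \<xi>] zero_le_power2[of "\<bar>\<xi>\<bar> - 1"] by (simp add: power2_eq_square algebra_simps)
      then have "\<bar>amplitude \<mu> \<xi>\<bar> \<le> 1"
        using one_plus_sq_pos[of \<xi>] by (simp add: amplitude_def)
      then have "norm (fhat f \<xi>) * \<bar>amplitude \<mu> \<xi>\<bar> \<le> M * 1"
        using fhat_bound[OF f, of \<xi>] unfolding M_def by (intro mult_mono) auto
      then show ?thesis by (simp add: a_def norm_mult)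
    qed
    have ac: "isCont a \<xi>" for \<xi>
    proof -
      have "continuous_on UNIV (amplitude \<mu>)"
        unfolding amplitude_def[abs_def] by (intro continuous_intros) (auto simp: one_plus_sq_pos)
      then have "isCont (amplitude \<mu>) \<xi>" by (simp add: continuous_on_eq_continuous_at)
      then show ?thesis unfolding a_def[abs_def] by (intro continuous_intros isCont_fhat[OF f])
    qed
    have aq: "q \<le> norm (a x0)"
    proof -
      have "x0 / sqrt (1 + sqrt \<mu>m * x0) / (1 + x0\<^sup>2) \<le> amplitude \<mu> x0"
        unfolding amplitude_def by (intro divide_right_mono phase_lower \<mu> x0) simp
      then have "q \<le> amplitude \<mu> x0 * norm (fhat f x0)" unfolding q_def by (rule mult_right_mono) simp
      also have "\<dots> \<le> norm (a x0)" by (simp add: a_def norm_mult mult.commute[of "norm _"] mult_right_mono)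
      finally show ?thesis .
    qed
    \<comment> \<open>Chosen so that \<open>t * B * (e t)^2 = 1\<close>: the Taylor remainder of the
      rescaled phase is then at most \<open>z^2 / 2\<close>, as
      \<open>gaussian_oscillation_lower\<close> requires.\<close>
    define e where "e t = 1 / sqrt (B * t)" for t
    \<comment> \<open>The error of freezing the amplitude at \<open>x0\<close>. Continuity and
      boundedness of \<open>a\<close> make it vanish in the limit without any rate.\<close>
    define E where "E t = (LINT z|lborel. std_normal_density z * norm (a (x0 + e t * z) - a x0))" for t
    have e0: "(e \<longlongrightarrow> 0) at_top"
      unfolding e_def[abs_def] using B by real_asymp
    have "(E \<longlongrightarrow> (LINT z|(lborel :: real measure). 0)) at_top"
      unfolding E_def[abs_def]
    proof (rule integral_dominated_convergence_at_top[where f = "\<lambda>_. 0"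
        and s = "\<lambda>t z. std_normal_density z * norm (a (x0 + e t * z) - a x0)" and w = "\<lambda>z. std_normal_density z * (2 * M)"])
      show "integrable lborel (\<lambda>z. std_normal_density z * (2 * M))"
        by (intro integrable_mult_left integral_std_normal)
      show "AE z in lborel. ((\<lambda>t. std_normal_density z * norm (a (x0 + e t * z) - a x0)) \<longlongrightarrow> 0) at_top"
      proof (rule AE_I2)
        fix z
        have "((\<lambda>t. x0 + e t * z) \<longlongrightarrow> x0 + 0 * z) at_top" by (intro tendsto_intros e0)
        then have "((\<lambda>t. x0 + e t * z) \<longlongrightarrow> x0) at_top" by simp
        from isCont_tendsto_compose[OF ac this]
        have "((\<lambda>t. std_normal_density z * norm (a (x0 + e t * z) - a x0)) \<longlongrightarrow> std_normal_density z * norm (a x0 - a x0)) at_top"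
          by (intro tendsto_intros)
        then show "((\<lambda>t. std_normal_density z * norm (a (x0 + e t * z) - a x0)) \<longlongrightarrow> 0) at_top" by simp
      qed
      have "norm (a y - a x0) \<le> 2 * M" for y
        using norm_triangle_ineq4[of "a y" "a x0"] ab[of y] ab[of x0] by linarith
      then show "\<forall>\<^sub>F t in at_top. AE z in lborel. norm (std_normal_density z * norm (a (x0 + e t * z) - a x0)) \<le> std_normal_density z * (2 * M)"
        by (intro always_eventually allI AE_I2) (simp add: abs_mult mult_left_mono)
    qed measurable
    then have E0: "(E \<longlongrightarrow> 0) at_top" by simp
    \<comment> \<open>One eighth leaves \<open>5/8 - 1/8 = 1/2\<close> of
      \<open>norm (a x0)\<close>.\<close>
    have "\<forall>\<^sub>F t in at_top. E t < norm (a x0) / 8"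
      using aq q by (intro order_tendstoD[OF E0]) linarith
    then show "\<forall>\<^sub>F t in at_top. ereal c \<le> Linf_norm (\<lambda>X. complex_of_real (1 / sqrt t) * zeta_R \<mu> P t X)"
      using eventually_gt_at_top[of 0]
    proof eventually_elim
      case (elim t)
      then have t: "t > 0" and Et: "E t < norm (a x0) / 8" by auto
      have et: "e t > 0" using B t by (simp add: e_def)
      \<comment> \<open>This centre cancels the linear term of the phase; the constant term is
        removed in \<open>\<theta>\<close> and costs only a unimodular factor.\<close>
      define X0 where "X0 = t * disp1 (sqrt \<mu> * x0)"
      define \<psi> where "\<psi> z = e t * z * X0 - t * phase \<mu> (x0 + e t * z)" for z
      have [measurable]: "\<psi> \<in> borel_measurable borel" unfolding \<psi>_def by measurable
      define \<theta> where "\<theta> z = \<psi> z + t * phase \<mu> x0" for z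
      have \<theta>b: "\<bar>\<theta> z\<bar> \<le> z\<^sup>2 / 2" for z
      proof -
        have "\<theta> z = - (t * (phase \<mu> (x0 + e t * z) - phase \<mu> x0 - disp1 (sqrt \<mu> * x0) * (e t * z)))"
          by (simp add: \<theta>_def \<psi>_def X0_def algebra_simps)
        then have "\<bar>\<theta> z\<bar> = t * \<bar>phase \<mu> (x0 + e t * z) - phase \<mu> x0 - disp1 (sqrt \<mu> * x0) * (e t * z)\<bar>"
          using t by (simp add: abs_mult)
        also have "\<dots> \<le> t * (B * (e t * z)\<^sup>2 / 2)"
          unfolding B_def using t by (intro mult_left_mono phase_taylor \<mu> x0) auto
        also have "\<dots> = t * B * (e t)\<^sup>2 * z\<^sup>2 / 2" by (simp add: power_mult_distrib)
        also have "t * B * (e t)\<^sup>2 = 1" using t B by (simp add: e_def power_divide)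
        finally show ?thesis by simp
      qed
      define J where "J = (LINT z|lborel. of_real (std_normal_density z) * cis (\<psi> z))"
      define I where "I = (LINT z|lborel. of_real (std_normal_density z) * (a (x0 + e t * z) * cis (\<psi> z)))"
      have "5 / 8 \<le> norm (LINT z|lborel. of_real (std_normal_density z) * cis (\<theta> z))"
        by (rule gaussian_oscillation_lower[OF _ \<theta>b]) (simp add: \<theta>_def)
      also have "(LINT z|lborel. of_real (std_normal_density z) * cis (\<theta> z)) = (LINT z|lborel. cis (t * phase \<mu> x0) * (of_real (std_normal_density z) * cis (\<psi> z)))"
      proof -
        have "cis (\<theta> z) = cis (t * phase \<mu> x0) * cis (\<psi> z)" for z
          by (simp add: \<theta>_def cis_mult add.commute)
        then show ?thesis by (simp only: mult.left_commute)
      qed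
      also have "\<dots> = cis (t * phase \<mu> x0) * J" by (simp add: J_def)
      finally have J: "5 / 8 \<le> norm J" by (simp add: norm_mult)
      have iJ: "integrable lborel (\<lambda>z. of_real (std_normal_density z) * cis (\<psi> z))"
        by (rule Bochner_Integration.integrable_bound[OF integral_std_normal(1)]) (auto simp: norm_mult)
      have iI: "integrable lborel (\<lambda>z. of_real (std_normal_density z) * (a (x0 + e t * z) * cis (\<psi> z)))"
      proof (rule Bochner_Integration.integrable_bound[OF integrable_mult_left[OF integral_std_normal(1), of M]])
        show "AE z in lborel. norm (of_real (std_normal_density z) * (a (x0 + e t * z) * cis (\<psi> z))) \<le> norm (std_normal_density z * M)"
        proof (rule AE_I2)
          fix z
          have "norm (a (x0 + e t * z)) \<le> \<bar>M\<bar>" using ab[of "x0 + e t * z"] by linarith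
          then show "norm (of_real (std_normal_density z) * (a (x0 + e t * z) * cis (\<psi> z))) \<le> norm (std_normal_density z * M)"
            by (simp add: norm_mult abs_mult mult_left_mono)
        qed
      qed measurable
      have IJ: "I - a x0 * J = (LINT z|lborel. of_real (std_normal_density z) * (a (x0 + e t * z) * cis (\<psi> z)) - a x0 * (of_real (std_normal_density z) * cis (\<psi> z)))"
        unfolding I_def J_def using iI iJ by simp
      have "norm (I - a x0 * J) \<le> (LINT z|lborel. norm (of_real (std_normal_density z) * (a (x0 + e t * z) * cis (\<psi> z)) - a x0 * (of_real (std_normal_density z) * cis (\<psi> z))))"
        unfolding IJ by (rule integral_norm_bound)
      also have "\<dots> = E t"
      proof -
        have "S * (A * C) - A' * (S * C) = S * (A - A') * C" for S A A' C :: complex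
          by (simp add: algebra_simps)
        then show ?thesis
          by (simp only: E_def norm_mult norm_of_real norm_cis mult_1_right abs_of_nonneg[OF normal_density_nonneg])
      qed
      finally have "norm (I - a x0 * J) \<le> E t" .
      moreover have "norm (a x0) * (5 / 8) \<le> norm (a x0 * J)"
        unfolding norm_mult by (rule mult_left_mono[OF J norm_ge_zero])
      ultimately have I: "norm (a x0) / 2 \<le> norm I"
        using Et norm_triangle_ineq2[of "a x0 * J" I] by (simp add: norm_minus_commute)
      show ?case
      proof (rule ccontr)
        assume "\<not> ?case"
        then have lt: "Linf_norm (\<lambda>X. complex_of_real (1 / sqrt t) * zeta_R \<mu> P t X) < ereal c" by simp
        have "AE X in lebesgue. ereal (norm (complex_of_real (1 / sqrt t) * zeta_R \<mu> P t X))
            \<le> Linf_norm (\<lambda>X. complex_of_real (1 / sqrt t) * zeta_R \<mu> P t X)"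
          unfolding Linf_norm_def by (rule esssup_AE)
        then have "AE X in lebesgue. norm (zeta_R \<mu> P t X) \<le> c * sqrt t"
        proof eventually_elim
          case (elim X)
          then have "ereal (norm (complex_of_real (1 / sqrt t) * zeta_R \<mu> P t X)) < ereal c"
            using lt by (rule le_less_trans)
          then have "norm (zeta_R \<mu> P t X) / sqrt t < c"
            using t by (simp add: norm_mult norm_divide)
          then show ?case using t by (simp add: pos_divide_less_eq)
        qed
        from zeta_R_pairing[OF f fh \<mu>(1) t et this, of x0 X0]
        have "t / 2 * (e t * sqrt (2 * pi) * norm I) \<le> c * sqrt t"
          unfolding I_def a_def \<psi>_def by (simp only: mult.assoc)
        moreover have "t * e t = sqrt t / sqrt B"
        proof -
          have "u * u * (1 / (v * u)) = u / v" if "u > 0" for u v :: real using that by simp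
          from this[of "sqrt t" "sqrt B"] show ?thesis using t by (simp add: e_def real_sqrt_mult)
        qed
        moreover have "t / 2 * (e t * sqrt (2 * pi) * norm I) = (t * e t) * (sqrt (2 * pi) * norm I / 2)" by simp
        ultimately have "sqrt t / sqrt B * (sqrt (2 * pi) * norm I / 2) \<le> c * sqrt t" by (simp only:)
        then have "sqrt t * (sqrt (2 * pi) * norm I / (2 * sqrt B)) \<le> sqrt t * c" by (simp add: mult.commute)
        then have "sqrt (2 * pi) * norm I / (2 * sqrt B) \<le> c"
          by (rule mult_left_le_imp_le) (use t in simp)
        then have "sqrt (2 * pi) * norm I \<le> q / 2"
          using mult_right_mono[of _ c "2 * sqrt B"] B by (fastforce simp: c_def)
        moreover have "1 < sqrt (2 * pi)" using pi_gt3 by simp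
        moreover have "q / 2 \<le> norm I" using aq I by linarith
        ultimately show False using q mult_strict_right_mono[of 1 "sqrt (2 * pi)" "norm I"] by linarith
      qed
    qed
  qed
  then show ?thesis using c by blast
qed

theorem corollary3p11:
  fixes \<mu>max :: real
  assumes "\<mu>max > 0"
  shows
    "(\<exists>C>0. \<forall>P\<^sub>0 \<mu> t.
        H3 P\<^sub>0 \<and> sobolev 2 1 P\<^sub>0 \<and> H3 (\<lambda>X. X * P\<^sub>0 X) \<and> fourier P\<^sub>0 0 \<noteq> 0 \<and>
        0 < \<mu> \<and> \<mu> \<le> \<mu>max \<and> 0 < t \<longrightarrow>
        Linf_norm (zeta_R \<mu> P\<^sub>0 t) \<le>
          ereal (C * sqrt (t / \<mu>) *
            (H3_norm P\<^sub>0 + Lp_norm 1 P\<^sub>0 + H3_norm (\<lambda>X. X * P\<^sub>0 X)))) \<and>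
     (\<forall>P\<^sub>0.
        H3 P\<^sub>0 \<and> sobolev 2 1 P\<^sub>0 \<and> H3 (\<lambda>X. X * P\<^sub>0 X) \<and> fourier P\<^sub>0 0 \<noteq> 0 \<longrightarrow>
        (\<exists>c>0. \<forall>\<mu>. 0 < \<mu> \<and> \<mu> \<le> \<mu>max \<longrightarrow>
          Liminf at_top (\<lambda>t::real.
            Linf_norm (\<lambda>X. complex_of_real (1 / sqrt t) * zeta_R \<mu> P\<^sub>0 t X)) \<ge> ereal c))"
proof (intro conjI allI impI)
  have "0 < 7 * (16 * pi * (1 + \<mu>max) + 1 + 5 * pi / 2)"
    using assms by (simp add: add_pos_pos)
  then show "\<exists>C>0. \<forall>P\<^sub>0 \<mu> t.
        H3 P\<^sub>0 \<and> sobolev 2 1 P\<^sub>0 \<and> H3 (\<lambda>X. X * P\<^sub>0 X) \<and> fourier P\<^sub>0 0 \<noteq> 0 \<and>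
        0 < \<mu> \<and> \<mu> \<le> \<mu>max \<and> 0 < t \<longrightarrow>
        Linf_norm (zeta_R \<mu> P\<^sub>0 t) \<le>
          ereal (C * sqrt (t / \<mu>) *
            (H3_norm P\<^sub>0 + Lp_norm 1 P\<^sub>0 + H3_norm (\<lambda>X. X * P\<^sub>0 X)))"
    using zeta_R_upper by blast
qed (use assms zeta_R_lower in blast)

end
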